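(* FFRob is probabilistically complete and exponentially convergent over the class of robustly feasible PPM (pick-place-move) problems. That is, for any robustly feasible PPM problem, the probability that FFRob halts and returns a solution is one in the limit as the number of time steps goes to infinity, and the probability that FFRob has not terminated and returned a solution decreases exponentially in the number of time steps.
   Context: **PPM domain.** There are $m$ movable rigid objects $o_1,\dots,o_m$; a robot configuration space $\mathcal{Q}\subseteq\mathbb{R}^d$ (taking into account joint limits and collisions with fixed obstacles); and for each $i$ a space $\mathcal{P}^{o_i}$ of legal placement poses of $o_i$ and a space $\mathcal{G}^{o_i}$ of grasps $g=(o_i,\gamma)$, where $\gamma=\mathrm{transform}(g)$ is the rigid transform relating the robot's end-effector pose and the object pose while $o_i$ is held. A state assigns a configuration $q\in D_r=\mathcal{Q}$, a grasp $g\in D_h=\bigcup_i\mathcal{G}^{o_i}\cup\{\mathrm{None}\}$, and for each $i$ a pose $p^{o_i}\in D_{o_i}=\mathcal{P}^{o_i}\cup\{\mathrm{None}\}$; the robot can hold only one object, and the pose of a held object is set to $\mathrm{None}$. A state is legal if there are no collisions among the robot, the held object and the placed objects. **PPM problem.** $\Pi=\langle s_0,S_*\rangle$, where the initial state $s_0=(q_0,g_0^{o_{h_0}},p_0^{o_1},\dots,p_0^{o_m})$ is legal and $S_*$ is the set of legal states in $Q_*\times G_*^{o_{h_*}}\times P_*^{o_1}\times\cdots\times P_*^{o_m}$, with $Q_*\subseteq D_r$, $G_*^{o_{h_*}}\subseteq D_h$, $P_*^{o_i}\subseteq D_{o_i}$ (an unspecified goal set defaults to the full domain); $o_{h_*}$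 is the object with a holding goal, if any. **Measures.** $\mu(E;X)$ denotes a measure on subsets $E$ of a space $X$ that assigns finite, nonzero measure to $X$ (e.g. Lebesgue, counting, or Haar measure as appropriate), and $\tilde\mu(E;X)=\mu(E;X)/\mu(X;X)$. $x\sim X$ means $x$ is drawn uniformly at random from $X$. For an end-effector transform $t$, $Q_{ik}(t)=\{q\in\mathcal{Q}:\mathrm{end\text{-}effector}(q)=t\}$. It is assumed that one can randomly sample from $Q_{ik}(t)$ with probability density bounded away from zero by some $\kappa>0$. **Modes.** A transit mode $\psi=\langle\mathrm{None},\{p^{o_j}\}_{j\in[m]}\rangle$ fixes a pose $p^{o_j}\in\mathcal{P}^{o_j}$ for every object. A transfer mode $\phi=\langle g^{o_h},\{p^{o_j}\}_{j\neq h}\rangle$ fixes a grasp $g^{o_h}\in\mathcal{G}^{o_h}$ of one object $o_h$ and a pose for every other object. A mode is legal if there are no collisions among the placed objects. $Q_\psi\subseteq\mathcal{Q}$ is the set of configurations at which the robot does not collide with the placed objects; $Q_\phi\subseteq\mathcal{Q}$ is the set of configurations at which neither the robot nor $o_h$ (held at $g^{o_h}$) collides with the placed objects and $o_h$ does not intersect the robot. A transit mode $\psi$ and a transfer mode $\phi$ holding $o_h$ are adjacent iff the poses of all objects other than $o_h$ agree in both modes and $Q_\psi\cap Q_\phi\neq\emptyset$. With $t(\psi,\phi)=t(\phi,\psi)=p_\psi^{o_h}\times\mathrm{transform}(g_\phi^{o_h})^{-1}$, the set $Q_\psi\cap Q_\phi\subseteq Q_{ik}(t(\psi,\phi))$ is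 regarded as the collision-free subset of the inverse kinematics solutions for the end-effector transform at the mode switch. A mode sequence is a sequence $(\omega_1,\dots,\omega_k)$ of legal modes with consecutive ones adjacent (so it alternates between transit and transfer modes). **Robust motion planning.** A motion planning problem in $Q\subseteq\mathbb{R}^d$ from $q^0\in Q$ to $q^*\in Q$ is robustly feasible if there exist $\delta>0$ and a trajectory $\tau:[0,L]\to Q$ of length $L$ from some $q^0_+\in Q$ to some $q^*_+\in Q$ such that every point of $\tau$ has distance at least $\delta$ from $\partial Q$; for every $q\in Q$ with $\|q-q^0_+\|\le\delta/2$ the segment from $q^0$ to $q$ lies in $Q$; and for every $q'\in Q$ with $\|q'-q^*_+\|\le\delta/2$ the segment from $q'$ to $q^*$ lies in $Q$. The $\omega$-mode-constrained motion planning problem is the one with $Q=Q_\omega$. **Robust multi-mode problem.** For a mode sequence $(\omega_1,\dots,\omega_k)$, the multi-mode-constrained motion planning problem from $q_0$ to $Q_*$ is robustly feasible if there exist sets of configurations $Q_0,\dots,Q_k$ and $\epsilon>0$ such that: $Q_0=\{q_0\}$; for all $i\in[k-1]$, $Q_i\subseteq Q_{ik}(t(\omega_i,\omega_{i+1}))$ and $\tilde\mu(Q_i;Q_{ik}(t(\omega_i,\omega_{i+1})))\ge\epsilon$; $Q_k\subseteq Q_*$ and $\tilde\mu(Q_k;Q_* )\ge\epsilon$; and for all $i\in[k]$, all $q_i^0\in Q_{i-1}$ and all $q_i^*\in Q_i$, the $\omega_i$-mode-constrained motion planning problem from $q_i^0$ to $q_i^*$ is robustly feasible. **Robust PPM problem.**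 Starting from $\omega_1$, a mode sequence is described by its successive parameters: each later transfer mode $\omega_j$ by its grasp of an object $o_{h_j}$, and each later transit mode $\omega_i$ by the new pose of the object $o_{h_{i-1}}$ held in $\omega_{i-1}$. A set $\theta$ of length-$k$ mode sequences is given as a product of sets of values $G_j^{o_{h_j}}\subseteq\mathcal{G}^{o_{h_j}}$ and $P_i^{o_{h_{i-1}}}\subseteq\mathcal{P}^{o_{h_{i-1}}}$ for these parameters. $\Pi$ is robustly feasible if there exists such a set $\theta$ of length-$k$ mode sequences, with transfer modes involving a common sequence of objects, such that: for every $(\omega_1,\dots,\omega_k)\in\theta$, $\omega_1$ is the mode of $s_0$, the grasp of $\omega_k$ is in $G_*^{o_{h_*}}$ and the pose of each $o_j$ in $\omega_k$ is in $P_*^{o_j}$, and the multi-mode-constrained motion planning problem from $q_0$ to $Q_*$ along $(\omega_1,\dots,\omega_k)$ is robustly feasible; and $\tilde\mu(P_i^{o_{h_{i-1}}})>0$ for each set of transit-mode poses and $\tilde\mu(G_j^{o_{h_j}})>0$ for each set of transfer-mode grasps. Here $\tilde\mu(P_i^{o_{h_{i-1}}})$ is $\tilde\mu(P_i^{o_{h_{i-1}}};P_*^{o_{h_{i-1}}})$ if $P_i^{o_{h_{i-1}}}\subseteq P_*^{o_{h_{i-1}}}$ and $\tilde\mu(P_i^{o_{h_{i-1}}};\mathcal{P}^{o_{h_{i-1}}})$ otherwise; $\tilde\mu(G_j^{o_{h_j}})$ is $\tilde\mu(G_j^{o_{h_j}};G_*^{o_{h_*}})$ if $o_{h_j}=o_{h_*}$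 and $G_j^{o_{h_j}}\subseteq G_*^{o_{h_*}}$, and $\tilde\mu(G_j^{o_{h_j}};\mathcal{G}^{o_{h_j}})$ otherwise. **FFRob (the simplified version analyzed).** Initially, for each $i$: $P^{o_i}(0)=\{p_0^{o_i}\}$ and $G^{o_i}(0)=\emptyset$ if $p_0^{o_i}\neq\mathrm{None}$, otherwise $P^{o_i}(0)=\emptyset$ and $G^{o_i}(0)=\{g_0^{o_i}\}$; $Q^{o_i}(0)=\emptyset$; $V(0)=\{q_0\}$. On sampling iteration $n\ge1$, for each $i$, with independent draws: $P^{o_i}(n)=P^{o_i}(n-1)\cup\{p^{o_i},p_*^{o_i}\}$ with $p^{o_i}\sim\mathcal{P}^{o_i}$, $p_*^{o_i}\sim P_*^{o_i}$; $G^{o_i}(n)=G^{o_i}(n-1)\cup\{g^{o_i},g_*^{o_i}\}$ with $g^{o_i}\sim\mathcal{G}^{o_i}$ and, only when $o_i=o_{h_*}$, $g_*^{o_i}\sim G_*^{o_{h_*}}$; $Q^{o_i}(n)$ is $Q^{o_i}(n-1)$ together with one new inverse kinematics sample from $Q_{ik}(p\times\mathrm{transform}(g)^{-1})$ for every $p\in P^{o_i}(n)$, $g\in G^{o_i}(n)$. Then $V(n)=V(n-1)\cup Q^{o_1}(n)\cup\dots\cup Q^{o_m}(n)\cup\{q,q_*\}$ with $q\sim\mathcal{Q}$, $q_*\sim Q_*$, and $E(n)$ consists of all pairs of configurations in $V(n)$ whose connecting straight segment lies in $\mathcal{Q}$. A complete, unguided discrete search (such as Dijkstra's algorithm on the graph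 of states and actions) is then run from $s_0$ for a plan reaching $S_*$ using the actions: Move$(q,q')$ for $q\neq q'\in V(n)$, which changes the configuration from $q$ to $q'$ and is applicable when $(V(n),E(n))$ contains a path from $q$ to $q'$ that is collision-free with respect to the current placed objects and held object; and Pick$(o_i,p,g,q)$, Place$(o_i,p,g,q)$ for $p\in P^{o_i}(n)$, $g\in G^{o_i}(n)$, $q\in Q^{o_i}(n)\cap Q_{ik}(p\times\mathrm{transform}(g)^{-1})$, where Pick requires the robot at $q$ with empty hand and $o_i$ at $p$ and results in holding $o_i$ with $g$, and Place requires the robot at $q$ holding $o_i$ with $g$ and results in an empty hand and $o_i$ at $p$. FFRob terminates and returns the plan if and when the discrete search finds one; otherwise it goes on to the next iteration. Time steps count all sampling and discrete-search operations over all iterations. **Definitions.** An algorithm is probabilistically complete over a class of problems iff the probability that it halts and returns a solution is one in the limit as the number of time steps goes to infinity. It is exponentially convergent over a class of problems iff the probability that it has not terminated and returned a solution decreases exponentially in the number of time steps.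
   Formalization: The failure probability is shown to be at most C exp(-a t^b), some b>0, in the number t of time steps, and exponentially small in sampling iterations; exp(-a t) is false as iterations make growing numbers of draws. The discrete search is assumed polynomial in the number of states. *)

theory Defs
  imports "HOL-Probability.Probability"
begin

section \<open>Rigid transforms\<close>

text \<open>The pair \<open>(R, v)\<close> with a rotation matrix \<open>R\<close> stands for the map \<open>x \<mapsto> R x + v\<close> of the
  workspace, which is the Euclidean space indexed by \<open>'w\<close> (two or three dimensional in practice).\<close>

type_synonym 'w rigid = "(real^'w^'w) \<times> (real^'w)"

definition rigid_transforms :: "'w::finite rigid set" where
  "rigid_transforms = {(R, v). rotation_matrix R}"

definition rapply :: "'w::finite rigid \<Rightarrow> real^'w \<Rightarrow> real^'w" where
  "rapply T x = fst T *v x + snd T"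

definition rmul :: "'w::finite rigid \<Rightarrow> 'w rigid \<Rightarrow> 'w rigid" where
  "rmul S T = (fst S ** fst T, fst S *v snd T + snd S)"

definition rinv :: "'w::finite rigid \<Rightarrow> 'w rigid" where
  "rinv T = (transpose (fst T), - (transpose (fst T) *v snd T))"


section \<open>Pick-place-move problems\<close>

text \<open>A grasp is a pair of an object and a rigid transform. The mode part of a state consists of
  the grasp in the hand (if any) and of the poses of the objects (\<open>None\<close> for a held object), so
  that a state is a configuration together with a mode.\<close>

type_synonym ('w, 'o) grasp = "'o \<times> 'w rigid"
type_synonym ('w, 'o) mode = "('w, 'o) grasp option \<times> ('o \<Rightarrow> 'w rigid option)"
type_synonym ('d, 'w, 'o) state = "(real^'d) \<times> ('w, 'o) mode"

text \<open>The elements of \<open>'o\<close> are the movable objects. The robot bodies and the object bodies are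
  the sets of points of the workspace they occupy; \<open>object_body i\<close> is relative to the frame of
  the object. \<open>grasp_space i\<close> contains the transforms \<open>\<gamma>\<close> of the grasps \<open>(i, \<gamma>)\<close> of \<open>i\<close>.

  The fields ending in \<open>_mu\<close> are the measures \<open>\<mu>(\<sqdot>; X)\<close> belonging to the respective spaces \<open>X\<close>;
  on the configuration space the measure is Lebesgue measure. \<open>ik_sampler u t\<close> is the inverse
  kinematics sampler for the end-effector transform \<open>t\<close>, driven by a random seed \<open>u\<close> that is
  uniform on the unit interval: this covers every measurable family of sampling distributions.\<close>

record ('d::finite, 'w::finite, 'o::finite) ppm =
  conf_space :: "(real^'d) set"
  robot_body :: "real^'d \<Rightarrow> (real^'w) set"
  end_effector :: "real^'d \<Rightarrow> 'w rigid"
  object_body :: "'o \<Rightarrow> (real^'w) set"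
  pose_space :: "'o \<Rightarrow> 'w rigid set"
  grasp_space :: "'o \<Rightarrow> 'w rigid set"
  init_conf :: "real^'d"
  init_hand :: "('w, 'o) grasp option"
  init_pose :: "'o \<Rightarrow> 'w rigid option"
  goal_conf :: "(real^'d) set"
  goal_hand :: "('w, 'o) grasp option set"
  goal_pose :: "'o \<Rightarrow> 'w rigid option set"
  goal_object :: "'o option"
  pose_mu :: "'o \<Rightarrow> 'w rigid measure"
  grasp_mu :: "'o \<Rightarrow> 'w rigid measure"
  goal_conf_mu :: "(real^'d) measure"
  goal_pose_mu :: "'o \<Rightarrow> 'w rigid measure"
  goal_grasp_mu :: "'w rigid measure"
  ik_mu :: "'w rigid \<Rightarrow> (real^'d) measure"
  ik_sampler :: "real \<Rightarrow> 'w rigid \<Rightarrow> real^'d"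

definition ik_confs :: "('d::finite, 'w::finite, 'o::finite) ppm \<Rightarrow> 'w rigid \<Rightarrow> (real^'d) set" where
  "ik_confs \<P> t = {q \<in> conf_space \<P>. end_effector \<P> q = t}"

definition placed_body ::
    "('d::finite, 'w::finite, 'o::finite) ppm \<Rightarrow> 'o \<Rightarrow> 'w rigid \<Rightarrow> (real^'w) set" where
  "placed_body \<P> i p = rapply p ` object_body \<P> i"

definition held_body ::
    "('d::finite, 'w::finite, 'o::finite) ppm \<Rightarrow> ('w, 'o) grasp \<Rightarrow> real^'d \<Rightarrow> (real^'w) set" where
  "held_body \<P> g q = placed_body \<P> (fst g) (rmul (end_effector \<P> q) (snd g))"

definition transit_mode :: "('d::finite, 'w::finite, 'o::finite) ppm \<Rightarrow> ('w, 'o) mode \<Rightarrow> bool" where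
  "transit_mode \<P> \<omega> \<longleftrightarrow>
     fst \<omega> = None \<and> (\<forall>j. \<exists>p \<in> pose_space \<P> j. snd \<omega> j = Some p)"

definition transfer_mode ::
    "('d::finite, 'w::finite, 'o::finite) ppm \<Rightarrow> 'o \<Rightarrow> ('w, 'o) mode \<Rightarrow> bool" where
  "transfer_mode \<P> h \<omega> \<longleftrightarrow>
     (\<exists>\<gamma> \<in> grasp_space \<P> h. fst \<omega> = Some (h, \<gamma>)) \<and> snd \<omega> h = None \<and>
     (\<forall>j. j \<noteq> h \<longrightarrow> (\<exists>p \<in> pose_space \<P> j. snd \<omega> j = Some p))"

definition legal_mode :: "('d::finite, 'w::finite, 'o::finite) ppm \<Rightarrow> ('w, 'o) mode \<Rightarrow> bool" where
  "legal_mode \<P> \<omega> \<longleftrightarrow>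
     (transit_mode \<P> \<omega> \<or> (\<exists>h. transfer_mode \<P> h \<omega>)) \<and>
     (\<forall>i j p p'. i \<noteq> j \<and> snd \<omega> i = Some p \<and> snd \<omega> j = Some p' \<longrightarrow>
        placed_body \<P> i p \<inter> placed_body \<P> j p' = {})"

definition mode_confs ::
    "('d::finite, 'w::finite, 'o::finite) ppm \<Rightarrow> ('w, 'o) mode \<Rightarrow> (real^'d) set" where
  "mode_confs \<P> \<omega> = {q \<in> conf_space \<P>.
     (\<forall>j p. snd \<omega> j = Some p \<longrightarrow> robot_body \<P> q \<inter> placed_body \<P> j p = {}) \<and>
     (\<forall>g. fst \<omega> = Some g \<longrightarrow>
        robot_body \<P> q \<inter> held_body \<P> g q = {} \<and>
        (\<forall>j p. snd \<omega> j = Some p \<longrightarrow> held_body \<P> g q \<inter> placed_body \<P> j p = {}))}"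

definition legal_state :: "('d::finite, 'w::finite, 'o::finite) ppm \<Rightarrow> ('d, 'w, 'o) state \<Rightarrow> bool" where
  "legal_state \<P> s \<longleftrightarrow> legal_mode \<P> (snd s) \<and> fst s \<in> mode_confs \<P> (snd s)"

definition init_mode :: "('d::finite, 'w::finite, 'o::finite) ppm \<Rightarrow> ('w, 'o) mode" where
  "init_mode \<P> = (init_hand \<P>, init_pose \<P>)"

definition init_state :: "('d::finite, 'w::finite, 'o::finite) ppm \<Rightarrow> ('d, 'w, 'o) state" where
  "init_state \<P> = (init_conf \<P>, init_mode \<P>)"

definition goal_mode :: "('d::finite, 'w::finite, 'o::finite) ppm \<Rightarrow> ('w, 'o) mode \<Rightarrow> bool" where
  "goal_mode \<P> \<omega> \<longleftrightarrow> fst \<omega> \<in> goal_hand \<P> \<and> (\<forall>j. snd \<omega> j \<in> goal_pose \<P> j)"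

definition goal_states :: "('d::finite, 'w::finite, 'o::finite) ppm \<Rightarrow> ('d, 'w, 'o) state set" where
  "goal_states \<P> = {s. legal_state \<P> s \<and> fst s \<in> goal_conf \<P> \<and> goal_mode \<P> (snd s)}"

text \<open>Actual poses and actual grasps admitted by the goal, without \<open>None\<close>.\<close>

definition goal_placements :: "('d::finite, 'w::finite, 'o::finite) ppm \<Rightarrow> 'o \<Rightarrow> 'w rigid set" where
  "goal_placements \<P> i = {p. Some p \<in> goal_pose \<P> i}"

definition goal_grasps :: "('d::finite, 'w::finite, 'o::finite) ppm \<Rightarrow> 'o \<Rightarrow> 'w rigid set" where
  "goal_grasps \<P> i = {\<gamma>. Some (i, \<gamma>) \<in> goal_hand \<P>}"

definition measure_on :: "'a::topological_space measure \<Rightarrow> 'a set \<Rightarrow> bool" where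
  "measure_on M X \<longleftrightarrow>
     sets M = sets borel \<and> X \<in> sets borel \<and> emeasure M X \<noteq> 0 \<and> emeasure M X \<noteq> \<infinity>"

definition seed_law :: "real measure" where
  "seed_law = uniform_measure lborel {0..1}"

text \<open>The distribution of the sampler has a density with respect to the measure on the set of
  inverse kinematics solutions which is at least \<open>\<kappa>\<close> there.\<close>

definition ik_sampling :: "('d::finite, 'w::finite, 'o::finite) ppm \<Rightarrow> bool" where
  "ik_sampling \<P> \<longleftrightarrow>
     (\<lambda>(u, t). ik_sampler \<P> u t) \<in> borel_measurable borel \<and>
     (\<exists>\<kappa>::real. 0 < \<kappa> \<and>
       (\<forall>t. ik_confs \<P> t \<noteq> {} \<longrightarrow>
          measure_on (ik_mu \<P> t) (ik_confs \<P> t) \<and>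
          (\<exists>f \<in> borel_measurable borel.
             (\<forall>q \<in> ik_confs \<P> t. ennreal \<kappa> \<le> f q) \<and>
             distr seed_law borel (\<lambda>u. ik_sampler \<P> u t) =
               density (ik_mu \<P> t) (\<lambda>q. f q * indicator (ik_confs \<P> t) q))))"

text \<open>The tests made by the algorithm (segments in the configuration space and pairwise collision
  tests, at a configuration or along a segment) are Borel measurable in their parameters. Without
  this the probability that the algorithm halts need not be defined.\<close>

definition measurable_tests :: "('d::finite, 'w::finite, 'o::finite) ppm \<Rightarrow> bool" where
  "measurable_tests \<P> \<longleftrightarrow>
     end_effector \<P> \<in> borel_measurable borel \<and>
     {(q, q'). closed_segment q q' \<subseteq> conf_space \<P>} \<in> sets borel \<and>
     (\<forall>j. {(q, q', p). \<forall>x \<in> closed_segment q q'.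
            robot_body \<P> x \<inter> placed_body \<P> j p = {}} \<in> sets borel) \<and>
     (\<forall>i. {(q, q', \<gamma>). \<forall>x \<in> closed_segment q q'.
            robot_body \<P> x \<inter> held_body \<P> (i, \<gamma>) x = {}} \<in> sets borel) \<and>
     (\<forall>i j. i \<noteq> j \<longrightarrow> {(q, q', \<gamma>, p). \<forall>x \<in> closed_segment q q'.
            held_body \<P> (i, \<gamma>) x \<inter> placed_body \<P> j p = {}} \<in> sets borel) \<and>
     (\<forall>i j. i \<noteq> j \<longrightarrow> {(p, p'). placed_body \<P> i p \<inter> placed_body \<P> j p' = {}} \<in> sets borel)"

text \<open>If \<open>goal_object\<close> is \<open>Some h\<close>, the goal requires to hold \<open>h\<close>; otherwise the goal set of
  grasps is an arbitrary set, usually the full domain.\<close>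

definition ppm_problem :: "('d::finite, 'w::finite, 'o::finite) ppm \<Rightarrow> bool" where
  "ppm_problem \<P> \<longleftrightarrow>
     measure_on lborel (conf_space \<P>) \<and>
     end_effector \<P> ` conf_space \<P> \<subseteq> rigid_transforms \<and>
     (\<forall>i. pose_space \<P> i \<subseteq> rigid_transforms \<and> measure_on (pose_mu \<P> i) (pose_space \<P> i)) \<and>
     (\<forall>i. grasp_space \<P> i \<subseteq> rigid_transforms \<and> measure_on (grasp_mu \<P> i) (grasp_space \<P> i)) \<and>
     legal_state \<P> (init_state \<P>) \<and>
     goal_conf \<P> \<subseteq> conf_space \<P> \<and> measure_on (goal_conf_mu \<P>) (goal_conf \<P>) \<and>
     (\<forall>i. goal_placements \<P> i \<subseteq> pose_space \<P> i \<and>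
        (goal_placements \<P> i \<noteq> {} \<longrightarrow> measure_on (goal_pose_mu \<P> i) (goal_placements \<P> i))) \<and>
     (\<forall>i. goal_grasps \<P> i \<subseteq> grasp_space \<P> i \<and> goal_grasps \<P> i \<in> sets borel) \<and>
     (\<forall>h. goal_object \<P> = Some h \<longrightarrow>
        goal_hand \<P> \<subseteq> {Some (h, \<gamma>) |\<gamma>. True} \<and>
        measure_on (goal_grasp_mu \<P>) (goal_grasps \<P> h)) \<and>
     ik_sampling \<P> \<and> measurable_tests \<P>"


section \<open>Mode sequences\<close>

text \<open>The transform \<open>p \<times> transform(g)\<^sup>-\<^sup>1\<close> of the end-effector at a pick or a place.\<close>

definition ee_transform :: "'w::finite rigid \<Rightarrow> 'w rigid \<Rightarrow> 'w rigid" where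
  "ee_transform p \<gamma> = rmul p (rinv \<gamma>)"

fun switch_transform :: "('w::finite, 'o) mode \<Rightarrow> ('w, 'o) mode \<Rightarrow> 'w rigid" where
  "switch_transform (None, ps) (Some (h, \<gamma>), ps') = ee_transform (the (ps h)) \<gamma>"
| "switch_transform (Some (h, \<gamma>), ps') (None, ps) = ee_transform (the (ps h)) \<gamma>"
| "switch_transform _ _ = undefined"

text \<open>The configurations at which a mode switch can take place are the collision-free inverse
  kinematics solutions: mere intersection of the two sets \<open>mode_confs\<close> would not force the robot
  to be at the end-effector transform of the switch.\<close>

definition transit_transfer_adjacent ::
    "('d::finite, 'w::finite, 'o::finite) ppm \<Rightarrow> ('w, 'o) mode \<Rightarrow> ('w, 'o) mode \<Rightarrow> bool" where
  "transit_transfer_adjacent \<P> \<psi> \<phi> \<longleftrightarrow>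
     (\<exists>h. transit_mode \<P> \<psi> \<and> transfer_mode \<P> h \<phi> \<and> (\<forall>j. j \<noteq> h \<longrightarrow> snd \<psi> j = snd \<phi> j) \<and>
        mode_confs \<P> \<psi> \<inter> mode_confs \<P> \<phi> \<inter> ik_confs \<P> (switch_transform \<psi> \<phi>) \<noteq> {})"

definition mode_adjacent ::
    "('d::finite, 'w::finite, 'o::finite) ppm \<Rightarrow> ('w, 'o) mode \<Rightarrow> ('w, 'o) mode \<Rightarrow> bool" where
  "mode_adjacent \<P> \<omega> \<omega>' \<longleftrightarrow>
     transit_transfer_adjacent \<P> \<omega> \<omega>' \<or> transit_transfer_adjacent \<P> \<omega>' \<omega>"

definition mode_sequence ::
    "('d::finite, 'w::finite, 'o::finite) ppm \<Rightarrow> ('w, 'o) mode list \<Rightarrow> bool" where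
  "mode_sequence \<P> \<omega>s \<longleftrightarrow> \<omega>s \<noteq> [] \<and> (\<forall>\<omega> \<in> set \<omega>s. legal_mode \<P> \<omega>) \<and>
     (\<forall>i. Suc i < length \<omega>s \<longrightarrow> mode_adjacent \<P> (\<omega>s ! i) (\<omega>s ! Suc i))"


section \<open>Robust feasibility\<close>

definition rel_measure :: "'a measure \<Rightarrow> 'a set \<Rightarrow> 'a set \<Rightarrow> real" where
  "rel_measure M X E = measure M E / measure M X"

definition curve_length :: "(real \<Rightarrow> 'a::metric_space) \<Rightarrow> real \<Rightarrow> real \<Rightarrow> ennreal" where
  "curve_length \<tau> a b =
     (SUP ts \<in> {ts. sorted ts \<and> set ts \<subseteq> {a..b}}.
        \<Sum>i < length ts - 1. ennreal (dist (\<tau> (ts ! i)) (\<tau> (ts ! Suc i))))"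

definition robust_motion :: "'a::euclidean_space set \<Rightarrow> 'a \<Rightarrow> 'a \<Rightarrow> bool" where
  "robust_motion Q q0 q1 \<longleftrightarrow> q0 \<in> Q \<and> q1 \<in> Q \<and>
     (\<exists>\<delta> > 0. \<exists>L \<ge> 0. \<exists>\<tau>.
        continuous_on {0..L} \<tau> \<and> curve_length \<tau> 0 L = ennreal L \<and> \<tau> ` {0..L} \<subseteq> Q \<and>
        (\<forall>s \<in> {0..L}. \<forall>x \<in> frontier Q. \<delta> \<le> dist (\<tau> s) x) \<and>
        (\<forall>q \<in> Q. norm (q - \<tau> 0) \<le> \<delta> / 2 \<longrightarrow> closed_segment q0 q \<subseteq> Q) \<and>
        (\<forall>q \<in> Q. norm (q - \<tau> L) \<le> \<delta> / 2 \<longrightarrow> closed_segment q q1 \<subseteq> Q))"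

text \<open>Lists are indexed from zero, so \<open>\<omega>s ! (i - 1)\<close> is the \<open>i\<close>-th mode.\<close>

definition robust_multi_mode ::
    "('d::finite, 'w::finite, 'o::finite) ppm \<Rightarrow> ('w, 'o) mode list \<Rightarrow> bool" where
  "robust_multi_mode \<P> \<omega>s \<longleftrightarrow>
     (\<exists>(Q :: nat \<Rightarrow> (real^'d) set) (\<epsilon>::real).
        0 < \<epsilon> \<and> Q 0 = {init_conf \<P>} \<and>
        (\<forall>i \<in> {1..<length \<omega>s}.
           let t = switch_transform (\<omega>s ! (i - 1)) (\<omega>s ! i)
           in Q i \<subseteq> ik_confs \<P> t \<and> \<epsilon> \<le> rel_measure (ik_mu \<P> t) (ik_confs \<P> t) (Q i)) \<and>
        Q (length \<omega>s) \<subseteq> goal_conf \<P> \<and>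
        \<epsilon> \<le> rel_measure (goal_conf_mu \<P>) (goal_conf \<P>) (Q (length \<omega>s)) \<and>
        (\<forall>i \<in> {1..length \<omega>s}. \<forall>q0 \<in> Q (i - 1). \<forall>q1 \<in> Q i.
           robust_motion (mode_confs \<P> (\<omega>s ! (i - 1))) q0 q1))"

text \<open>A mode sequence is described by its first mode, the successive mode switches and the values
  of their parameters: a grasp transform for \<open>Pick_up h\<close> and a pose for \<open>Put_down h\<close>. Switches that
  do not fit the current mode lead to sequences that are not mode sequences.\<close>

datatype 'o switch = Pick_up 'o | Put_down 'o

fun switch_mode :: "'o switch \<Rightarrow> 'w::finite rigid \<Rightarrow> ('w, 'o) mode \<Rightarrow> ('w, 'o) mode" where
  "switch_mode (Pick_up h) \<gamma> \<omega> = (Some (h, \<gamma>), (snd \<omega>)(h := None))"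
| "switch_mode (Put_down h) p \<omega> = (None, (snd \<omega>)(h := Some p))"

fun modes_from ::
    "('w::finite, 'o) mode \<Rightarrow> ('o switch \<times> 'w rigid) list \<Rightarrow> ('w, 'o) mode list" where
  "modes_from \<omega> [] = [\<omega>]"
| "modes_from \<omega> ((\<sigma>, x) # as) = \<omega> # modes_from (switch_mode \<sigma> x \<omega>) as"

fun switch_space :: "('d::finite, 'w::finite, 'o::finite) ppm \<Rightarrow> 'o switch \<Rightarrow> 'w rigid set" where
  "switch_space \<P> (Pick_up h) = grasp_space \<P> h"
| "switch_space \<P> (Put_down h) = pose_space \<P> h"

fun switch_measure ::
    "('d::finite, 'w::finite, 'o::finite) ppm \<Rightarrow> 'o switch \<Rightarrow> 'w rigid set \<Rightarrow> real" where
  "switch_measure \<P> (Pick_up h) G =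
     (if goal_object \<P> = Some h \<and> G \<subseteq> goal_grasps \<P> h
      then rel_measure (goal_grasp_mu \<P>) (goal_grasps \<P> h) G
      else rel_measure (grasp_mu \<P> h) (grasp_space \<P> h) G)"
| "switch_measure \<P> (Put_down h) P =
     (if P \<subseteq> goal_placements \<P> h
      then rel_measure (goal_pose_mu \<P> h) (goal_placements \<P> h) P
      else rel_measure (pose_mu \<P> h) (pose_space \<P> h) P)"

text \<open>The list \<open>\<theta>\<close> gives the common sequence of switches and the set of values of each
  parameter; the modes after the first one are determined by a choice \<open>xs\<close> of values.\<close>

definition robustly_feasible :: "('d::finite, 'w::finite, 'o::finite) ppm \<Rightarrow> bool" where
  "robustly_feasible \<P> \<longleftrightarrow> ppm_problem \<P> \<and>
     (\<exists>\<theta> :: ('o switch \<times> 'w rigid set) list.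
        (\<forall>(\<sigma>, X) \<in> set \<theta>. X \<subseteq> switch_space \<P> \<sigma> \<and> 0 < switch_measure \<P> \<sigma> X) \<and>
        (\<forall>xs. list_all2 (\<in>) xs (map snd \<theta>) \<longrightarrow>
           (let \<omega>s = modes_from (init_mode \<P>) (zip (map fst \<theta>) xs)
            in mode_sequence \<P> \<omega>s \<and> goal_mode \<P> (last \<omega>s) \<and> robust_multi_mode \<P> \<omega>s)))"


section \<open>The algorithm\<close>

text \<open>Outcome of the draws of one iteration: the poses drawn from the pose spaces and from the goal
  poses, the grasps drawn from the grasp spaces and from the goal grasps, the configurations drawn
  from the configuration space and from the goal configurations, and the seeds of the inverse
  kinematics sampler. All draws are independent.\<close>

type_synonym ('d, 'w, 'o) draw =
  "('o \<Rightarrow> 'w rigid) \<times> ('o \<Rightarrow> 'w rigid) \<times> ('o \<Rightarrow> 'w rigid) \<times> 'w rigid \<times>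
   (real^'d) \<times> (real^'d) \<times> ('o \<times> nat \<times> nat \<Rightarrow> real)"

type_synonym ('d, 'w, 'o) run = "nat \<Rightarrow> ('d, 'w, 'o) draw"

definition draw_pose :: "('d::finite, 'w::finite, 'o) draw \<Rightarrow> 'o \<Rightarrow> 'w rigid" where
  "draw_pose = (\<lambda>(p, p', g, g', q, q', u). p)"

definition draw_goal_pose :: "('d::finite, 'w::finite, 'o) draw \<Rightarrow> 'o \<Rightarrow> 'w rigid" where
  "draw_goal_pose = (\<lambda>(p, p', g, g', q, q', u). p')"

definition draw_grasp :: "('d::finite, 'w::finite, 'o) draw \<Rightarrow> 'o \<Rightarrow> 'w rigid" where
  "draw_grasp = (\<lambda>(p, p', g, g', q, q', u). g)"

definition draw_goal_grasp :: "('d::finite, 'w::finite, 'o) draw \<Rightarrow> 'w rigid" where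
  "draw_goal_grasp = (\<lambda>(p, p', g, g', q, q', u). g')"

definition draw_conf :: "('d::finite, 'w::finite, 'o) draw \<Rightarrow> real^'d" where
  "draw_conf = (\<lambda>(p, p', g, g', q, q', u). q)"

definition draw_goal_conf :: "('d::finite, 'w::finite, 'o) draw \<Rightarrow> real^'d" where
  "draw_goal_conf = (\<lambda>(p, p', g, g', q, q', u). q')"

definition draw_seed :: "('d::finite, 'w::finite, 'o) draw \<Rightarrow> 'o \<times> nat \<times> nat \<Rightarrow> real" where
  "draw_seed = (\<lambda>(p, p', g, g', q, q', u). u)"

text \<open>If there is no goal placement or no goal grasp to draw, the law below is a dummy, and the
  drawn value is not used.\<close>

definition goal_pose_law :: "('d::finite, 'w::finite, 'o::finite) ppm \<Rightarrow> 'o \<Rightarrow> 'w rigid measure" where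
  "goal_pose_law \<P> i =
     (if goal_placements \<P> i = {} then return borel undefined
      else uniform_measure (goal_pose_mu \<P> i) (goal_placements \<P> i))"

definition goal_grasp_law :: "('d::finite, 'w::finite, 'o::finite) ppm \<Rightarrow> 'w rigid measure" where
  "goal_grasp_law \<P> =
     (case goal_object \<P> of None \<Rightarrow> return borel undefined
      | Some h \<Rightarrow> uniform_measure (goal_grasp_mu \<P>) (goal_grasps \<P> h))"

definition draw_law :: "('d::finite, 'w::finite, 'o::finite) ppm \<Rightarrow> ('d, 'w, 'o) draw measure" where
  "draw_law \<P> =
     (\<Pi>\<^sub>M i\<in>UNIV. uniform_measure (pose_mu \<P> i) (pose_space \<P> i)) \<Otimes>\<^sub>M
     (\<Pi>\<^sub>M i\<in>UNIV. goal_pose_law \<P> i) \<Otimes>\<^sub>M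
     (\<Pi>\<^sub>M i\<in>UNIV. uniform_measure (grasp_mu \<P> i) (grasp_space \<P> i)) \<Otimes>\<^sub>M
     goal_grasp_law \<P> \<Otimes>\<^sub>M
     uniform_measure lborel (conf_space \<P>) \<Otimes>\<^sub>M
     uniform_measure (goal_conf_mu \<P>) (goal_conf \<P>) \<Otimes>\<^sub>M
     (\<Pi>\<^sub>M _\<in>UNIV. seed_law)"

text \<open>Component \<open>n\<close> of a run contains the draws of iteration \<open>n\<close>; component \<open>0\<close> is not used.\<close>

definition run_law :: "('d::finite, 'w::finite, 'o::finite) ppm \<Rightarrow> ('d, 'w, 'o) run measure" where
  "run_law \<P> = (\<Pi>\<^sub>M _\<in>UNIV. draw_law \<P>)"

text \<open>Enumeration of the poses in their order of arrival: index \<open>0\<close> is the initial pose, and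
  \<open>2n - 1\<close> and \<open>2n\<close> are the two poses drawn in iteration \<open>n\<close>. Similarly for grasps.\<close>

definition pose_at ::
    "('d::finite, 'w::finite, 'o::finite) ppm \<Rightarrow> ('d, 'w, 'o) run \<Rightarrow> 'o \<Rightarrow> nat \<Rightarrow> 'w rigid option" where
  "pose_at \<P> r i a =
     (if a = 0 then init_pose \<P> i
      else if odd a then Some (draw_pose (r (Suc a div 2)) i)
      else if goal_placements \<P> i = {} then None
      else Some (draw_goal_pose (r (a div 2)) i))"

definition grasp_at ::
    "('d::finite, 'w::finite, 'o::finite) ppm \<Rightarrow> ('d, 'w, 'o) run \<Rightarrow> 'o \<Rightarrow> nat \<Rightarrow> 'w rigid option" where
  "grasp_at \<P> r i a =
     (if a = 0 then (case init_hand \<P> of Some (h, \<gamma>) \<Rightarrow> if h = i then Some \<gamma> else None | None \<Rightarrow> None)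
      else if odd a then Some (draw_grasp (r (Suc a div 2)) i)
      else if goal_object \<P> = Some i then Some (draw_goal_grasp (r (a div 2)))
      else None)"

definition poses ::
    "('d::finite, 'w::finite, 'o::finite) ppm \<Rightarrow> ('d, 'w, 'o) run \<Rightarrow> nat \<Rightarrow> 'o \<Rightarrow> 'w rigid set" where
  "poses \<P> r n i = {p. \<exists>a \<le> 2 * n. pose_at \<P> r i a = Some p}"

definition grasps ::
    "('d::finite, 'w::finite, 'o::finite) ppm \<Rightarrow> ('d, 'w, 'o) run \<Rightarrow> nat \<Rightarrow> 'o \<Rightarrow> 'w rigid set" where
  "grasps \<P> r n i = {\<gamma>. \<exists>a \<le> 2 * n. grasp_at \<P> r i a = Some \<gamma>}"

text \<open>Iteration \<open>n\<close> makes one inverse kinematics draw for every pair of a pose and a grasp. The pair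
  uses the seed whose number is given by the first occurrences of the pose and of the grasp, so
  that distinct pairs use independent seeds.\<close>

definition ik_draw ::
    "('d::finite, 'w::finite, 'o::finite) ppm \<Rightarrow> ('d, 'w, 'o) run \<Rightarrow> nat \<Rightarrow> 'o \<Rightarrow>
     'w rigid \<Rightarrow> 'w rigid \<Rightarrow> real^'d" where
  "ik_draw \<P> r n i p \<gamma> =
     ik_sampler \<P>
       (draw_seed (r n) (i, LEAST a. pose_at \<P> r i a = Some p, LEAST b. grasp_at \<P> r i b = Some \<gamma>))
       (ee_transform p \<gamma>)"

text \<open>The intersection with \<open>ik_confs\<close> makes the draw void if there is no inverse kinematics
  solution at all; otherwise the drawn value almost surely is a solution.\<close>

fun ik_samples ::
    "('d::finite, 'w::finite, 'o::finite) ppm \<Rightarrow> ('d, 'w, 'o) run \<Rightarrow> nat \<Rightarrow> 'o \<Rightarrow> (real^'d) set" where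
  "ik_samples \<P> r 0 i = {}"
| "ik_samples \<P> r (Suc n) i = ik_samples \<P> r n i \<union>
     (\<Union>p \<in> poses \<P> r (Suc n) i. \<Union>\<gamma> \<in> grasps \<P> r (Suc n) i.
        {ik_draw \<P> r (Suc n) i p \<gamma>} \<inter> ik_confs \<P> (ee_transform p \<gamma>))"

fun roadmap_vertices ::
    "('d::finite, 'w::finite, 'o::finite) ppm \<Rightarrow> ('d, 'w, 'o) run \<Rightarrow> nat \<Rightarrow> (real^'d) set" where
  "roadmap_vertices \<P> r 0 = {init_conf \<P>}"
| "roadmap_vertices \<P> r (Suc n) = roadmap_vertices \<P> r n \<union> (\<Union>i. ik_samples \<P> r (Suc n) i) \<union>
     {draw_conf (r (Suc n)), draw_goal_conf (r (Suc n))}"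

definition roadmap_edges ::
    "('d::finite, 'w::finite, 'o::finite) ppm \<Rightarrow> ('d, 'w, 'o) run \<Rightarrow> nat \<Rightarrow> ((real^'d) \<times> (real^'d)) set" where
  "roadmap_edges \<P> r n =
     {(q, q'). q \<in> roadmap_vertices \<P> r n \<and> q' \<in> roadmap_vertices \<P> r n \<and>
        closed_segment q q' \<subseteq> conf_space \<P>}"

text \<open>One action (Move, Pick or Place) of the discrete search in iteration \<open>n\<close>.\<close>

inductive action ::
    "('d::finite, 'w::finite, 'o::finite) ppm \<Rightarrow> ('d, 'w, 'o) run \<Rightarrow> nat \<Rightarrow>
     ('d, 'w, 'o) state \<Rightarrow> ('d, 'w, 'o) state \<Rightarrow> bool"
  for \<P> r n where
  move: "q \<in> roadmap_vertices \<P> r n \<Longrightarrow> q' \<in> roadmap_vertices \<P> r n \<Longrightarrow> q \<noteq> q' \<Longrightarrow>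
    (q, q') \<in> {(x, y) \<in> roadmap_edges \<P> r n. closed_segment x y \<subseteq> mode_confs \<P> \<omega>}\<^sup>* \<Longrightarrow>
    action \<P> r n (q, \<omega>) (q', \<omega>)"
| pick: "p \<in> poses \<P> r n i \<Longrightarrow> \<gamma> \<in> grasps \<P> r n i \<Longrightarrow>
    q \<in> ik_samples \<P> r n i \<inter> ik_confs \<P> (ee_transform p \<gamma>) \<Longrightarrow> ps i = Some p \<Longrightarrow>
    action \<P> r n (q, None, ps) (q, Some (i, \<gamma>), ps(i := None))"
| place: "p \<in> poses \<P> r n i \<Longrightarrow> \<gamma> \<in> grasps \<P> r n i \<Longrightarrow>
    q \<in> ik_samples \<P> r n i \<inter> ik_confs \<P> (ee_transform p \<gamma>) \<Longrightarrow>
    action \<P> r n (q, Some (i, \<gamma>), ps) (q, None, ps(i := Some p))"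

text \<open>As the search is complete, it finds a plan in iteration \<open>n\<close> if and only if there is one.\<close>

definition solved :: "('d::finite, 'w::finite, 'o::finite) ppm \<Rightarrow> ('d, 'w, 'o) run \<Rightarrow> nat \<Rightarrow> bool" where
  "solved \<P> r n \<longleftrightarrow> (\<exists>s \<in> goal_states \<P>. (action \<P> r n)\<^sup>*\<^sup>* (init_state \<P>) s)"

definition search_states ::
    "('d::finite, 'w::finite, 'o::finite) ppm \<Rightarrow> ('d, 'w, 'o) run \<Rightarrow> nat \<Rightarrow> ('d, 'w, 'o) state set" where
  "search_states \<P> r n = {(q, g, ps). q \<in> roadmap_vertices \<P> r n \<and>
     (g = None \<or> (\<exists>i. \<exists>\<gamma> \<in> grasps \<P> r n i. g = Some (i, \<gamma>))) \<and>
     (\<forall>i. ps i = None \<or> (\<exists>p \<in> poses \<P> r n i. ps i = Some p))}"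

text \<open>Number of samples drawn in iteration \<open>n\<close>.\<close>

definition sampling_steps ::
    "('d::finite, 'w::finite, 'o::finite) ppm \<Rightarrow> ('d, 'w, 'o) run \<Rightarrow> nat \<Rightarrow> nat" where
  "sampling_steps \<P> r n =
     (\<Sum>i\<in>UNIV. 2 + (if goal_placements \<P> i = {} then 0 else 1) +
        (if goal_object \<P> = Some i then 1 else 0) +
        card (poses \<P> r n i) * card (grasps \<P> r n i)) + 2"

text \<open>The number \<open>ops \<P> r n\<close> of operations performed by the discrete search of iteration \<open>n\<close> depends
  on the search procedure. It is only required to be polynomial in the number of states of the
  search space, as is the case for Dijkstra's algorithm.\<close>

definition polynomial_search ::
    "(('d::finite, 'w::finite, 'o::finite) ppm \<Rightarrow> ('d, 'w, 'o) run \<Rightarrow> nat \<Rightarrow> nat) \<Rightarrow> bool" where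
  "polynomial_search ops \<longleftrightarrow> (\<forall>\<P>. ppm_problem \<P> \<longrightarrow>
     (\<forall>n. (\<lambda>r. ops \<P> r n) \<in> measurable (run_law \<P>) (count_space UNIV)) \<and>
     (\<exists>C k. \<forall>r n. ops \<P> r n \<le> C * card (search_states \<P> r n) ^ k))"

text \<open>Number of iterations and number of time steps until the algorithm halts with a solution, or
  \<open>\<infinity>\<close> if it does not halt.\<close>

definition ffrob_iterations ::
    "('d::finite, 'w::finite, 'o::finite) ppm \<Rightarrow> ('d, 'w, 'o) run \<Rightarrow> enat" where
  "ffrob_iterations \<P> r =
     (if \<exists>n\<ge>1. solved \<P> r n then enat (LEAST n. 1 \<le> n \<and> solved \<P> r n) else \<infinity>)"

definition ffrob_time ::
    "(('d::finite, 'w::finite, 'o::finite) ppm \<Rightarrow> ('d, 'w, 'o) run \<Rightarrow> nat \<Rightarrow> nat) \<Rightarrow>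
     ('d, 'w, 'o) ppm \<Rightarrow> ('d, 'w, 'o) run \<Rightarrow> enat" where
  "ffrob_time ops \<P> r =
     (case ffrob_iterations \<P> r of
        enat N \<Rightarrow> enat (\<Sum>n = 1..N. sampling_steps \<P> r n + ops \<P> r n)
      | \<infinity> \<Rightarrow> \<infinity>)"


section \<open>Convergence of randomized algorithms\<close>

text \<open>An algorithm is given by the law of its random choices on a problem and by the number of time
  steps (or other units) it takes to halt with a solution, as a function of the random choices.\<close>

definition probabilistically_complete ::
    "('p \<Rightarrow> 'r measure) \<Rightarrow> ('p \<Rightarrow> 'r \<Rightarrow> enat) \<Rightarrow> 'p set \<Rightarrow> bool" where
  "probabilistically_complete law T \<C> \<longleftrightarrow> (\<forall>\<P> \<in> \<C>.
     prob_space (law \<P>) \<and> T \<P> \<in> measurable (law \<P>) (count_space UNIV) \<and>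
     (\<lambda>t. measure (law \<P>) {r \<in> space (law \<P>). T \<P> r \<le> enat t}) \<longlonglongrightarrow> 1)"

definition exponential_tail ::
    "real \<Rightarrow> 'r measure \<Rightarrow> ('r \<Rightarrow> enat) \<Rightarrow> bool" where
  "exponential_tail b M T \<longleftrightarrow>
     prob_space M \<and> T \<in> measurable M (count_space UNIV) \<and>
     (\<exists>C > 0. \<exists>a > 0. \<forall>t::nat.
        measure M {r \<in> space M. enat t < T r} \<le> C * exp (- a * real t powr b))"

text \<open>Exponential decrease in time steps is decrease of the form \<open>exp (- a t\<^sup>b)\<close> with \<open>a, b > 0\<close>.
  The number of time steps spent in an iteration grows polynomially with the number of the
  iteration, so that \<open>b = 1\<close> is out of reach in general: if \<open>n\<close> iterations take at least \<open>c n\<^sup>3\<close> time steps and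
  each of them fails to draw a usable grasp with probability one half, then the probability of not
  having halted after \<open>t\<close> steps is at least \<open>2 powr (- ((t / c) powr (1 / 3)) - 1)\<close>. In the number of
  iterations, \<open>b = 1\<close> is required.\<close>

definition exponentially_convergent ::
    "('p \<Rightarrow> 'r measure) \<Rightarrow> ('p \<Rightarrow> 'r \<Rightarrow> enat) \<Rightarrow> 'p set \<Rightarrow> bool" where
  "exponentially_convergent law T \<C> \<longleftrightarrow>
     (\<forall>\<P> \<in> \<C>. \<exists>b > 0. exponential_tail b (law \<P>) (T \<P>))"

definition exponentially_convergent_iterations ::
    "('p \<Rightarrow> 'r measure) \<Rightarrow> ('p \<Rightarrow> 'r \<Rightarrow> enat) \<Rightarrow> 'p set \<Rightarrow> bool" where
  "exponentially_convergent_iterations law N \<C> \<longleftrightarrow>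
     (\<forall>\<P> \<in> \<C>. exponential_tail 1 (law \<P>) (N \<P>))"

end

theory Submission
  imports Defs
begin

text \<open>Solvability of the discrete search is monotone in the iteration, so it suffices that a block of
  iterations of some fixed length makes the search succeed with probability at least \<open>p > 0\<close>,
  whatever the earlier draws \<open>h\<close> were: then the probability of failure decays geometrically in the number
  of blocks. Within a block, the parameters of a mode sequence in \<open>\<theta>\<close> are drawn first, then one
  inverse kinematics solution per mode switch, then a goal configuration, while the uniform
  configuration draws build the roadmap. The number of the seed used for an inverse kinematics
  solution depends on \<open>h\<close>, but the law of the solution does not, which makes \<open>p\<close> uniform in \<open>h\<close>.
  The clearance \<open>\<delta>\<close> of robust motions is not uniform in the drawn values, yet no quantitative estimate
  is needed: almost surely an infinite sequence of uniform configurations visits every ball in the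
  configuration space and thus connects all robust pairs, and by continuity of measure some finite
  block length already has positive probability. Finally the number of time steps of an iteration is
  bounded by a deterministic polynomial, which turns the exponential tail in the number of iterations into a
  stretched exponential tail in time.\<close>

section \<open>Measure-theoretic preliminaries\<close>

text \<open>Two obstacles to measurability shape the proof. The search runs over uncountably many
  states, so the event of success is rewritten over indices of draws, which are countable in number.
  Moreover, the sets \<open>Q\<close>, the constant \<epsilon> and the clearance \<delta> of robust
  feasibility are obtained separately for each choice of parameter values and need not depend
  measurably on them. They are used only while the parameters are fixed; what is integrated over the
  parameters is the event \<open>plan_along\<close>, which speaks of drawn values alone. Fubini's
  theorem turns positivity of the sections of this event into positivity of the whole, and asks for
  no lower bound common to the sections. The comparison with a given history \<open>h\<close> loses
  nothing: once \<open>h\<close> and the parameters are fixed, each later iteration matters only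
  through one configuration, one goal configuration and one seed, and such triples have the same law
  whichever seed is selected.\<close>

lemma pred_rtranclp_countable:
  fixes S :: "'a \<Rightarrow> 'i::countable \<Rightarrow> 'i \<Rightarrow> bool"
  assumes [measurable]: "\<And>x y. Measurable.pred M (\<lambda>r. S r x y)"
  shows "Measurable.pred M (\<lambda>r. (S r)\<^sup>*\<^sup>* x y)"
proof -
  \<comment> \<open>Induction on the length: the last but one node of a path ranges over a countable
    type.\<close>
  have [measurable]: "Measurable.pred M (\<lambda>r. (S r ^^ n) x y)" for n y
  proof (induction n arbitrary: y)
    case (Suc n)
    note [measurable] = Suc
    show ?case by (simp add: relcompp_apply) measurable
  qed simp
  have "Measurable.pred M (\<lambda>r. \<exists>n. (S r ^^ n) x y)" by measurable
  then show ?thesis by (simp add: rtranclp_power)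
qed

text \<open>The image measure agrees with the product on cylinders, where both sides are finite
  products; this determines a product of probability measures even for infinite
  \<open>I\<close>.\<close>

lemma distr_PiM_map:
  assumes M: "\<And>i. i \<in> I \<Longrightarrow> prob_space (M i)"
    and f: "\<And>i. i \<in> I \<Longrightarrow> f i \<in> measurable (M i) (N i)"
    and d: "\<And>i. i \<in> I \<Longrightarrow> distr (M i) (N i) (f i) = N i"
  shows "distr (PiM I M) (PiM I N) (\<lambda>x. \<lambda>i\<in>I. f i (x i)) = PiM I N"
proof -
  \<comment> \<open>The characterization by cylinders wants a probability measure at every index, so
    a Dirac measure fills the places outside \<open>I\<close>.\<close>
  define N' where "N' i = (if i \<in> I then N i else return (count_space UNIV) undefined)" for i
  have N: "prob_space (N i)" if "i \<in> I" for i
    using prob_space.prob_space_distr[OF M[OF that] f[OF that]] d[OF that] by simp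
  interpret N': product_prob_space N' I
    unfolding product_prob_space_def product_prob_space_axioms_def product_sigma_finite_def
    by (auto simp: N'_def N prob_space_return intro!: prob_space_imp_sigma_finite)
  have PN: "PiM I N = PiM I N'"
    by (intro PiM_cong) (auto simp: N'_def)
  have meas: "(\<lambda>x. \<lambda>i\<in>I. f i (x i)) \<in> measurable (PiM I M) (PiM I N)"
    using f by (intro measurable_restrict) (auto intro: measurable_compose[OF measurable_component_singleton])
  have "distr (PiM I M) (PiM I N) (\<lambda>x. \<lambda>i\<in>I. f i (x i)) = PiM I N'"
  proof (rule N'.PiM_eq)
    fix J A assume J: "finite J" "J \<subseteq> I" and A: "\<And>j. j \<in> J \<Longrightarrow> A j \<in> sets (N' j)"
    have A': "A j \<in> sets (N j)" if "j \<in> J" for j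
      using A[OF that] that J by (auto simp: N'_def)
    let ?X = "prod_emb I N' J (Pi\<^sub>E J A)"
    have X: "?X = prod_emb I N J (Pi\<^sub>E J A)"
      by (auto simp: prod_emb_def N'_def PiE_iff)
    have "emeasure (distr (PiM I M) (PiM I N) (\<lambda>x. \<lambda>i\<in>I. f i (x i))) ?X =
        emeasure (PiM I M) ((\<lambda>x. \<lambda>i\<in>I. f i (x i)) -` ?X \<inter> space (PiM I M))"
      unfolding X using J A' by (intro emeasure_distr meas sets_PiM_I) auto
    also have "(\<lambda>x. \<lambda>i\<in>I. f i (x i)) -` ?X \<inter> space (PiM I M) =
        prod_emb I M J (\<Pi>\<^sub>E j\<in>J. f j -` A j \<inter> space (M j))"
      unfolding X using J f[THEN measurable_space]
      by (auto simp: prod_emb_def PiE_iff space_PiM subset_eq restrict_def extensional_def split: if_splits)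
    also have "emeasure (PiM I M) \<dots> = (\<Prod>j\<in>J. emeasure (M j) (f j -` A j \<inter> space (M j)))"
      using J A' f by (intro emeasure_PiM_emb M) (auto intro: measurable_sets)
    also have "\<dots> = (\<Prod>j\<in>J. emeasure (distr (M j) (N j) (f j)) (A j))"
      using J A' f by (intro prod.cong refl) (subst emeasure_distr, auto)
    also have "\<dots> = (\<Prod>j\<in>J. emeasure (N' j) (A j))"
      using J d by (intro prod.cong refl) (auto simp: N'_def subset_eq)
    finally show "emeasure (distr (PiM I M) (PiM I N) (\<lambda>x. \<lambda>i\<in>I. f i (x i))) ?X = (\<Prod>j\<in>J. emeasure (N' j) (A j))" .
  qed (simp add: PN)
  with PN show ?thesis by simp
qed

text \<open>Never visiting \<open>A\<close> is a product event; its measure is the limit of the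
  powers of the probability of missing \<open>A\<close> once, which is below 1.\<close>

lemma AE_PiM_visits:
  assumes "prob_space M" "A \<in> sets M" "emeasure M A > 0"
  shows "AE x in PiM (UNIV::nat set) (\<lambda>_. M). \<exists>n. x n \<in> A"
proof -
  interpret M: prob_space M by fact
  interpret sequence_space M
    unfolding sequence_space_def product_prob_space_def product_prob_space_axioms_def
      product_sigma_finite_def
    by (auto intro: M.prob_space_axioms prob_space_imp_sigma_finite)
  let ?B = "Pi UNIV (\<lambda>_::nat. space M - A)"
  let ?p = "measure M (space M - A)"
  have p: "?p < 1"
    using assms M.prob_compl[of A] by (simp add: M.emeasure_eq_measure)
  have "(\<lambda>n. \<Prod>i\<le>n. ?p) \<longlonglongrightarrow> measure S ?B"
    using assms by (intro measure_PiM_countable) auto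
  moreover have "(\<lambda>n. \<Prod>i\<le>n::nat. ?p) \<longlonglongrightarrow> 0"
    using LIMSEQ_power_zero[of ?p] p by (simp add: tendsto_mult_right_zero)
  ultimately have "measure S ?B = 0" by (rule LIMSEQ_unique)
  moreover have "?B \<in> sets S" using assms by (intro infprod_in_sets) auto
  ultimately show ?thesis
    by (intro AE_I[of _ _ ?B]) (auto simp: P.emeasure_eq_measure space_PiM PiE_iff)
qed

text \<open>The exceptional null set must not depend on \<open>U\<close>. With a countable base only
  countably many base sets have to be visited, and an open set of positive measure contains a base
  set of positive measure, as a countable union of null sets is null.\<close>

lemma AE_PiM_visits_open:
  fixes M :: "'a::second_countable_topology measure"
  assumes "prob_space M" and sets: "sets M = sets borel"
  shows "AE x in PiM (UNIV::nat set) (\<lambda>_. M). \<forall>U. open U \<and> emeasure M U > 0 \<longrightarrow> (\<exists>n. x n \<in> U)"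
proof -
  obtain B :: "'a set set" where B: "countable B" "topological_basis B"
    using ex_countable_basis by blast
  have B_sets: "b \<in> sets M" if "b \<in> B" for b
    using topological_basis_open[OF B(2) that] sets by simp
  have "AE x in PiM (UNIV::nat set) (\<lambda>_. M). \<forall>b\<in>{b\<in>B. emeasure M b > 0}. \<exists>n. x n \<in> b"
    by (subst AE_ball_countable) (use B B_sets assms in \<open>auto intro!: AE_PiM_visits\<close>)
  then show ?thesis
  proof (eventually_elim, intro allI impI)
    fix x U assume x: "\<forall>b\<in>{b\<in>B. emeasure M b > 0}. \<exists>n::nat. x n \<in> b"
      and U: "open U \<and> emeasure M U > 0"
    obtain B' where B': "B' \<subseteq> B" "\<Union>B' = U"
      using B(2) U unfolding topological_basis_def by blast
    have "\<exists>b\<in>B'. emeasure M b > 0"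
    proof (rule ccontr)
      assume "\<not> ?thesis"
      then have "(\<Union>b\<in>B'. b) \<in> null_sets M"
        using B' B_sets B(1) by (intro null_sets_UN')
          (auto simp: not_less null_sets_def intro: countable_subset)
      with B' U show False by auto
    qed
    with B' x show "\<exists>n. x n \<in> U" by blast
  qed
qed

lemma distr_pair_map:
  assumes "prob_space M" "prob_space N" "f \<in> measurable M S" "g \<in> measurable N T"
  shows "distr (M \<Otimes>\<^sub>M N) (S \<Otimes>\<^sub>M T) (\<lambda>(x, y). (f x, g y)) = distr M S f \<Otimes>\<^sub>M distr N T g"
  using assms by (intro pair_measure_distr[symmetric] prob_space_imp_sigma_finite prob_space.prob_space_distr)

lemma distr_pair_measure_snd:
  assumes "prob_space M" "prob_space N"
  shows "distr (M \<Otimes>\<^sub>M N) N snd = N"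
proof (rule measure_eqI)
  interpret M: prob_space M by fact
  interpret N: prob_space N by fact
  fix A assume "A \<in> sets (distr (M \<Otimes>\<^sub>M N) N snd)"
  then have A: "A \<in> sets N" by simp
  then have "snd -` A \<inter> space (M \<Otimes>\<^sub>M N) = space M \<times> A"
    using sets.sets_into_space[OF A] by (auto simp: space_pair_measure)
  with A show "emeasure (distr (M \<Otimes>\<^sub>M N) N snd) A = emeasure N A"
    by (simp add: emeasure_distr N.emeasure_pair_measure_Times M.emeasure_space_1)
qed simp

section \<open>Laws of the draws\<close>

lemma borel_measurable_rmul [measurable (raw)]:
  assumes "S \<in> borel_measurable M" "T \<in> borel_measurable M"
  shows "(\<lambda>x. rmul (S x) (T x)) \<in> borel_measurable M"
  unfolding rmul_def matrix_matrix_mult_def matrix_vector_mult_def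
  by (rule borel_measurable_continuous_Pair[OF assms]) (intro continuous_intros)

lemma borel_measurable_rinv [measurable (raw)]:
  assumes "T \<in> borel_measurable M"
  shows "(\<lambda>x. rinv (T x)) \<in> borel_measurable M"
  unfolding rinv_def matrix_vector_mult_def transpose_def
  by (rule borel_measurable_continuous_on[OF _ assms]) (intro continuous_intros)

lemma borel_measurable_ee_transform [measurable (raw)]:
  assumes [measurable]: "p \<in> borel_measurable M" "\<gamma> \<in> borel_measurable M"
  shows "(\<lambda>x. ee_transform (p x) (\<gamma> x)) \<in> borel_measurable M"
  unfolding ee_transform_def by measurable

text \<open>The diagonal of a Hausdorff space is closed, and second countability makes the pair
  \<open>(f, g)\<close> Borel. Equality of drawn transforms matters because seed numbers are first
  occurrences of values.\<close>

lemma pred_eq_borel: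
  fixes f g :: "'a \<Rightarrow> 'b::{second_countable_topology, t2_space}"
  assumes "f \<in> borel_measurable M" "g \<in> borel_measurable M"
  shows "Measurable.pred M (\<lambda>x. f x = g x)"
proof -
  have "{p :: 'b \<times> 'b. fst p = snd p} \<in> sets borel"
    by (intro borel_closed closed_Collect_eq continuous_intros)
  from measurable_sets[OF borel_measurable_Pair[OF assms] this] show ?thesis
    by (simp add: pred_def vimage_def Int_def conj_commute)
qed

lemma prob_space_uniform_measure_on: "measure_on M X \<Longrightarrow> prob_space (uniform_measure M X)"
  unfolding measure_on_def by (intro prob_space_uniform_measure) auto

text \<open>Robust feasibility does not state that its sets are measurable; nonzero relative measure
  implies it, since \<open>measure\<close> is 0 outside the sigma-algebra.\<close>

lemma emeasure_uniform_measure_on_pos: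
  assumes "measure_on M X" "A \<subseteq> X" "0 < rel_measure M X A"
  shows "A \<in> sets borel" "0 < emeasure (uniform_measure M X) A"
proof -
  have "measure M A \<noteq> 0" using assms(3) by (auto simp: rel_measure_def)
  then have A: "A \<in> sets M" "emeasure M A \<noteq> 0"
    by (metis measure_notin_sets, auto simp: measure_def)
  show "A \<in> sets borel" using A assms by (simp add: measure_on_def)
  have "X \<inter> A = A" using assms(2) by auto
  then show "0 < emeasure (uniform_measure M X) A"
    using A assms(1) by (simp add: measure_on_def ennreal_zero_less_divide top.not_eq_extremum less_top zero_less_iff_neq_zero)
qed

lemma prob_space_seed_law: "prob_space seed_law"
  unfolding seed_law_def by (intro prob_space_uniform_measure) auto

lemma sets_seed_law [measurable_cong, simp]: "sets seed_law = sets borel"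
  by (simp add: seed_law_def)

lemma space_seed_law [simp]: "space seed_law = UNIV"
  by (simp add: seed_law_def)

section \<open>Consequences of the problem being valid, and the laws of its draws\<close>

locale valid_ppm =
  fixes \<P> :: "('d::finite, 'w::finite, 'o::finite) ppm"
  assumes problem: "ppm_problem \<P>"
begin

lemma conf_space_measure: "measure_on lborel (conf_space \<P>)"
  and pose_space_measure: "measure_on (pose_mu \<P> i) (pose_space \<P> i)"
  and grasp_space_measure: "measure_on (grasp_mu \<P> i) (grasp_space \<P> i)"
  and legal_init: "legal_state \<P> (init_state \<P>)"
  and goal_conf_measure: "measure_on (goal_conf_mu \<P>) (goal_conf \<P>)"
  and goal_placements_measure: "goal_placements \<P> i \<noteq> {} \<Longrightarrow>
    measure_on (goal_pose_mu \<P> i) (goal_placements \<P> i)"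
  and sets_goal_grasps [measurable]: "goal_grasps \<P> i \<in> sets borel"
  and goal_grasps_measure: "goal_object \<P> = Some h \<Longrightarrow>
    measure_on (goal_grasp_mu \<P>) (goal_grasps \<P> h)"
  using problem unfolding ppm_problem_def by auto

lemma ik: "ik_sampling \<P>" and tests: "measurable_tests \<P>"
  using problem unfolding ppm_problem_def by auto

lemma sets_conf_space [measurable]: "conf_space \<P> \<in> sets borel"
  and sets_pose_space [measurable]: "pose_space \<P> i \<in> sets borel"
  and sets_grasp_space [measurable]: "grasp_space \<P> i \<in> sets borel"
  and sets_goal_conf [measurable]: "goal_conf \<P> \<in> sets borel"
  using conf_space_measure pose_space_measure grasp_space_measure goal_conf_measure
  by (auto simp: measure_on_def)

lemma sets_goal_placements [measurable]: "goal_placements \<P> i \<in> sets borel"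
  using goal_placements_measure[of i] by (cases "goal_placements \<P> i = {}") (auto simp: measure_on_def)

lemma end_effector_measurable [measurable]: "end_effector \<P> \<in> borel_measurable borel"
  using tests by (simp add: measurable_tests_def)

lemma ik_sampler_measurable [measurable (raw)]:
  assumes "u \<in> borel_measurable M" "t \<in> borel_measurable M"
  shows "(\<lambda>x. ik_sampler \<P> (u x) (t x)) \<in> borel_measurable M"
proof -
  have "(\<lambda>(u, t). ik_sampler \<P> u t) \<in> borel_measurable borel"
    using ik unfolding ik_sampling_def by (rule conjunct1)
  from measurable_compose[OF borel_measurable_Pair[OF assms] this] show ?thesis by simp
qed

lemma pred_ik_confs [measurable (raw)]:
  assumes [measurable]: "q \<in> borel_measurable M" "t \<in> borel_measurable M"
  shows "Measurable.pred M (\<lambda>x. q x \<in> ik_confs \<P> (t x))"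
proof -
  have [measurable]: "Measurable.pred M (\<lambda>x. end_effector \<P> (q x) = t x)"
    by (intro pred_eq_borel) measurable
  show ?thesis unfolding ik_confs_def mem_Collect_eq by measurable
qed

text \<open>A density of at least \<kappa> on the solutions gives \<open>Q\<close> at least \<kappa>
  times its measure as probability.\<close>

lemma ik_sampler_pos:
  assumes "Q \<subseteq> ik_confs \<P> t" "0 < rel_measure (ik_mu \<P> t) (ik_confs \<P> t) Q"
  shows "{u. ik_sampler \<P> u t \<in> Q} \<in> sets borel" "0 < emeasure seed_law {u. ik_sampler \<P> u t \<in> Q}"
proof -
  have "measure (ik_mu \<P> t) Q \<noteq> 0" using assms(2) by (auto simp: rel_measure_def)
  then have Q: "Q \<in> sets (ik_mu \<P> t)" "emeasure (ik_mu \<P> t) Q \<noteq> 0"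
    by (metis measure_notin_sets, auto simp: measure_def)
  then have "Q \<noteq> {}" by auto
  with assms(1) have ne: "ik_confs \<P> t \<noteq> {}" by auto
  from ik obtain \<kappa> :: real where \<kappa>: "0 < \<kappa>" and
    all: "\<forall>t. ik_confs \<P> t \<noteq> {} \<longrightarrow>
          measure_on (ik_mu \<P> t) (ik_confs \<P> t) \<and>
          (\<exists>f \<in> borel_measurable borel.
             (\<forall>q \<in> ik_confs \<P> t. ennreal \<kappa> \<le> f q) \<and>
             distr seed_law borel (\<lambda>u. ik_sampler \<P> u t) =
               density (ik_mu \<P> t) (\<lambda>q. f q * indicator (ik_confs \<P> t) q))"
    unfolding ik_sampling_def by (elim conjE exE) (rule that)
  have mu: "measure_on (ik_mu \<P> t) (ik_confs \<P> t)"
    using all[rule_format, OF ne] by (rule conjunct1)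
  obtain f where f [measurable]: "f \<in> borel_measurable borel"
    and fk: "\<And>q. q \<in> ik_confs \<P> t \<Longrightarrow> ennreal \<kappa> \<le> f q"
    and d: "distr seed_law borel (\<lambda>u. ik_sampler \<P> u t) =
               density (ik_mu \<P> t) (\<lambda>q. f q * indicator (ik_confs \<P> t) q)"
    using all[rule_format, OF ne, THEN conjunct2] by (elim bexE conjE) (rule that, auto)
  have s: "sets (ik_mu \<P> t) = sets borel" and I: "ik_confs \<P> t \<in> sets borel"
    using mu by (auto simp: measure_on_def)
  have Qb [measurable]: "Q \<in> sets borel" using Q s by simp
  have meas: "(\<lambda>u. ik_sampler \<P> u t) \<in> borel_measurable borel"
    by (intro ik_sampler_measurable measurable_ident_sets borel_measurable_const refl)
  show "{u. ik_sampler \<P> u t \<in> Q} \<in> sets borel"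
    using measurable_sets[OF meas Qb] by (simp add: vimage_def)
  have "0 < ennreal \<kappa> * emeasure (ik_mu \<P> t) Q"
    using \<kappa> Q by (simp add: ennreal_zero_less_mult_iff zero_less_iff_neq_zero)
  also have "\<dots> = (\<integral>\<^sup>+q. ennreal \<kappa> * indicator Q q \<partial>ik_mu \<P> t)"
    using Q by (subst nn_integral_cmult_indicator) auto
  also have "\<dots> \<le> (\<integral>\<^sup>+q. f q * indicator (ik_confs \<P> t) q * indicator Q q \<partial>ik_mu \<P> t)"
    using assms(1) fk by (intro nn_integral_mono) (auto simp: indicator_def)
  also have "\<dots> = emeasure (density (ik_mu \<P> t) (\<lambda>q. f q * indicator (ik_confs \<P> t) q)) Q"
    by (rule emeasure_density[symmetric]) (use Q I f s in \<open>auto simp: measurable_cong_sets[OF s refl]\<close>)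
  also have "\<dots> = emeasure seed_law {u. ik_sampler \<P> u t \<in> Q}"
    unfolding d[symmetric] using meas Qb by (simp add: emeasure_distr vimage_def measurable_cong_sets[OF sets_seed_law refl])
  finally show "0 < emeasure seed_law {u. ik_sampler \<P> u t \<in> Q}" .
qed

abbreviation "pose_law i \<equiv> uniform_measure (pose_mu \<P> i) (pose_space \<P> i)"
abbreviation "grasp_law i \<equiv> uniform_measure (grasp_mu \<P> i) (grasp_space \<P> i)"
abbreviation "conf_law \<equiv> uniform_measure lborel (conf_space \<P>)"
abbreviation "goal_conf_law \<equiv> uniform_measure (goal_conf_mu \<P>) (goal_conf \<P>)"

lemma prob_space_laws:
  "prob_space (pose_law i)" "prob_space (goal_pose_law \<P> i)" "prob_space (grasp_law i)"
  "prob_space (goal_grasp_law \<P>)" "prob_space conf_law" "prob_space goal_conf_law"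
  using conf_space_measure pose_space_measure grasp_space_measure goal_conf_measure
    goal_placements_measure goal_grasps_measure
  by (auto simp: goal_pose_law_def goal_grasp_law_def prob_space_return split: option.split
        intro!: prob_space_uniform_measure_on)

lemma sets_mu [measurable_cong, simp]:
  "sets (pose_mu \<P> i) = sets borel" "sets (grasp_mu \<P> i) = sets borel"
  "sets (goal_conf_mu \<P>) = sets borel"
  using pose_space_measure[of i] grasp_space_measure[of i] goal_conf_measure
  by (auto simp: measure_on_def)

lemma sets_goal_laws [measurable_cong, simp]:
  "sets (goal_pose_law \<P> i) = sets borel" "sets (goal_grasp_law \<P>) = sets borel"
  using goal_placements_measure[of i] goal_grasps_measure
  by (auto simp: goal_pose_law_def goal_grasp_law_def measure_on_def split: option.split)

lemma space_mu [simp]: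
  "space (pose_mu \<P> i) = UNIV" "space (grasp_mu \<P> i) = UNIV" "space (goal_conf_mu \<P>) = UNIV"
  "space (goal_pose_law \<P> i) = UNIV" "space (goal_grasp_law \<P>) = UNIV"
  using sets_mu[THEN sets_eq_imp_space_eq] sets_goal_laws[THEN sets_eq_imp_space_eq]
  by simp_all

abbreviation "seeds_law \<equiv> (\<Pi>\<^sub>M _\<in>(UNIV :: ('o \<times> nat \<times> nat) set). seed_law)"

lemma space_draw_law [simp]: "space (draw_law \<P>) = UNIV"
  by (auto simp: draw_law_def space_pair_measure space_PiM PiE_def)

lemma space_run_law [simp]: "space (run_law \<P>) = UNIV"
  by (auto simp: run_law_def space_PiM PiE_def)

lemma draw_measurable [measurable]:
  "(\<lambda>d. draw_pose d i) \<in> borel_measurable (draw_law \<P>)"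
  "(\<lambda>d. draw_goal_pose d i) \<in> borel_measurable (draw_law \<P>)"
  "(\<lambda>d. draw_grasp d i) \<in> borel_measurable (draw_law \<P>)"
  "draw_goal_grasp \<in> borel_measurable (draw_law \<P>)"
  "draw_conf \<in> borel_measurable (draw_law \<P>)"
  "draw_goal_conf \<in> borel_measurable (draw_law \<P>)"
  "(\<lambda>d. draw_seed d c) \<in> borel_measurable (draw_law \<P>)"
  unfolding draw_pose_def draw_goal_pose_def draw_grasp_def draw_goal_grasp_def draw_conf_def
    draw_goal_conf_def draw_seed_def draw_law_def case_prod_beta by measurable

lemma run_measurable [measurable]: "(\<lambda>r. r n) \<in> measurable (run_law \<P>) (draw_law \<P>)"
  unfolding run_law_def by measurable

lemma prob_space_seeds: "prob_space seeds_law"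
  by (intro prob_space_PiM prob_space_seed_law)

lemma prob_space_draw_law: "prob_space (draw_law \<P>)"
  unfolding draw_law_def
  by (intro prob_space_pair prob_space_PiM prob_space_laws prob_space_seed_law)

lemma prob_space_run_law: "prob_space (run_law \<P>)"
  unfolding run_law_def by (intro prob_space_PiM prob_space_draw_law)

abbreviation "essential_law \<equiv> conf_law \<Otimes>\<^sub>M goal_conf_law \<Otimes>\<^sub>M seed_law"

text \<open>The part of a draw that matters once the parameters of the mode sequence are drawn, where \<open>c\<close> is
  the number of the seed in use.\<close>

definition essential :: "'o \<times> nat \<times> nat \<Rightarrow> ('d, 'w, 'o) draw \<Rightarrow> (real^'d) \<times> (real^'d) \<times> real" where
  "essential c d = (draw_conf d, draw_goal_conf d, draw_seed d c)"

lemma prob_space_essential_law: "prob_space essential_law"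
  by (intro prob_space_pair prob_space_laws prob_space_seed_law)

text \<open>All components of a draw are independent, so discarding some of them leaves the product
  of the others. Every coordinate of the seed family has law \<open>seed_law\<close>, whence the
  right side is free of \<open>c\<close>.\<close>

lemma distr_draw_law_essential: "distr (draw_law \<P>) essential_law (essential c) = essential_law"
proof -
  let ?T = "conf_law \<Otimes>\<^sub>M goal_conf_law \<Otimes>\<^sub>M seeds_law"
  let ?g = "\<lambda>(x, y). (x, (\<lambda>(z, u). (z, u c)) y)"
  have p: "prob_space ?T" "prob_space (goal_conf_law \<Otimes>\<^sub>M seeds_law)"
    by (intro prob_space_pair prob_space_PiM prob_space_laws prob_space_seed_law)+
  have m: "(\<lambda>(z, u). (z, u c)) \<in> measurable (goal_conf_law \<Otimes>\<^sub>M seeds_law) (goal_conf_law \<Otimes>\<^sub>M seed_law)"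
    "?g \<in> measurable ?T essential_law"
    unfolding case_prod_beta by measurable
  \<comment> \<open>The four projections discard the poses, the goal poses, the grasps and the goal
    grasp; \<open>?g\<close> then picks coordinate \<open>c\<close> of the seeds.\<close>
  have "essential c = ?g \<circ> (snd \<circ> (snd \<circ> (snd \<circ> snd)))"
    by (auto simp: essential_def draw_conf_def draw_goal_conf_def draw_seed_def fun_eq_iff)
  moreover have "distr (draw_law \<P>) ?T (snd \<circ> (snd \<circ> (snd \<circ> snd))) = ?T"
  proof -
    let ?A4 = "goal_grasp_law \<P> \<Otimes>\<^sub>M ?T"
    let ?A3 = "(\<Pi>\<^sub>M i\<in>UNIV. grasp_law i) \<Otimes>\<^sub>M ?A4"
    let ?A2 = "(\<Pi>\<^sub>M i\<in>UNIV. goal_pose_law \<P> i) \<Otimes>\<^sub>M ?A3"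
    have P: "prob_space ?A4" "prob_space ?A3" "prob_space ?A2"
      by (intro p prob_space_pair prob_space_PiM prob_space_laws)+
    have "distr (draw_law \<P>) ?T (snd \<circ> (snd \<circ> (snd \<circ> snd))) =
      distr (distr (distr (distr (draw_law \<P>) ?A2 snd) ?A3 snd) ?A4 snd) ?T snd"
      unfolding draw_law_def by (simp add: distr_distr comp_assoc)
    then show ?thesis
      unfolding draw_law_def using p P prob_space_laws
      by (simp add: distr_pair_measure_snd prob_space_PiM)
  qed
  moreover have "distr ?T essential_law ?g = essential_law"
  proof -
    have "distr (goal_conf_law \<Otimes>\<^sub>M seeds_law) (goal_conf_law \<Otimes>\<^sub>M seed_law) (\<lambda>(z, u). (z, u c)) =
        distr goal_conf_law goal_conf_law (\<lambda>z. z) \<Otimes>\<^sub>M distr seeds_law seed_law (\<lambda>u. u c)"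
      using prob_space_laws prob_space_seeds by (intro distr_pair_map) auto
    also have "\<dots> = goal_conf_law \<Otimes>\<^sub>M seed_law"
      using prob_space_seed_law distr_PiM_component[of UNIV "\<lambda>_. seed_law" c] by simp
    finally have e: "distr (goal_conf_law \<Otimes>\<^sub>M seeds_law) (goal_conf_law \<Otimes>\<^sub>M seed_law) (\<lambda>(z, u). (z, u c)) =
      goal_conf_law \<Otimes>\<^sub>M seed_law" .
    have "distr ?T essential_law ?g =
        distr conf_law conf_law (\<lambda>x. x) \<Otimes>\<^sub>M
        distr (goal_conf_law \<Otimes>\<^sub>M seeds_law) (goal_conf_law \<Otimes>\<^sub>M seed_law) (\<lambda>(z, u). (z, u c))"
      by (intro distr_pair_map prob_space_laws p m) simp
    with e show ?thesis by simp
  qed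
  moreover have "(snd \<circ> (snd \<circ> (snd \<circ> snd))) \<in> measurable (draw_law \<P>) ?T"
    unfolding draw_law_def by measurable
  ultimately show ?thesis
    using distr_distr[OF m(2)] by metis
qed

lemma essential_measurable: "essential c \<in> measurable (draw_law \<P>) essential_law"
  unfolding essential_def by measurable

text \<open>Seed numbers are random, yet \<open>c\<close> is a fixed sequence: it is meant to be
  computed from draws other than those in \<open>r\<close>.\<close>

definition essential_run ::
    "(nat \<Rightarrow> 'o \<times> nat \<times> nat) \<Rightarrow> ('d, 'w, 'o) run \<Rightarrow> nat \<Rightarrow> (real^'d) \<times> (real^'d) \<times> real" where
  "essential_run c r = (\<lambda>n. essential (c n) (r n))"

abbreviation "essential_run_law \<equiv> (\<Pi>\<^sub>M _\<in>(UNIV::nat set). essential_law)"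

lemma distr_run_law_essential: "distr (run_law \<P>) essential_run_law (essential_run c) = essential_run_law"
  unfolding run_law_def essential_run_def
  using distr_PiM_map[of UNIV "\<lambda>_. draw_law \<P>" "\<lambda>n. essential (c n)" "\<lambda>_. essential_law"]
  by (simp add: prob_space_draw_law essential_measurable distr_draw_law_essential restrict_def)

lemma essential_run_measurable [measurable]: "essential_run c \<in> measurable (run_law \<P>) essential_run_law"
  unfolding essential_run_def run_law_def
  by (intro measurable_PiM_single') (auto intro!: measurable_compose[OF _ essential_measurable] simp: space_pair_measure)

end

section \<open>Random modes\<close>

text \<open>The held object (if any) and the set \<open>S\<close> of placed objects are deterministic, only the transforms
  are random. The held object must not be placed, as no measurable collision test is available for
  an object against itself.\<close>

definition random_mode :: "'a measure \<Rightarrow> ('a \<Rightarrow> ('w::finite, 'o::finite) mode) \<Rightarrow> bool" where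
  "random_mode M \<omega> \<longleftrightarrow> (\<exists>H S g p. g \<in> borel_measurable M \<and> (\<forall>j. p j \<in> borel_measurable M) \<and>
     (\<forall>i. H = Some i \<longrightarrow> i \<notin> S) \<and>
     (\<forall>r. \<omega> r = (map_option (\<lambda>i. (i, g r)) H, \<lambda>j. if j \<in> S then Some (p j r) else None)))"

lemma random_modeE:
  assumes "random_mode M \<omega>"
  obtains H S g p where "g \<in> borel_measurable M" "\<And>j. p j \<in> borel_measurable M"
    "\<And>i. H = Some i \<Longrightarrow> i \<notin> S"
    "\<omega> = (\<lambda>r. (map_option (\<lambda>i. (i, g r)) H, \<lambda>j. if j \<in> S then Some (p j r) else None))"
  using assms unfolding random_mode_def by (elim exE conjE) (rule that; auto)

lemma random_modeI:
  assumes "g \<in> borel_measurable M" "\<And>j. p j \<in> borel_measurable M"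
    "\<And>i. H = Some i \<Longrightarrow> i \<notin> S"
    "\<And>r. \<omega> r = (map_option (\<lambda>i. (i, g r)) H, \<lambda>j. if j \<in> S then Some (p j r) else None)"
  shows "random_mode M \<omega>"
  using assms unfolding random_mode_def by blast

lemma random_mode_const:
  assumes "\<And>i \<gamma>. fst \<omega> = Some (i, \<gamma>) \<Longrightarrow> snd \<omega> i = None"
  shows "random_mode M (\<lambda>_. \<omega>)"
proof (rule random_modeI[where H = "map_option fst (fst \<omega>)" and S = "{j. snd \<omega> j \<noteq> None}" and
        g = "\<lambda>_. snd (the (fst \<omega>))" and p = "\<lambda>j _. the (snd \<omega> j)"])
  show "i \<notin> {j. snd \<omega> j \<noteq> None}" if "map_option fst (fst \<omega>) = Some i" for i
    using that assms by (cases "fst \<omega>") (auto simp del: not_None_eq)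
  show "\<omega> = (map_option (\<lambda>i. (i, snd (the (fst \<omega>)))) (map_option fst (fst \<omega>)),
      \<lambda>j. if j \<in> {j. snd \<omega> j \<noteq> None} then Some (the (snd \<omega> j)) else None)"
    by (rule prod_eqI; cases "fst \<omega>") (auto simp: fun_eq_iff simp del: not_None_eq)
qed auto

lemma random_mode_switch:
  assumes \<omega>: "random_mode M \<omega>" and x: "x \<in> borel_measurable M"
  shows "random_mode M (\<lambda>r. switch_mode \<sigma> (x r) (\<omega> r))"
proof -
  from \<omega> obtain H S g p where 1: "g \<in> borel_measurable M" "\<And>j. p j \<in> borel_measurable M"
    and \<omega>_eq: "\<omega> = (\<lambda>r. (map_option (\<lambda>i. (i, g r)) H, \<lambda>j. if j \<in> S then Some (p j r) else None))"
    by (rule random_modeE) (rule that)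
  show ?thesis
  proof (cases \<sigma>)
    case (Pick_up h)
    show ?thesis
      by (rule random_modeI[where H = "Some h" and S = "S - {h}" and g = x and p = p])
         (auto simp: Pick_up \<omega>_eq 1 x)
  next
    case (Put_down h)
    show ?thesis
      by (rule random_modeI[where H = None and S = "insert h S" and g = x and p = "p(h := x)"])
         (auto simp: Put_down \<omega>_eq 1 x)
  qed
qed

lemma the_if_Some_measurable:
  "q \<in> measurable M N \<Longrightarrow> (\<lambda>r. the (if b then Some (q r) else None)) \<in> measurable M N"
  if "b \<or> the None \<in> space N"
  using that by (cases b) simp_all

text \<open>The held objects are deterministic, so a single equation of
  \<open>switch_transform\<close> applies at every outcome.\<close>

lemma switch_transform_measurable:
  assumes \<omega>: "random_mode M \<omega>" and \<omega>': "random_mode M \<omega>'"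
  shows "(\<lambda>r. switch_transform (\<omega> r) (\<omega>' r)) \<in> borel_measurable M"
proof -
  from \<omega> obtain H S g p where [measurable]: "g \<in> borel_measurable M" "\<And>j. p j \<in> borel_measurable M"
    and \<omega>_eq: "\<omega> = (\<lambda>r. (map_option (\<lambda>i. (i, g r)) H, \<lambda>j. if j \<in> S then Some (p j r) else None))"
    by (rule random_modeE) (rule that)
  from \<omega>' obtain H' S' g' p' where [measurable]: "g' \<in> borel_measurable M" "\<And>j. p' j \<in> borel_measurable M"
    and \<omega>'_eq: "\<omega>' = (\<lambda>r. (map_option (\<lambda>i. (i, g' r)) H', \<lambda>j. if j \<in> S' then Some (p' j r) else None))"
    by (rule random_modeE) (rule that)
  show ?thesis
    unfolding \<omega>_eq \<omega>'_eq
    by (cases H; cases H') (auto intro!: borel_measurable_ee_transform the_if_Some_measurable \<open>\<And>j. p j \<in> borel_measurable M\<close>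
        \<open>\<And>j. p' j \<in> borel_measurable M\<close>)
qed

lemma if_Some_eq: "(if b then Some x else None) = Some y \<longleftrightarrow> b \<and> y = x"
  by auto

section \<open>Measurability of collision, legality and goal tests\<close>

context valid_ppm
begin

lemma pred_segment_conf_space:
  assumes [measurable]: "a \<in> borel_measurable M" "b \<in> borel_measurable M"
  shows "Measurable.pred M (\<lambda>r. closed_segment (a r) (b r) \<subseteq> conf_space \<P>)"
proof -
  have T: "{(q, q'). closed_segment q q' \<subseteq> conf_space \<P>} \<in> sets borel"
    using tests by (simp add: measurable_tests_def)
  have "(\<lambda>r. (a r, b r)) \<in> borel_measurable M" by (intro borel_measurable_Pair assms)
  from measurable_sets[OF this T] show ?thesis
    by (simp add: pred_def vimage_def Int_def conj_commute)
qed

lemma pred_segment_robot_placed: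
  assumes "a \<in> borel_measurable M" "b \<in> borel_measurable M" "p \<in> borel_measurable M"
  shows "Measurable.pred M (\<lambda>r. \<forall>x \<in> closed_segment (a r) (b r).
    robot_body \<P> x \<inter> placed_body \<P> j (p r) = {})"
proof -
  have T: "{(q, q', p). \<forall>x \<in> closed_segment q q'. robot_body \<P> x \<inter> placed_body \<P> j p = {}} \<in> sets borel"
    using tests by (simp add: measurable_tests_def)
  have "(\<lambda>r. (a r, b r, p r)) \<in> borel_measurable M" by (intro borel_measurable_Pair assms)
  from measurable_sets[OF this T] show ?thesis
    by (simp add: pred_def vimage_def Int_def conj_commute)
qed

lemma pred_segment_robot_held:
  assumes "a \<in> borel_measurable M" "b \<in> borel_measurable M" "g \<in> borel_measurable M"
  shows "Measurable.pred M (\<lambda>r. \<forall>x \<in> closed_segment (a r) (b r).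
    robot_body \<P> x \<inter> held_body \<P> (i, g r) x = {})"
proof -
  have T: "{(q, q', \<gamma>). \<forall>x \<in> closed_segment q q'. robot_body \<P> x \<inter> held_body \<P> (i, \<gamma>) x = {}} \<in> sets borel"
    using tests by (simp add: measurable_tests_def)
  have "(\<lambda>r. (a r, b r, g r)) \<in> borel_measurable M" by (intro borel_measurable_Pair assms)
  from measurable_sets[OF this T] show ?thesis
    by (simp add: pred_def vimage_def Int_def conj_commute)
qed

lemma pred_segment_held_placed:
  assumes "a \<in> borel_measurable M" "b \<in> borel_measurable M" "g \<in> borel_measurable M"
    "p \<in> borel_measurable M" "i \<noteq> j"
  shows "Measurable.pred M (\<lambda>r. \<forall>x \<in> closed_segment (a r) (b r).
    held_body \<P> (i, g r) x \<inter> placed_body \<P> j (p r) = {})"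
proof -
  have T: "{(q, q', \<gamma>, p). \<forall>x \<in> closed_segment q q'.
      held_body \<P> (i, \<gamma>) x \<inter> placed_body \<P> j p = {}} \<in> sets borel"
    using tests \<open>i \<noteq> j\<close> unfolding measurable_tests_def by blast
  have "(\<lambda>r. (a r, b r, g r, p r)) \<in> borel_measurable M" by (intro borel_measurable_Pair assms)
  from measurable_sets[OF this T] show ?thesis
    by (simp add: pred_def vimage_def Int_def conj_commute)
qed

lemma pred_placed_placed:
  assumes "p \<in> borel_measurable M" "p' \<in> borel_measurable M" "i \<noteq> j"
  shows "Measurable.pred M (\<lambda>r. placed_body \<P> i (p r) \<inter> placed_body \<P> j (p' r) = {})"
proof -
  have T: "{(p, p'). placed_body \<P> i p \<inter> placed_body \<P> j p' = {}} \<in> sets borel"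
    using tests \<open>i \<noteq> j\<close> unfolding measurable_tests_def by blast
  have "(\<lambda>r. (p r, p' r)) \<in> borel_measurable M" by (intro borel_measurable_Pair assms)
  from measurable_sets[OF this T] show ?thesis
    by (simp add: pred_def vimage_def Int_def conj_commute)
qed

text \<open>As the shape of the mode is fixed, freedom from collisions is a finite conjunction of
  pairwise tests. The held object is not placed, so the tests between objects concern distinct
  objects only.\<close>

lemma pred_segment_mode_confs:
  assumes \<omega>: "random_mode M \<omega>"
    and a: "a \<in> borel_measurable M" and b: "b \<in> borel_measurable M"
  shows "Measurable.pred M (\<lambda>r. closed_segment (a r) (b r) \<subseteq> mode_confs \<P> (\<omega> r))"
proof -
  from \<omega> obtain H S g p where g: "g \<in> borel_measurable M" and p: "\<And>j. p j \<in> borel_measurable M"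
    and wf: "\<And>i. H = Some i \<Longrightarrow> i \<notin> S"
    and \<omega>_eq: "\<omega> = (\<lambda>r. (map_option (\<lambda>i. (i, g r)) H, \<lambda>j. if j \<in> S then Some (p j r) else None))"
    by (rule random_modeE) (rule that)
  have eq: "closed_segment (a r) (b r) \<subseteq> mode_confs \<P> (\<omega> r) \<longleftrightarrow>
      closed_segment (a r) (b r) \<subseteq> conf_space \<P> \<and>
      (\<forall>j\<in>S. \<forall>x\<in>closed_segment (a r) (b r). robot_body \<P> x \<inter> placed_body \<P> j (p j r) = {}) \<and>
      (\<forall>i\<in>{i. H = Some i}.
        (\<forall>x\<in>closed_segment (a r) (b r). robot_body \<P> x \<inter> held_body \<P> (i, g r) x = {}) \<and>
        (\<forall>j\<in>S. \<forall>x\<in>closed_segment (a r) (b r). held_body \<P> (i, g r) x \<inter> placed_body \<P> j (p j r) = {}))" for r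
    unfolding mode_confs_def \<omega>_eq snd_conv fst_conv if_Some_eq
    by (cases H) (simp_all del: split_paired_All split_paired_Ex, blast+)
  show ?thesis unfolding eq
    using wf
    by (intro pred_intros_logic pred_intros_finite pred_segment_conf_space pred_segment_robot_placed
        pred_segment_robot_held pred_segment_held_placed a b g p finite) auto
qed

lemma pred_legal_mode:
  assumes \<omega>: "random_mode M \<omega>"
  shows "Measurable.pred M (\<lambda>r. legal_mode \<P> (\<omega> r))"
proof -
  from \<omega> obtain H S g p where [measurable]: "g \<in> borel_measurable M" "\<And>j. p j \<in> borel_measurable M"
    and \<omega>_eq: "\<omega> = (\<lambda>r. (map_option (\<lambda>i. (i, g r)) H, \<lambda>j. if j \<in> S then Some (p j r) else None))"
    by (rule random_modeE) (rule that)
  have eq: "legal_mode \<P> (\<omega> r) \<longleftrightarrow>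
      (H = None \<and> (\<forall>j. j \<in> S \<and> p j r \<in> pose_space \<P> j) \<or>
       (\<exists>h. H = Some h \<and> g r \<in> grasp_space \<P> h \<and> h \<notin> S \<and>
            (\<forall>j. j \<noteq> h \<longrightarrow> j \<in> S \<and> p j r \<in> pose_space \<P> j))) \<and>
      (\<forall>i\<in>S. \<forall>j\<in>S - {i}. placed_body \<P> i (p i r) \<inter> placed_body \<P> j (p j r) = {})" for r
    unfolding legal_mode_def transit_mode_def transfer_mode_def \<omega>_eq snd_conv fst_conv if_Some_eq
    by (cases H) (simp_all del: split_paired_All split_paired_Ex, blast+)
  have 1: "Measurable.pred M (\<lambda>r. \<forall>i\<in>S. \<forall>j\<in>S - {i}.
      placed_body \<P> i (p i r) \<inter> placed_body \<P> j (p j r) = {})"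
    by (intro pred_intros_finite pred_placed_placed finite) auto
  have 2: "Measurable.pred M (\<lambda>r. p j r \<in> pose_space \<P> j)" for j by measurable
  have 3: "Measurable.pred M (\<lambda>r. g r \<in> grasp_space \<P> j)" for j by measurable
  have c: "Measurable.pred M (\<lambda>r. c)" for c by simp
  show ?thesis unfolding eq
    by (intro pred_intros_logic pred_intros_finite pred_intros_countable 1 2 3 c)
qed

lemma pred_goal_mode:
  assumes \<omega>: "random_mode M \<omega>"
  shows "Measurable.pred M (\<lambda>r. goal_mode \<P> (\<omega> r))"
proof -
  from \<omega> obtain H S g p where [measurable]: "g \<in> borel_measurable M" "\<And>j. p j \<in> borel_measurable M"
    and \<omega>_eq: "\<omega> = (\<lambda>r. (map_option (\<lambda>i. (i, g r)) H, \<lambda>j. if j \<in> S then Some (p j r) else None))"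
    by (rule random_modeE) (rule that)
  have eq: "goal_mode \<P> (\<omega> r) \<longleftrightarrow>
      (H = None \<and> None \<in> goal_hand \<P> \<or> (\<exists>h. H = Some h \<and> g r \<in> goal_grasps \<P> h)) \<and>
      (\<forall>j. j \<in> S \<and> p j r \<in> goal_placements \<P> j \<or> j \<notin> S \<and> None \<in> goal_pose \<P> j)" for r
    unfolding goal_mode_def goal_grasps_def goal_placements_def \<omega>_eq
    by (cases H) (auto split: if_splits)
  have 2: "Measurable.pred M (\<lambda>r. p j r \<in> goal_placements \<P> j)" for j by measurable
  have 3: "Measurable.pred M (\<lambda>r. g r \<in> goal_grasps \<P> j)" for j by measurable
  have c: "Measurable.pred M (\<lambda>r. c)" for c by simp
  show ?thesis unfolding eq
    by (intro pred_intros_logic pred_intros_countable 2 3 c)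
qed

lemma pred_goal_states:
  assumes \<omega>: "random_mode M \<omega>" and [measurable]: "a \<in> borel_measurable M"
  shows "Measurable.pred M (\<lambda>r. (a r, \<omega> r) \<in> goal_states \<P>)"
proof -
  \<comment> \<open>A degenerate segment turns the test along a segment into a test at one
    configuration.\<close>
  have "Measurable.pred M (\<lambda>r. closed_segment (a r) (a r) \<subseteq> mode_confs \<P> (\<omega> r))"
    by (rule pred_segment_mode_confs[OF \<omega>]) measurable
  then have 1: "Measurable.pred M (\<lambda>r. a r \<in> mode_confs \<P> (\<omega> r))" by simp
  have 2: "Measurable.pred M (\<lambda>r. a r \<in> goal_conf \<P>)" by measurable
  show ?thesis
    unfolding goal_states_def legal_state_def mem_Collect_eq fst_conv snd_conv
    by (intro pred_intros_logic 1 2 pred_legal_mode pred_goal_mode \<omega>)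
qed

end

section \<open>Measurability of the search\<close>

declare split_paired_All [simp del] split_paired_Ex [simp del]

text \<open>If some index up to \<open>n\<close> qualifies, the least one is decided by the indices
  up to \<open>n\<close>. Applied to first occurrences, this shows that later draws cannot change a
  seed number.\<close>

lemma Least_cong_le:
  fixes P Q :: "nat \<Rightarrow> bool"
  assumes "\<And>a. a \<le> n \<Longrightarrow> P a \<longleftrightarrow> Q a" "a \<le> n" "P a"
  shows "(LEAST a. P a) = (LEAST a. Q a)"
proof (rule sym, rule Least_equality)
  have le: "(LEAST a. P a) \<le> n"
    using Least_le[of P a] assms(2,3) by simp
  show "Q (LEAST a. P a)"
    using LeastI[of P a] assms le by auto
  show "(LEAST a. P a) \<le> y" if "Q y" for y
    using Least_le[of P y] assms(1)[of y] that le by (cases "y \<le> n") auto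
qed

lemma pose_at_cong: "(\<And>m. m \<le> n \<Longrightarrow> r m = r' m) \<Longrightarrow> a \<le> 2 * n \<Longrightarrow> pose_at \<P> r i a = pose_at \<P> r' i a"
  by (auto simp: pose_at_def elim!: oddE)

lemma grasp_at_cong: "(\<And>m. m \<le> n \<Longrightarrow> r m = r' m) \<Longrightarrow> a \<le> 2 * n \<Longrightarrow> grasp_at \<P> r i a = grasp_at \<P> r' i a"
  by (auto simp: grasp_at_def elim!: oddE)

lemma poses_cong: "(\<And>m. m \<le> n \<Longrightarrow> r m = r' m) \<Longrightarrow> poses \<P> r n i = poses \<P> r' n i"
  unfolding poses_def using pose_at_cong[of n r r'] by (metis (no_types, lifting))

lemma grasps_cong: "(\<And>m. m \<le> n \<Longrightarrow> r m = r' m) \<Longrightarrow> grasps \<P> r n i = grasps \<P> r' n i"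
  unfolding grasps_def using grasp_at_cong[of n r r'] by (metis (no_types, lifting))

lemma pose_index_cong:
  assumes "\<And>m. m \<le> n \<Longrightarrow> r m = r' m" "p \<in> poses \<P> r n i"
  shows "(LEAST a. pose_at \<P> r i a = Some p) = (LEAST a. pose_at \<P> r' i a = Some p)"
proof -
  obtain a where "a \<le> 2 * n" "pose_at \<P> r i a = Some p"
    using assms(2) by (auto simp: poses_def)
  then show ?thesis
    using pose_at_cong[OF assms(1)] by (intro Least_cong_le[where n = "2 * n"]) auto
qed

lemma grasp_index_cong:
  assumes "\<And>m. m \<le> n \<Longrightarrow> r m = r' m" "p \<in> grasps \<P> r n i"
  shows "(LEAST a. grasp_at \<P> r i a = Some p) = (LEAST a. grasp_at \<P> r' i a = Some p)"
proof -
  obtain a where "a \<le> 2 * n" "grasp_at \<P> r i a = Some p"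
    using assms(2) by (auto simp: grasps_def)
  then show ?thesis
    using grasp_at_cong[OF assms(1)] by (intro Least_cong_le[where n = "2 * n"]) auto
qed

lemma poses_mono: "n \<le> n' \<Longrightarrow> poses \<P> r n i \<subseteq> poses \<P> r n' i"
  by (auto simp: poses_def) (metis le_trans mult_le_mono2)

lemma grasps_mono: "n \<le> n' \<Longrightarrow> grasps \<P> r n i \<subseteq> grasps \<P> r n' i"
  by (auto simp: grasps_def) (metis le_trans mult_le_mono2)

lemma ik_samples_iff:
  "q \<in> ik_samples \<P> r n i \<longleftrightarrow> (\<exists>m\<in>{1..n}. \<exists>p \<in> poses \<P> r m i. \<exists>\<gamma> \<in> grasps \<P> r m i.
     q = ik_draw \<P> r m i p \<gamma> \<and> q \<in> ik_confs \<P> (ee_transform p \<gamma>))"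
proof (induction n)
  case (Suc n)
  have "{1..Suc n} = insert (Suc n) {1..n}" by auto
  with Suc show ?case by (auto simp del: atLeastAtMost_iff)
qed simp

lemma ik_samples_mono: "n \<le> n' \<Longrightarrow> ik_samples \<P> r n i \<subseteq> ik_samples \<P> r n' i"
  unfolding subset_iff ik_samples_iff using atLeastatMost_subset_iff[of 1 n 1 n'] by blast

lemma roadmap_vertices_iff:
  "q \<in> roadmap_vertices \<P> r n \<longleftrightarrow> q = init_conf \<P> \<or> (\<exists>i. q \<in> ik_samples \<P> r n i) \<or>
     (\<exists>m\<in>{1..n}. q = draw_conf (r m) \<or> q = draw_goal_conf (r m))"
proof (induction n)
  case (Suc n)
  have "{1..Suc n} = insert (Suc n) {1..n}" by auto
  moreover have "ik_samples \<P> r n i \<subseteq> ik_samples \<P> r (Suc n) i" for i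
    by (rule ik_samples_mono) simp
  ultimately show ?case
    using Suc by (auto simp del: atLeastAtMost_iff ik_samples.simps)
qed simp

lemma roadmap_vertices_mono: "n \<le> n' \<Longrightarrow> roadmap_vertices \<P> r n \<subseteq> roadmap_vertices \<P> r n'"
  unfolding subset_iff roadmap_vertices_iff
  using atLeastatMost_subset_iff[of 1 n 1 n'] ik_samples_mono[of n n'] by blast

text \<open>The seed number is a least index over the whole infinite run, but a pair used in
  iteration \<open>m\<close> has already occurred by then, so both first occurrences are
  settled.\<close>

lemma ik_samples_cong:
  assumes "\<And>m. m \<le> n \<Longrightarrow> r m = r' m"
  shows "ik_samples \<P> r n i = ik_samples \<P> r' n i"
proof -
  have "ik_draw \<P> r m i p \<gamma> = ik_draw \<P> r' m i p \<gamma>"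
    if "m \<in> {1..n}" "p \<in> poses \<P> r m i" "\<gamma> \<in> grasps \<P> r m i" for m p \<gamma>
    using that assms pose_index_cong[of m r r' p \<P> i] grasp_index_cong[of m r r' \<gamma> \<P> i]
    by (simp add: ik_draw_def)
  moreover have "poses \<P> r m i = poses \<P> r' m i" "grasps \<P> r m i = grasps \<P> r' m i" if "m \<in> {1..n}" for m
    using that assms by (intro poses_cong grasps_cong; simp)+
  ultimately show ?thesis
    unfolding set_eq_iff ik_samples_iff by (metis (no_types, lifting))
qed

lemma roadmap_vertices_cong:
  assumes "\<And>m. m \<le> n \<Longrightarrow> r m = r' m"
  shows "roadmap_vertices \<P> r n = roadmap_vertices \<P> r' n"
  unfolding set_eq_iff roadmap_vertices_iff using assms ik_samples_cong[OF assms] by auto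

text \<open>Single roadmap edges instead of the paths of Move, and no restriction to distinct endpoints.\<close>

definition elementary_step ::
    "('d::finite, 'w::finite, 'o::finite) ppm \<Rightarrow> ('d, 'w, 'o) run \<Rightarrow> nat \<Rightarrow>
     ('d, 'w, 'o) state \<Rightarrow> ('d, 'w, 'o) state \<Rightarrow> bool" where
  "elementary_step \<P> r n s s' \<longleftrightarrow>
     (snd s' = snd s \<and> fst s \<in> roadmap_vertices \<P> r n \<and> fst s' \<in> roadmap_vertices \<P> r n \<and>
        closed_segment (fst s) (fst s') \<subseteq> mode_confs \<P> (snd s)) \<or>
     (fst s' = fst s \<and> (\<exists>i. \<exists>p \<in> poses \<P> r n i. \<exists>\<gamma> \<in> grasps \<P> r n i.
        fst s \<in> ik_samples \<P> r n i \<inter> ik_confs \<P> (ee_transform p \<gamma>) \<and>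
        (fst (snd s) = None \<and> snd (snd s) i = Some p \<and> snd s' = switch_mode (Pick_up i) \<gamma> (snd s) \<or>
         fst (snd s) = Some (i, \<gamma>) \<and> snd s' = switch_mode (Put_down i) p (snd s))))"

lemma elementary_step_cong:
  assumes "\<And>m. m \<le> n \<Longrightarrow> r m = r' m"
  shows "elementary_step \<P> r n = elementary_step \<P> r' n"
  unfolding elementary_step_def fun_eq_iff
  using roadmap_vertices_cong[OF assms] ik_samples_cong[OF assms] poses_cong[OF assms] grasps_cong[OF assms]
  by simp

lemma elementary_step_mono:
  assumes "n \<le> n'" "elementary_step \<P> r n s s'"
  shows "elementary_step \<P> r n' s s'"
  using assms(2) roadmap_vertices_mono[OF assms(1), of \<P> r] ik_samples_mono[OF assms(1), of \<P> r]
    poses_mono[OF assms(1), of \<P> r] grasps_mono[OF assms(1), of \<P> r]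
  unfolding elementary_step_def by blast

lemma mode_confs_subset: "mode_confs \<P> \<omega> \<subseteq> conf_space \<P>"
  by (auto simp: mode_confs_def)

text \<open>A Move is a chain of edges, and conversely an edge is a Move along a path of length one;
  its segment lies in the configuration space because \<open>mode_confs\<close> does. A step that
  stays in place disappears in the reflexive closure.\<close>

lemma rtranclp_action: "(action \<P> r n)\<^sup>*\<^sup>* = (elementary_step \<P> r n)\<^sup>*\<^sup>*"
proof (rule antisym; rule predicate2I)
  fix s s' assume "(action \<P> r n)\<^sup>*\<^sup>* s s'"
  then show "(elementary_step \<P> r n)\<^sup>*\<^sup>* s s'"
  proof (induction rule: rtranclp_induct)
    case (step y z)
    from step(2) have "(elementary_step \<P> r n)\<^sup>*\<^sup>* y z"
    proof cases
      case (move q q' \<omega>)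
      from move(6) have "(elementary_step \<P> r n)\<^sup>*\<^sup>* (q, \<omega>) (q', \<omega>)"
      proof (induction rule: rtrancl_induct)
        case (step x x')
        then have "elementary_step \<P> r n (x, \<omega>) (x', \<omega>)"
          by (simp add: elementary_step_def roadmap_edges_def)
        with step(3) show ?case by (rule rtranclp.rtrancl_into_rtrancl)
      qed simp
      with move show ?thesis by simp
    next
      case (pick p i \<gamma> q ps)
      then have "elementary_step \<P> r n y z"
        unfolding elementary_step_def pick(1,2) fst_conv snd_conv switch_mode.simps by blast
      then show ?thesis by blast
    next
      case (place p i \<gamma> q ps)
      then have "elementary_step \<P> r n y z"
        unfolding elementary_step_def place(1,2) fst_conv snd_conv switch_mode.simps by blast
      then show ?thesis by blast
    qed
    with step(3) show ?case by (rule rtranclp_trans)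
  qed simp
next
  have 1: "(action \<P> r n)\<^sup>*\<^sup>* (q, \<omega>) (q', \<omega>')" if st: "elementary_step \<P> r n (q, \<omega>) (q', \<omega>')" for q \<omega> q' \<omega>'
  proof -
    consider (move) "\<omega>' = \<omega>" "q \<in> roadmap_vertices \<P> r n" "q' \<in> roadmap_vertices \<P> r n"
        "closed_segment q q' \<subseteq> mode_confs \<P> \<omega>"
      | (pick) i p \<gamma> where "p \<in> poses \<P> r n i" "\<gamma> \<in> grasps \<P> r n i" "q' = q"
        "q \<in> ik_samples \<P> r n i \<inter> ik_confs \<P> (ee_transform p \<gamma>)"
        "fst \<omega> = None" "snd \<omega> i = Some p" "\<omega>' = switch_mode (Pick_up i) \<gamma> \<omega>"
      | (place) i p \<gamma> where "p \<in> poses \<P> r n i" "\<gamma> \<in> grasps \<P> r n i" "q' = q"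
        "q \<in> ik_samples \<P> r n i \<inter> ik_confs \<P> (ee_transform p \<gamma>)"
        "fst \<omega> = Some (i, \<gamma>)" "\<omega>' = switch_mode (Put_down i) p \<omega>"
      using st unfolding elementary_step_def fst_conv snd_conv by blast
    then show ?thesis
    proof cases
      case move
      show ?thesis
      proof (cases "q = q'")
        case False
        have "(q, q') \<in> {(x, y) \<in> roadmap_edges \<P> r n. closed_segment x y \<subseteq> mode_confs \<P> \<omega>}"
          using move mode_confs_subset[of \<P> \<omega>] by (auto simp: roadmap_edges_def)
        then have "action \<P> r n (q, \<omega>) (q', \<omega>)"
          using move False by (intro action.move r_into_rtrancl) auto
        then show ?thesis using move by blast
      qed (simp add: move)
    next
      case pick
      obtain ps where "\<omega> = (None, ps)" using pick by (cases \<omega>) auto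
      with pick action.pick[of p \<P> r n i \<gamma> q ps] show ?thesis by auto
    next
      case place
      obtain ps where "\<omega> = (Some (i, \<gamma>), ps)" using place by (cases \<omega>) auto
      with place action.place[of p \<P> r n i \<gamma> q ps] show ?thesis by auto
    qed
  qed
  fix s s' assume "(elementary_step \<P> r n)\<^sup>*\<^sup>* s s'"
  then show "(action \<P> r n)\<^sup>*\<^sup>* s s'"
  proof (induction rule: rtranclp_induct)
    case (step y z)
    from step(2) have "(action \<P> r n)\<^sup>*\<^sup>* y z"
      using 1[of "fst y" "snd y" "fst z" "snd z"] by simp
    with step(3) show ?case by (rule rtranclp_trans)
  qed simp
qed

lemma solved_iff: "solved \<P> r n \<longleftrightarrow>
    (\<exists>s \<in> goal_states \<P>. (elementary_step \<P> r n)\<^sup>*\<^sup>* (init_state \<P>) s)"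
  by (simp add: solved_def rtranclp_action)

lemma solved_cong: "(\<And>m. m \<le> n \<Longrightarrow> r m = r' m) \<Longrightarrow> solved \<P> r n = solved \<P> r' n"
  using elementary_step_cong[of n r r' \<P>] by (simp add: solved_iff)

lemma solved_mono:
  assumes "n \<le> n'" "solved \<P> r n"
  shows "solved \<P> r n'"
proof -
  have "elementary_step \<P> r n \<le> elementary_step \<P> r n'"
    using elementary_step_mono[OF assms(1)] by blast
  then show ?thesis
    using assms(2) rtranclp_mono[of "elementary_step \<P> r n" "elementary_step \<P> r n'"]
    unfolding solved_iff by blast
qed

section \<open>The search on countable indices\<close>

text \<open>To make the reachable states measurable, the search is run on indices, which form a countable set
  that does not depend on the random choices. The vertex \<open>Inl (m, i, a, b)\<close> is the inverse kinematics
  draw of iteration \<open>m\<close> for the pose number \<open>a\<close> and the grasp number \<open>b\<close> of object \<open>i\<close>;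
  \<open>Inr (Inl m)\<close> and \<open>Inr (Inr m)\<close> are the draws from the configuration space and from the goal
  configurations, and \<open>m = 0\<close> stands for the initial configuration.\<close>

type_synonym 'o vertex_index = "(nat \<times> 'o \<times> nat \<times> nat) + nat + nat"
type_synonym 'o mode_index = "('o \<times> nat) option \<times> ('o \<Rightarrow> nat option)"

text \<open>Whether an index carries a pose depends on the problem but not on the run; this keeps
  the shape of indexed modes deterministic.\<close>

definition pose_defined :: "('d::finite, 'w::finite, 'o::finite) ppm \<Rightarrow> 'o \<Rightarrow> nat \<Rightarrow> bool" where
  "pose_defined \<P> i a \<longleftrightarrow>
     (if a = 0 then init_pose \<P> i \<noteq> None else odd a \<or> goal_placements \<P> i \<noteq> {})"

definition grasp_defined :: "('d::finite, 'w::finite, 'o::finite) ppm \<Rightarrow> 'o \<Rightarrow> nat \<Rightarrow> bool" where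
  "grasp_defined \<P> i a \<longleftrightarrow>
     (if a = 0 then \<exists>\<gamma>. init_hand \<P> = Some (i, \<gamma>) else odd a \<or> goal_object \<P> = Some i)"

definition pose_value where "pose_value \<P> r i a = the (pose_at \<P> r i a)"
definition grasp_value where "grasp_value \<P> r i a = the (grasp_at \<P> r i a)"

lemma pose_at_eq: "pose_at \<P> r i a = (if pose_defined \<P> i a then Some (pose_value \<P> r i a) else None)"
  by (auto simp: pose_at_def pose_defined_def pose_value_def)

lemma grasp_at_eq: "grasp_at \<P> r i a = (if grasp_defined \<P> i a then Some (grasp_value \<P> r i a) else None)"
  by (auto simp: grasp_at_def grasp_defined_def grasp_value_def split: option.split)

lemma poses_eq: "poses \<P> r n i = pose_value \<P> r i ` {a. a \<le> 2 * n \<and> pose_defined \<P> i a}"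
  unfolding poses_def pose_at_eq if_Some_eq by blast

lemma grasps_eq: "grasps \<P> r n i = grasp_value \<P> r i ` {a. a \<le> 2 * n \<and> grasp_defined \<P> i a}"
  unfolding grasps_def grasp_at_eq if_Some_eq by blast

fun vertex_value ::
    "('d::finite, 'w::finite, 'o::finite) ppm \<Rightarrow> ('d, 'w, 'o) run \<Rightarrow> 'o vertex_index \<Rightarrow> real^'d" where
  "vertex_value \<P> r (Inl (m, i, a, b)) = ik_draw \<P> r m i (pose_value \<P> r i a) (grasp_value \<P> r i b)"
| "vertex_value \<P> r (Inr (Inl m)) = (if m = 0 then init_conf \<P> else draw_conf (r m))"
| "vertex_value \<P> r (Inr (Inr m)) = (if m = 0 then init_conf \<P> else draw_goal_conf (r m))"

fun vertex_ok ::
    "('d::finite, 'w::finite, 'o::finite) ppm \<Rightarrow> ('d, 'w, 'o) run \<Rightarrow> nat \<Rightarrow> 'o vertex_index \<Rightarrow> bool" where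
  "vertex_ok \<P> r n (Inl (m, i, a, b)) \<longleftrightarrow> m \<in> {1..n} \<and> a \<le> 2 * m \<and> b \<le> 2 * m \<and>
     pose_defined \<P> i a \<and> grasp_defined \<P> i b \<and>
     ik_draw \<P> r m i (pose_value \<P> r i a) (grasp_value \<P> r i b) \<in>
       ik_confs \<P> (ee_transform (pose_value \<P> r i a) (grasp_value \<P> r i b))"
| "vertex_ok \<P> r n (Inr (Inl m)) \<longleftrightarrow> m \<le> n"
| "vertex_ok \<P> r n (Inr (Inr m)) \<longleftrightarrow> m \<le> n"

lemma ik_samples_iff_vertex:
  "q \<in> ik_samples \<P> r n i \<longleftrightarrow> (\<exists>m a b. vertex_ok \<P> r n (Inl (m, i, a, b)) \<and> vertex_value \<P> r (Inl (m, i, a, b)) = q)"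
  unfolding ik_samples_iff poses_eq grasps_eq vertex_ok.simps vertex_value.simps by blast

lemma roadmap_vertices_iff_vertex:
  "q \<in> roadmap_vertices \<P> r n \<longleftrightarrow> (\<exists>v. vertex_ok \<P> r n v \<and> vertex_value \<P> r v = q)" (is "_ \<longleftrightarrow> ?R")
proof
  assume "q \<in> roadmap_vertices \<P> r n"
  then consider "q = init_conf \<P>" | i where "q \<in> ik_samples \<P> r n i"
    | m where "1 \<le> m" "m \<le> n" "q = draw_conf (r m)" | m where "1 \<le> m" "m \<le> n" "q = draw_goal_conf (r m)"
    unfolding roadmap_vertices_iff by auto
  then show ?R
  proof cases
    case 1 then show ?thesis by (intro exI[of _ "Inr (Inl 0)"]) auto
  next
    case 2 then show ?thesis unfolding ik_samples_iff_vertex by blast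
  next
    case (3 m) then show ?thesis by (intro exI[of _ "Inr (Inl m)"]) auto
  next
    case (4 m) then show ?thesis by (intro exI[of _ "Inr (Inr m)"]) auto
  qed
next
  assume ?R
  then obtain v where v: "vertex_ok \<P> r n v" "vertex_value \<P> r v = q" by blast
  show "q \<in> roadmap_vertices \<P> r n"
  proof (cases v)
    case (Inl x)
    then show ?thesis
      using v unfolding roadmap_vertices_iff ik_samples_iff_vertex by (cases x) blast
  next
    case (Inr x)
    then show ?thesis
      using v unfolding roadmap_vertices_iff by (cases x) (auto split: if_splits)
  qed
qed

definition mode_value ::
    "('d::finite, 'w::finite, 'o::finite) ppm \<Rightarrow> ('d, 'w, 'o) run \<Rightarrow> 'o mode_index \<Rightarrow> ('w, 'o) mode" where
  "mode_value \<P> r \<mu> = (map_option (\<lambda>(i, b). (i, grasp_value \<P> r i b)) (fst \<mu>),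
     \<lambda>j. map_option (pose_value \<P> r j) (snd \<mu> j))"

text \<open>The clause \<open>snd \<mu> i = None\<close> supplies what \<open>random_mode\<close>
  demands of the held object. The initial mode satisfies it, and picks and places preserve
  it.\<close>

definition mode_ok :: "('d::finite, 'w::finite, 'o::finite) ppm \<Rightarrow> nat \<Rightarrow> 'o mode_index \<Rightarrow> bool" where
  "mode_ok \<P> n \<mu> \<longleftrightarrow>
     (\<forall>j a. snd \<mu> j = Some a \<longrightarrow> a \<le> 2 * n \<and> pose_defined \<P> j a) \<and>
     (\<forall>i b. fst \<mu> = Some (i, b) \<longrightarrow> b \<le> 2 * n \<and> grasp_defined \<P> i b \<and> snd \<mu> i = None)"

text \<open>The current vertex need not be an inverse kinematics index of \<open>i\<close>:
  membership in \<open>ik_samples\<close> concerns values, so it is enough that some such index has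
  the same value.\<close>

definition index_step ::
    "('d::finite, 'w::finite, 'o::finite) ppm \<Rightarrow> ('d, 'w, 'o) run \<Rightarrow> nat \<Rightarrow>
     'o vertex_index \<times> 'o mode_index \<Rightarrow> 'o vertex_index \<times> 'o mode_index \<Rightarrow> bool" where
  "index_step \<P> r n x y \<longleftrightarrow> mode_ok \<P> n (snd x) \<and> mode_ok \<P> n (snd y) \<and>
     vertex_ok \<P> r n (fst x) \<and> vertex_ok \<P> r n (fst y) \<and>
     (snd y = snd x \<and>
        closed_segment (vertex_value \<P> r (fst x)) (vertex_value \<P> r (fst y)) \<subseteq>
          mode_confs \<P> (mode_value \<P> r (snd x)) \<or>
      fst y = fst x \<and> (\<exists>i a b. a \<le> 2 * n \<and> b \<le> 2 * n \<and> pose_defined \<P> i a \<and> grasp_defined \<P> i b \<and>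
        (\<exists>m a' b'. vertex_ok \<P> r n (Inl (m, i, a', b')) \<and>
           vertex_value \<P> r (Inl (m, i, a', b')) = vertex_value \<P> r (fst x)) \<and>
        vertex_value \<P> r (fst x) \<in> ik_confs \<P> (ee_transform (pose_value \<P> r i a) (grasp_value \<P> r i b)) \<and>
        (fst (snd x) = None \<and> snd (snd x) i = Some a \<and>
           snd y = (Some (i, b), (snd (snd x))(i := None)) \<or>
         fst (snd x) = Some (i, b) \<and> snd y = (None, (snd (snd x))(i := Some a)))))"

definition index_init :: "('d::finite, 'w::finite, 'o::finite) ppm \<Rightarrow> 'o vertex_index \<times> 'o mode_index" where
  "index_init \<P> = (Inr (Inl 0), map_option (\<lambda>(i, \<gamma>). (i, 0)) (init_hand \<P>),
     \<lambda>j. map_option (\<lambda>_. 0) (init_pose \<P> j))"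

definition index_value where
  "index_value \<P> r x = (vertex_value \<P> r (fst x), mode_value \<P> r (snd x))"

lemma index_step_sound:
  assumes "index_step \<P> r n x y"
  shows "elementary_step \<P> r n (index_value \<P> r x) (index_value \<P> r y)"
proof -
  from assms have ok: "mode_ok \<P> n (snd x)" "vertex_ok \<P> r n (fst x)" "vertex_ok \<P> r n (fst y)"
    by (auto simp: index_step_def)
  from assms consider
    (move) "snd y = snd x" "closed_segment (vertex_value \<P> r (fst x)) (vertex_value \<P> r (fst y)) \<subseteq>
          mode_confs \<P> (mode_value \<P> r (snd x))"
    | (switch) i a b where "fst y = fst x" "a \<le> 2 * n" "b \<le> 2 * n" "pose_defined \<P> i a" "grasp_defined \<P> i b"
       "vertex_value \<P> r (fst x) \<in> ik_samples \<P> r n i"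
       "vertex_value \<P> r (fst x) \<in> ik_confs \<P> (ee_transform (pose_value \<P> r i a) (grasp_value \<P> r i b))"
       "fst (snd x) = None \<and> snd (snd x) i = Some a \<and>
           snd y = (Some (i, b), (snd (snd x))(i := None)) \<or>
         fst (snd x) = Some (i, b) \<and> snd y = (None, (snd (snd x))(i := Some a))"
    unfolding index_step_def ik_samples_iff_vertex by (elim conjE disjE exE) blast+
  then show ?thesis
  proof cases
    case move
    then show ?thesis
      using ok unfolding elementary_step_def index_value_def fst_conv snd_conv
      by (metis roadmap_vertices_iff_vertex)
  next
    case switch
    have "pose_value \<P> r i a \<in> poses \<P> r n i" "grasp_value \<P> r i b \<in> grasps \<P> r n i"
      using switch by (auto simp: poses_eq grasps_eq)
    moreover from switch(8) have
      "fst (mode_value \<P> r (snd x)) = None \<and> snd (mode_value \<P> r (snd x)) i = Some (pose_value \<P> r i a) \<and>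
       mode_value \<P> r (snd y) = switch_mode (Pick_up i) (grasp_value \<P> r i b) (mode_value \<P> r (snd x)) \<or>
       fst (mode_value \<P> r (snd x)) = Some (i, grasp_value \<P> r i b) \<and>
       mode_value \<P> r (snd y) = switch_mode (Put_down i) (pose_value \<P> r i a) (mode_value \<P> r (snd x))"
      by (auto simp: mode_value_def fun_eq_iff)
    ultimately show ?thesis
      using switch(1,6,7) unfolding elementary_step_def index_value_def fst_conv snd_conv by auto
  qed
qed

text \<open>Several indices may have the same value. A pick keeps the pose index stored in the mode,
  a place keeps the stored grasp index, and a new index is chosen only for the value that the step
  introduces.\<close>

lemma index_step_complete:
  assumes "elementary_step \<P> r n (index_value \<P> r x) s" "mode_ok \<P> n (snd x)" "vertex_ok \<P> r n (fst x)"
  shows "\<exists>y. index_step \<P> r n x y \<and> index_value \<P> r y = s"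
proof -
  let ?\<omega> = "mode_value \<P> r (snd x)"
  obtain H A where x: "snd x = (H, A)" by (cases "snd x")
  from assms(1) consider
    (move) "snd s = ?\<omega>" "fst s \<in> roadmap_vertices \<P> r n"
      "closed_segment (vertex_value \<P> r (fst x)) (fst s) \<subseteq> mode_confs \<P> ?\<omega>"
    | (pick) i p \<gamma> where "fst s = vertex_value \<P> r (fst x)" "p \<in> poses \<P> r n i" "\<gamma> \<in> grasps \<P> r n i"
        "fst s \<in> ik_samples \<P> r n i" "fst s \<in> ik_confs \<P> (ee_transform p \<gamma>)"
        "fst ?\<omega> = None" "snd ?\<omega> i = Some p" "snd s = switch_mode (Pick_up i) \<gamma> ?\<omega>"
    | (place) i p \<gamma> where "fst s = vertex_value \<P> r (fst x)" "p \<in> poses \<P> r n i" "\<gamma> \<in> grasps \<P> r n i"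
        "fst s \<in> ik_samples \<P> r n i" "fst s \<in> ik_confs \<P> (ee_transform p \<gamma>)"
        "fst ?\<omega> = Some (i, \<gamma>)" "snd s = switch_mode (Put_down i) p ?\<omega>"
    unfolding elementary_step_def index_value_def fst_conv snd_conv by (elim conjE disjE exE bexE) auto
  then show ?thesis
  proof cases
    case move
    then obtain v where "vertex_ok \<P> r n v" "vertex_value \<P> r v = fst s"
      unfolding roadmap_vertices_iff_vertex by blast
    with move assms show ?thesis
      by (intro exI[of _ "(v, snd x)"]) (auto simp: index_step_def index_value_def prod_eq_iff)
  next
    case pick
    from pick(6,7) obtain a where H: "H = None" and a: "A i = Some a" "pose_value \<P> r i a = p"
      by (auto simp: mode_value_def x)
    from pick(3) obtain b where b: "b \<le> 2 * n" "grasp_defined \<P> i b" "grasp_value \<P> r i b = \<gamma>"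
      by (auto simp: grasps_eq)
    from assms(2) a have a': "a \<le> 2 * n" "pose_defined \<P> i a" by (auto simp: mode_ok_def x)
    let ?y = "(fst x, Some (i, b), A(i := None))"
    have "mode_ok \<P> n (snd ?y)"
      using assms(2) b by (auto simp: mode_ok_def x)
    then have "index_step \<P> r n x ?y"
      using assms pick(4,5) a a' b H unfolding pick(1) ik_samples_iff_vertex index_step_def x
      by auto
    moreover have "index_value \<P> r ?y = s"
      using pick(1,8) b by (auto simp: index_value_def mode_value_def x prod_eq_iff fun_eq_iff)
    ultimately show ?thesis by blast
  next
    case place
    from place(6) obtain b where H: "H = Some (i, b)" and b: "grasp_value \<P> r i b = \<gamma>"
      by (auto simp: mode_value_def x)
    from place(2) obtain a where a: "a \<le> 2 * n" "pose_defined \<P> i a" "pose_value \<P> r i a = p"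
      by (auto simp: poses_eq)
    from assms(2) H have b': "b \<le> 2 * n" "grasp_defined \<P> i b" by (auto simp: mode_ok_def x)
    let ?y = "(fst x, None, A(i := Some a))"
    have "mode_ok \<P> n (snd ?y)"
      using assms(2) a by (auto simp: mode_ok_def x)
    then have "index_step \<P> r n x ?y"
      using assms place(4,5) a b' b H unfolding place(1) ik_samples_iff_vertex index_step_def x
      by auto
    moreover have "index_value \<P> r ?y = s"
      using place(1,7) a by (auto simp: index_value_def mode_value_def x prod_eq_iff fun_eq_iff)
    ultimately show ?thesis by blast
  qed
qed

section \<open>Measurability of the halting time in iterations\<close>

context valid_ppm
begin

lemma init_hand_unplaced: "init_hand \<P> = Some (i, \<gamma>) \<Longrightarrow> init_pose \<P> i = None"
  using legal_init
  by (auto simp: legal_state_def legal_mode_def init_state_def init_mode_def transit_mode_def transfer_mode_def)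

lemma index_init: "mode_ok \<P> n (snd (index_init \<P>))" "vertex_ok \<P> r n (fst (index_init \<P>))"
  "index_value \<P> r (index_init \<P>) = init_state \<P>"
  using init_hand_unplaced
  by (auto simp: mode_ok_def index_init_def index_value_def mode_value_def init_state_def init_mode_def
      pose_defined_def grasp_defined_def pose_value_def grasp_value_def pose_at_def grasp_at_def
      fun_eq_iff map_option_case split: option.split)

text \<open>Steps on indices and steps on values simulate each other. The type of \<open>y\<close>
  is countable, since there are finitely many objects, so the right side becomes a countable union
  of events.\<close>

lemma solved_iff_index: "solved \<P> r n \<longleftrightarrow> (\<exists>y. (index_step \<P> r n)\<^sup>*\<^sup>* (index_init \<P>) y \<and>
    mode_ok \<P> n (snd y) \<and> index_value \<P> r y \<in> goal_states \<P>)"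
proof
  assume "solved \<P> r n"
  then obtain s where s: "s \<in> goal_states \<P>" "(elementary_step \<P> r n)\<^sup>*\<^sup>* (init_state \<P>) s"
    by (auto simp: solved_iff)
  from s(2) have "\<exists>y. (index_step \<P> r n)\<^sup>*\<^sup>* (index_init \<P>) y \<and> mode_ok \<P> n (snd y) \<and>
    vertex_ok \<P> r n (fst y) \<and> index_value \<P> r y = s"
  proof (induction rule: rtranclp_induct)
    case base
    show ?case using index_init by blast
  next
    case (step s' s)
    then obtain y where y: "(index_step \<P> r n)\<^sup>*\<^sup>* (index_init \<P>) y" "mode_ok \<P> n (snd y)"
      "vertex_ok \<P> r n (fst y)" "index_value \<P> r y = s'" by blast
    with step(2) index_step_complete[of \<P> r n y s] obtain z where
      z: "index_step \<P> r n y z" "index_value \<P> r z = s" by blast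
    from z(1) have "mode_ok \<P> n (snd z)" "vertex_ok \<P> r n (fst z)" by (simp_all add: index_step_def)
    moreover have "(index_step \<P> r n)\<^sup>*\<^sup>* (index_init \<P>) z"
      using y(1) z(1) by (rule rtranclp.rtrancl_into_rtrancl)
    ultimately show ?case using z(2) by blast
  qed
  with s(1) show "\<exists>y. (index_step \<P> r n)\<^sup>*\<^sup>* (index_init \<P>) y \<and>
    mode_ok \<P> n (snd y) \<and> index_value \<P> r y \<in> goal_states \<P>" by blast
next
  assume "\<exists>y. (index_step \<P> r n)\<^sup>*\<^sup>* (index_init \<P>) y \<and>
    mode_ok \<P> n (snd y) \<and> index_value \<P> r y \<in> goal_states \<P>"
  then obtain y where y: "(index_step \<P> r n)\<^sup>*\<^sup>* (index_init \<P>) y" "index_value \<P> r y \<in> goal_states \<P>"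
    by blast
  from y(1) have "(elementary_step \<P> r n)\<^sup>*\<^sup>* (init_state \<P>) (index_value \<P> r y)"
  proof (induction rule: rtranclp_induct)
    case base
    show ?case using index_init by simp
  next
    case (step y z)
    from step(3) index_step_sound[OF step(2)] show ?case by (rule rtranclp.rtrancl_into_rtrancl)
  qed
  with y(2) show "solved \<P> r n" by (auto simp: solved_iff)
qed

lemma pose_value_measurable [measurable]: "(\<lambda>r. pose_value \<P> r i a) \<in> borel_measurable (run_law \<P>)"
  unfolding pose_value_def pose_at_def by (cases "a = 0"; cases "odd a"; cases "goal_placements \<P> i = {}") simp_all

lemma grasp_value_measurable [measurable]: "(\<lambda>r. grasp_value \<P> r i a) \<in> borel_measurable (run_law \<P>)"
  unfolding grasp_value_def grasp_at_def by (cases "a = 0"; cases "odd a"; cases "goal_object \<P> = Some i") simp_all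

lemma pred_pose_at: "Measurable.pred (run_law \<P>) (\<lambda>r. pose_at \<P> r i a = Some (pose_value \<P> r i b))"
  unfolding pose_at_eq if_Some_eq by (intro pred_intros_logic pred_eq_borel pose_value_measurable) simp

lemma pred_grasp_at: "Measurable.pred (run_law \<P>) (\<lambda>r. grasp_at \<P> r i a = Some (grasp_value \<P> r i b))"
  unfolding grasp_at_eq if_Some_eq by (intro pred_intros_logic pred_eq_borel grasp_value_measurable) simp

lemma ik_draw_measurable [measurable]:
  "(\<lambda>r. ik_draw \<P> r m i (pose_value \<P> r i a) (grasp_value \<P> r i b)) \<in> borel_measurable (run_law \<P>)"
proof -
  have 1: "(\<lambda>r. LEAST a'. pose_at \<P> r i a' = Some (pose_value \<P> r i a)) \<in>
      measurable (run_law \<P>) (count_space UNIV)"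
    by (intro measurable_Least pred_pose_at)
  have 2: "(\<lambda>r. LEAST b'. grasp_at \<P> r i b' = Some (grasp_value \<P> r i b)) \<in>
      measurable (run_law \<P>) (count_space UNIV)"
    by (intro measurable_Least pred_grasp_at)
  have A: "(\<lambda>r. draw_seed (r m) (i, k, l)) \<in> borel_measurable (run_law \<P>)" for k l
    by measurable
  have B: "(\<lambda>r. draw_seed (r m) (i, k, LEAST b'. grasp_at \<P> r i b' = Some (grasp_value \<P> r i b)))
      \<in> borel_measurable (run_law \<P>)" for k
    by (rule measurable_compose_countable[where f = "\<lambda>l r. draw_seed (r m) (i, k, l)", OF A 2])
  have "(\<lambda>r. draw_seed (r m) (i, LEAST a'. pose_at \<P> r i a' = Some (pose_value \<P> r i a),
      LEAST b'. grasp_at \<P> r i b' = Some (grasp_value \<P> r i b))) \<in> borel_measurable (run_law \<P>)"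
    by (rule measurable_compose_countable[where f = "\<lambda>k r. draw_seed (r m) (i, k,
      LEAST b'. grasp_at \<P> r i b' = Some (grasp_value \<P> r i b))", OF B 1])
  then show ?thesis
    unfolding ik_draw_def
    by (intro ik_sampler_measurable borel_measurable_ee_transform pose_value_measurable grasp_value_measurable)
qed

lemma vertex_value_measurable [measurable]: "(\<lambda>r. vertex_value \<P> r v) \<in> borel_measurable (run_law \<P>)"
proof (cases v)
  case (Inl x)
  obtain m i a b where "x = (m, i, a, b)" by (cases x)
  with Inl show ?thesis by simp
next
  case (Inr x)
  then show ?thesis by (cases x) simp_all
qed

lemma pred_vertex_ok [measurable]: "Measurable.pred (run_law \<P>) (\<lambda>r. vertex_ok \<P> r n v)"
proof (cases v)
  case (Inl x)
  obtain m i a b where "x = (m, i, a, b)" by (cases x)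
  with Inl show ?thesis by simp
next
  case (Inr x)
  then show ?thesis by (cases x) simp_all
qed

lemma random_mode_value: "mode_ok \<P> n \<mu> \<Longrightarrow> random_mode (run_law \<P>) (\<lambda>r. mode_value \<P> r \<mu>)"
  by (rule random_modeI[where H = "map_option fst (fst \<mu>)" and S = "{j. snd \<mu> j \<noteq> None}" and
        g = "\<lambda>r. grasp_value \<P> r (fst (the (fst \<mu>))) (snd (the (fst \<mu>)))" and
        p = "\<lambda>j r. pose_value \<P> r j (the (snd \<mu> j))"])
     (auto simp: mode_ok_def mode_value_def fun_eq_iff map_option_case split: option.splits)

lemma pred_index_step [measurable]: "Measurable.pred (run_law \<P>) (\<lambda>r. index_step \<P> r n x y)"
proof (cases "mode_ok \<P> n (snd x)")
  case True
  have c: "Measurable.pred (run_law \<P>) (\<lambda>r. c)" for c by simp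
  show ?thesis
    unfolding index_step_def
    by (intro pred_intros_logic pred_intros_countable c pred_vertex_ok pred_segment_mode_confs
        random_mode_value[OF True] vertex_value_measurable pred_eq_borel pred_ik_confs
        borel_measurable_ee_transform pose_value_measurable grasp_value_measurable)
qed (simp add: index_step_def)

lemma pred_solved [measurable]: "Measurable.pred (run_law \<P>) (\<lambda>r. solved \<P> r n)"
proof -
  have "Measurable.pred (run_law \<P>) (\<lambda>r. (index_step \<P> r n)\<^sup>*\<^sup>* (index_init \<P>) y \<and>
      mode_ok \<P> n (snd y) \<and> index_value \<P> r y \<in> goal_states \<P>)" for y
  proof (cases "mode_ok \<P> n (snd y)")
    case True
    then have "Measurable.pred (run_law \<P>) (\<lambda>r. index_value \<P> r y \<in> goal_states \<P>)"
      unfolding index_value_def by (intro pred_goal_states random_mode_value) simp_all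
    moreover have "Measurable.pred (run_law \<P>) (\<lambda>r. (index_step \<P> r n)\<^sup>*\<^sup>* (index_init \<P>) y)"
      by (intro pred_rtranclp_countable pred_index_step)
    ultimately show ?thesis by simp
  qed simp
  then show ?thesis
    unfolding solved_iff_index by (rule pred_intros_countable)
qed

lemma ffrob_iterations_measurable:
  "ffrob_iterations \<P> \<in> measurable (run_law \<P>) (count_space UNIV)"
proof -
  have [measurable]: "(\<lambda>r. LEAST n. 1 \<le> n \<and> solved \<P> r n) \<in> measurable (run_law \<P>) (count_space UNIV)"
    by (intro measurable_Least) simp
  have [measurable]: "Measurable.pred (run_law \<P>) (\<lambda>r. \<exists>n\<ge>1. solved \<P> r n)"
    by (intro pred_intros_countable pred_intros_logic) simp_all
  show ?thesis
    unfolding ffrob_iterations_def by measurable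
qed

end

section \<open>Robust motions and plans\<close>

text \<open>Nodes of a path are indices rather than points, so that the existence of a path is a countable
  union of measurable events.\<close>

fun path_node :: "(nat \<Rightarrow> 'a) \<Rightarrow> 'a \<Rightarrow> 'a \<Rightarrow> nat \<Rightarrow> 'a" where
  "path_node v a b 0 = a"
| "path_node v a b (Suc 0) = b"
| "path_node v a b (Suc (Suc l)) = v l"

text \<open>The bound \<open>N + 2\<close> admits the two endpoints, nodes 0 and 1, and the points
  \<open>v l\<close> with \<open>l < N\<close>.\<close>

definition path_edge ::
    "'a::real_vector set \<Rightarrow> (nat \<Rightarrow> 'a) \<Rightarrow> nat \<Rightarrow> 'a \<Rightarrow> 'a \<Rightarrow> nat \<Rightarrow> nat \<Rightarrow> bool" where
  "path_edge Q v N a b x y \<longleftrightarrow> x < N + 2 \<and> y < N + 2 \<and>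
     closed_segment (path_node v a b x) (path_node v a b y) \<subseteq> Q"

definition path_via :: "'a::real_vector set \<Rightarrow> (nat \<Rightarrow> 'a) \<Rightarrow> nat \<Rightarrow> 'a \<Rightarrow> 'a \<Rightarrow> bool" where
  "path_via Q v N a b \<longleftrightarrow> (path_edge Q v N a b)\<^sup>*\<^sup>* 0 1"

lemma path_via_mono:
  assumes "N \<le> N'" "path_via Q v N a b"
  shows "path_via Q v N' a b"
proof -
  have "path_edge Q v N a b \<le> path_edge Q v N' a b"
    using assms(1) by (auto simp: path_edge_def)
  from rtranclp_mono[OF this] assms(2) show ?thesis by (auto simp: path_via_def)
qed

text \<open>Nodes 0 and 1 differ, so the path has a last edge, and the segment of that edge contains
  \<open>b\<close>.\<close>

lemma path_via_end: "path_via Q v N a b \<Longrightarrow> b \<in> Q"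
  unfolding path_via_def by (cases rule: rtranclp.cases, assumption) (auto simp: path_edge_def)

text \<open>The trajectory is cut so finely that it moves less than \<delta>/4 between neighbouring
  cut points, and a point of \<open>v\<close> is taken within \<delta>/4 of each of them. Clearance
  puts the segments between consecutive points inside \<open>Q\<close>; the two outer segments are
  those granted by robustness at the ends.\<close>

lemma robust_motion_path_via:
  fixes Q :: "'a::euclidean_space set"
  assumes "robust_motion Q q0 q1"
    and v: "\<And>c e. 0 < e \<Longrightarrow> ball c e \<subseteq> Q \<Longrightarrow> \<exists>l. v l \<in> ball c e"
  shows "\<exists>N. path_via Q v N q0 q1"
proof -
  from assms(1) obtain \<delta> L :: real and \<tau> where \<delta>: "0 < \<delta>" and L: "0 \<le> L" and cont: "continuous_on {0..L} \<tau>"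
    and "curve_length \<tau> 0 L = ennreal L"
    and \<tau>: "\<tau> ` {0..L} \<subseteq> Q" and far': "\<forall>s \<in> {0..L}. \<forall>x \<in> frontier Q. \<delta> \<le> dist (\<tau> s) x"
    and fst': "\<forall>q \<in> Q. norm (q - \<tau> 0) \<le> \<delta> / 2 \<longrightarrow> closed_segment q0 q \<subseteq> Q"
    and last': "\<forall>q \<in> Q. norm (q - \<tau> L) \<le> \<delta> / 2 \<longrightarrow> closed_segment q q1 \<subseteq> Q"
    unfolding robust_motion_def by (elim conjE exE) (rule that)
  note far = far'[rule_format] and fst_seg = fst'[rule_format] and last_seg = last'[rule_format]
  \<comment> \<open>A ball is connected: if it met both \<open>Q\<close> and the complement it would
    meet the frontier, at a distance below \<delta>.\<close>
  have ball: "ball (\<tau> s) \<delta> \<subseteq> Q" if "s \<in> {0..L}" for s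
  proof (rule ccontr)
    assume "\<not> ?thesis"
    then have "ball (\<tau> s) \<delta> - Q \<noteq> {}" by auto
    moreover have "ball (\<tau> s) \<delta> \<inter> Q \<noteq> {}"
      using that \<tau> \<delta> by (metis IntI centre_in_ball empty_iff image_subset_iff)
    ultimately have "ball (\<tau> s) \<delta> \<inter> frontier Q \<noteq> {}"
      using connected_Int_frontier[of "ball (\<tau> s) \<delta>" Q] by auto
    with far[OF that] show False by force
  qed
  have "uniformly_continuous_on {0..L} \<tau>"
    using cont by (intro compact_uniformly_continuous) auto
  then obtain \<eta> where \<eta>: "0 < \<eta>"
    and unif: "\<And>s s'. s \<in> {0..L} \<Longrightarrow> s' \<in> {0..L} \<Longrightarrow> dist s' s < \<eta> \<Longrightarrow> dist (\<tau> s') (\<tau> s) < \<delta> / 4"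
    unfolding uniformly_continuous_on_def using \<delta> by (metis zero_less_divide_iff zero_less_numeral)
  \<comment> \<open>With \<open>k\<close> pieces the mesh \<open>L / k\<close> is below \<eta>; the
    strict inequality makes \<open>k\<close> positive even for \<open>L = 0\<close>.\<close>
  obtain k :: nat where k: "L / \<eta> < k" using reals_Archimedean2 by blast
  have k0: "0 < real k"
    using k L \<eta> by (meson divide_nonneg_pos le_less_trans)
  define s where "s j = real j * L / k" for j :: nat
  have s_in: "s j \<in> {0..L}" if "j \<le> k" for j
    using that k0 L by (auto simp: s_def divide_simps mult.commute intro: mult_left_mono)
  have s_step: "dist (s (Suc j)) (s j) < \<eta>" for j
  proof -
    have "dist (s (Suc j)) (s j) = L / k"
      using L k0 by (simp add: s_def dist_real_def field_simps)
    also have "\<dots> < \<eta>" using k k0 \<eta> by (simp add: field_simps)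
    finally show ?thesis .
  qed
  have "\<exists>l. v l \<in> ball (\<tau> (s j)) (\<delta> / 4)" if "j \<le> k" for j
    using v[of "\<delta> / 4" "\<tau> (s j)"] ball[OF s_in[OF that]] \<delta> by (force simp: subset_eq)
  then obtain l where l: "\<And>j. j \<le> k \<Longrightarrow> v (l j) \<in> ball (\<tau> (s j)) (\<delta> / 4)" by metis
  define N where "N = Suc (Max (l ` {..k}))"
  have lN: "l j < N" if "j \<le> k" for j
    using that by (auto simp: N_def less_Suc_eq_le)
  have vQ: "v (l j) \<in> Q" if "j \<le> k" for j
    using l[OF that] ball[OF s_in[OF that]] \<delta> by (force simp: subset_eq)
  have "(path_edge Q v N q0 q1)\<^sup>*\<^sup>* 0 (Suc (Suc (l j)))" if "j \<le> k" for j
    using that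
  proof (induction j)
    case 0
    have "closed_segment q0 (v (l 0)) \<subseteq> Q"
      using l[of 0] vQ[of 0] \<delta> by (intro fst_seg) (auto simp: s_def dist_norm norm_minus_commute)
    then have "path_edge Q v N q0 q1 0 (Suc (Suc (l 0)))"
      using lN[of 0] by (simp add: path_edge_def)
    then show ?case by blast
  next
    case (Suc j)
    have "dist (\<tau> (s (Suc j))) (\<tau> (s j)) < \<delta> / 4"
      using Suc.prems s_step by (intro unif s_in) auto
    then have "dist (\<tau> (s j)) (v (l (Suc j))) < \<delta> / 2"
      using l[of "Suc j"] Suc.prems dist_triangle[of "\<tau> (s j)" "v (l (Suc j))" "\<tau> (s (Suc j))"]
      by (simp add: dist_commute)
    moreover have "dist (\<tau> (s j)) (v (l j)) < \<delta> / 2"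
      using l[of j] Suc.prems \<delta> by simp
    \<comment> \<open>Both points are within \<delta>/2 of \<open>\<tau> (s j)\<close>, one of them
      by \<delta>/4 + \<delta>/4, and a ball is convex.\<close>
    ultimately have "closed_segment (v (l j)) (v (l (Suc j))) \<subseteq> ball (\<tau> (s j)) \<delta>"
      using \<delta> by (intro closed_segment_subset convex_ball) auto
    then have "path_edge Q v N q0 q1 (Suc (Suc (l j))) (Suc (Suc (l (Suc j))))"
      using lN[of j] lN[of "Suc j"] Suc.prems ball[OF s_in[of j]] by (auto simp: path_edge_def)
    with Suc show ?case by (meson Suc_leD rtranclp.rtrancl_into_rtrancl)
  qed
  from this[of k] have "(path_edge Q v N q0 q1)\<^sup>*\<^sup>* 0 (Suc (Suc (l k)))" by simp
  moreover have "closed_segment (v (l k)) q1 \<subseteq> Q"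
    using l[of k] vQ[of k] \<delta> k0 by (intro last_seg) (auto simp: s_def dist_norm norm_minus_commute)
  then have "path_edge Q v N q0 q1 (Suc (Suc (l k))) 1"
    using lN[of k] by (simp add: path_edge_def)
  ultimately have "path_via Q v N q0 q1"
    unfolding path_via_def by (rule rtranclp.rtrancl_into_rtrancl)
  then show ?thesis ..
qed

section \<open>Executing a sequence of mode switches\<close>

fun switch_object :: "'o switch \<Rightarrow> 'o" where
  "switch_object (Pick_up h) = h"
| "switch_object (Put_down h) = h"

text \<open>Every switch takes place at a pose and a grasp of one object: one of the two is the new
  parameter \<open>x\<close>, the other is read off the mode before the switch.\<close>

fun switch_pose :: "'o switch \<Rightarrow> 'w::finite rigid \<Rightarrow> ('w, 'o) mode \<Rightarrow> 'w rigid" where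
  "switch_pose (Pick_up h) x \<omega> = the (snd \<omega> h)"
| "switch_pose (Put_down h) x \<omega> = x"

fun switch_grasp :: "'o switch \<Rightarrow> 'w::finite rigid \<Rightarrow> ('w, 'o) mode \<Rightarrow> 'w rigid" where
  "switch_grasp (Pick_up h) x \<omega> = x"
| "switch_grasp (Put_down h) x \<omega> = snd (the (fst \<omega>))"

fun value_sampled ::
    "('d::finite, 'w::finite, 'o::finite) ppm \<Rightarrow> ('d, 'w, 'o) run \<Rightarrow> nat \<Rightarrow> 'o switch \<Rightarrow> 'w rigid \<Rightarrow> bool" where
  "value_sampled \<P> r n (Pick_up h) x \<longleftrightarrow> x \<in> grasps \<P> r n h"
| "value_sampled \<P> r n (Put_down h) x \<longleftrightarrow> x \<in> poses \<P> r n h"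

definition mode_sampled ::
    "('d::finite, 'w::finite, 'o::finite) ppm \<Rightarrow> ('d, 'w, 'o) run \<Rightarrow> nat \<Rightarrow> ('w, 'o) mode \<Rightarrow> bool" where
  "mode_sampled \<P> r n \<omega> \<longleftrightarrow> (\<forall>i p. snd \<omega> i = Some p \<longrightarrow> p \<in> poses \<P> r n i) \<and>
     (\<forall>i \<gamma>. fst \<omega> = Some (i, \<gamma>) \<longrightarrow> \<gamma> \<in> grasps \<P> r n i)"

lemma mode_sampled_init: "mode_sampled \<P> r n (init_mode \<P>)"
  by (force simp: mode_sampled_def init_mode_def poses_def grasps_def pose_at_def grasp_at_def)

lemma mode_sampled_switch:
  "mode_sampled \<P> r n \<omega> \<Longrightarrow> value_sampled \<P> r n \<sigma> x \<Longrightarrow> mode_sampled \<P> r n (switch_mode \<sigma> x \<omega>)"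
  by (cases \<sigma>) (auto simp: mode_sampled_def)

text \<open>Adjacency excludes switches that do not fit the mode. For a put-down all objects are
  placed afterwards and only the pose of \<open>h\<close> has changed, so the object that was
  unplaced, hence held, is \<open>h\<close>.\<close>

lemma mode_adjacent_switch:
  assumes "mode_adjacent \<P> \<omega> (switch_mode \<sigma> x \<omega>)"
  shows "switch_transform \<omega> (switch_mode \<sigma> x \<omega>) = ee_transform (switch_pose \<sigma> x \<omega>) (switch_grasp \<sigma> x \<omega>)"
    and "case \<sigma> of Pick_up h \<Rightarrow> fst \<omega> = None \<and> snd \<omega> h = Some (switch_pose \<sigma> x \<omega>)
      | Put_down h \<Rightarrow> fst \<omega> = Some (h, switch_grasp \<sigma> x \<omega>)"
proof -
  obtain g ps where \<omega>: "\<omega> = (g, ps)" by (cases \<omega>)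
  have "switch_transform \<omega> (switch_mode \<sigma> x \<omega>) = ee_transform (switch_pose \<sigma> x \<omega>) (switch_grasp \<sigma> x \<omega>) \<and>
    (case \<sigma> of Pick_up h \<Rightarrow> fst \<omega> = None \<and> snd \<omega> h = Some (switch_pose \<sigma> x \<omega>)
      | Put_down h \<Rightarrow> fst \<omega> = Some (h, switch_grasp \<sigma> x \<omega>))"
  proof (cases \<sigma>)
    case (Pick_up h)
    from assms have "transit_mode \<P> \<omega>"
      unfolding mode_adjacent_def transit_transfer_adjacent_def transit_mode_def Pick_up by auto
    then have "g = None" "\<exists>p. ps h = Some p"
      by (auto simp: transit_mode_def \<omega>)
    then show ?thesis by (auto simp: Pick_up \<omega>)
  next
    case (Put_down h)
    from assms obtain h' where tr: "transfer_mode \<P> h' \<omega>"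
      and t: "transit_mode \<P> (switch_mode \<sigma> x \<omega>)"
      unfolding mode_adjacent_def transit_transfer_adjacent_def transfer_mode_def Put_down by auto
    obtain p where "snd (switch_mode \<sigma> x \<omega>) h' = Some p"
      using t unfolding transit_mode_def by blast
    moreover have "ps h' = None" using tr by (auto simp: transfer_mode_def \<omega>)
    ultimately have "h' = h" by (auto simp: Put_down \<omega> split: if_splits)
    with tr obtain \<gamma> where "g = Some (h, \<gamma>)" by (auto simp: transfer_mode_def \<omega>)
    then show ?thesis by (auto simp: Put_down \<omega>)
  qed
  then show "switch_transform \<omega> (switch_mode \<sigma> x \<omega>) = ee_transform (switch_pose \<sigma> x \<omega>) (switch_grasp \<sigma> x \<omega>)"
    and "case \<sigma> of Pick_up h \<Rightarrow> fst \<omega> = None \<and> snd \<omega> h = Some (switch_pose \<sigma> x \<omega>)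
      | Put_down h \<Rightarrow> fst \<omega> = Some (h, switch_grasp \<sigma> x \<omega>)" by simp_all
qed

lemma switch_values_sampled:
  assumes "mode_adjacent \<P> \<omega> (switch_mode \<sigma> x \<omega>)" "mode_sampled \<P> r n \<omega>" "value_sampled \<P> r n \<sigma> x"
  shows "switch_pose \<sigma> x \<omega> \<in> poses \<P> r n (switch_object \<sigma>)"
    "switch_grasp \<sigma> x \<omega> \<in> grasps \<P> r n (switch_object \<sigma>)"
  using mode_adjacent_switch(2)[OF assms(1)] assms(2,3) by (cases \<sigma>; force simp: mode_sampled_def)+

lemma elementary_step_switch:
  assumes adj: "mode_adjacent \<P> \<omega> (switch_mode \<sigma> x \<omega>)"
    and "mode_sampled \<P> r n \<omega>" "value_sampled \<P> r n \<sigma> x"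
    and q: "q \<in> ik_samples \<P> r n (switch_object \<sigma>)" "q \<in> ik_confs \<P> (switch_transform \<omega> (switch_mode \<sigma> x \<omega>))"
  shows "elementary_step \<P> r n (q, \<omega>) (q, switch_mode \<sigma> x \<omega>)"
proof -
  note s = switch_values_sampled[OF assms(1-3)]
  have "q \<in> ik_samples \<P> r n (switch_object \<sigma>) \<inter>
      ik_confs \<P> (ee_transform (switch_pose \<sigma> x \<omega>) (switch_grasp \<sigma> x \<omega>))"
    using q mode_adjacent_switch(1)[OF adj] by simp
  moreover have "fst \<omega> = None \<and> snd \<omega> (switch_object \<sigma>) = Some (switch_pose \<sigma> x \<omega>) \<and>
        switch_mode \<sigma> x \<omega> = switch_mode (Pick_up (switch_object \<sigma>)) (switch_grasp \<sigma> x \<omega>) \<omega> \<or>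
      fst \<omega> = Some (switch_object \<sigma>, switch_grasp \<sigma> x \<omega>) \<and>
        switch_mode \<sigma> x \<omega> = switch_mode (Put_down (switch_object \<sigma>)) (switch_pose \<sigma> x \<omega>) \<omega>"
    using mode_adjacent_switch(2)[OF adj] by (cases \<sigma>) simp_all
  ultimately show ?thesis
    unfolding elementary_step_def fst_conv snd_conv using s by blast
qed

lemma elementary_steps_path_via:
  assumes "path_via (mode_confs \<P> \<omega>) v N a b"
    and "a \<in> roadmap_vertices \<P> r n" "b \<in> roadmap_vertices \<P> r n"
    and "\<And>l. l < N \<Longrightarrow> v l \<in> roadmap_vertices \<P> r n"
  shows "(elementary_step \<P> r n)\<^sup>*\<^sup>* (a, \<omega>) (b, \<omega>)"
proof -
  have V: "path_node v a b k \<in> roadmap_vertices \<P> r n" if "k < N + 2" for k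
    using that assms(2-4) by (cases "(v, a, b, k)" rule: path_node.cases) auto
  have "(elementary_step \<P> r n)\<^sup>*\<^sup>* (path_node v a b 0, \<omega>) (path_node v a b k, \<omega>)"
    if "(path_edge (mode_confs \<P> \<omega>) v N a b)\<^sup>*\<^sup>* 0 k" for k
    using that
  proof (induction rule: rtranclp_induct)
    case (step k k')
    have "elementary_step \<P> r n (path_node v a b k, \<omega>) (path_node v a b k', \<omega>)"
      using step(2) V unfolding elementary_step_def path_edge_def by simp
    with step(3) show ?case by (rule rtranclp.rtrancl_into_rtrancl)
  qed simp
  from this[of 1] assms(1) show ?thesis by (simp add: path_via_def)
qed

text \<open>This is \<open>modes_from\<close> with the parameter values given as a sequence, the
  form in which they are drawn.\<close>

primrec mode_along ::
    "('d::finite, 'w::finite, 'o::finite) ppm \<Rightarrow> (nat \<Rightarrow> 'o switch) \<Rightarrow> (nat \<Rightarrow> 'w rigid) \<Rightarrow> nat \<Rightarrow> ('w, 'o) mode" where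
  "mode_along \<P> \<sigma> x 0 = init_mode \<P>"
| "mode_along \<P> \<sigma> x (Suc j) = switch_mode (\<sigma> j) (x j) (mode_along \<P> \<sigma> x j)"

lemma length_modes_from [simp]: "length (modes_from \<omega> as) = Suc (length as)"
  by (induction \<omega> as rule: modes_from.induct) auto

lemma modes_from_nth_0 [simp]: "modes_from \<omega> as ! 0 = \<omega>"
  by (cases "(\<omega>, as)" rule: modes_from.cases) auto

lemma modes_from_nth_Suc:
  "j < length as \<Longrightarrow>
    modes_from \<omega> as ! Suc j = switch_mode (fst (as ! j)) (snd (as ! j)) (modes_from \<omega> as ! j)"
proof (induction \<omega> as arbitrary: j rule: modes_from.induct)
  case (2 \<omega> \<sigma> x as)
  then show ?case by (cases j) auto
qed simp

lemma modes_from_eq_mode_along: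
  assumes "\<And>j. j < length as \<Longrightarrow> as ! j = (\<sigma> j, x j)" "j \<le> length as"
  shows "modes_from (init_mode \<P>) as ! j = mode_along \<P> \<sigma> x j"
  using assms(2) by (induction j) (auto simp: modes_from_nth_Suc assms(1))

text \<open>There are \<open>K\<close> switches and \<open>K + 1\<close> modes. In mode
  \<open>j\<close> the robot goes from \<open>q j\<close> to \<open>q (Suc j)\<close>, where the
  next switch happens or, for \<open>j = K\<close>, the plan ends. The last path also certifies that
  its endpoint is free of collisions, hence legality of the final state.\<close>

lemma solved_along_modes:
  assumes adj: "\<And>j. j < K \<Longrightarrow> mode_adjacent \<P> (mode_along \<P> \<sigma> x j) (mode_along \<P> \<sigma> x (Suc j))"
    and legal: "legal_mode \<P> (mode_along \<P> \<sigma> x K)" and goal: "goal_mode \<P> (mode_along \<P> \<sigma> x K)"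
    and x: "\<And>j. j < K \<Longrightarrow> value_sampled \<P> r n (\<sigma> j) (x j)"
    and q0: "q 0 = init_conf \<P>"
    and q: "\<And>j. j < K \<Longrightarrow> q (Suc j) \<in> ik_samples \<P> r n (switch_object (\<sigma> j))"
      "\<And>j. j < K \<Longrightarrow> q (Suc j) \<in> ik_confs \<P> (switch_transform (mode_along \<P> \<sigma> x j) (mode_along \<P> \<sigma> x (Suc j)))"
    and qK: "q (Suc K) \<in> goal_conf \<P>" "q (Suc K) \<in> roadmap_vertices \<P> r n"
    and path: "\<And>j. j \<le> K \<Longrightarrow> path_via (mode_confs \<P> (mode_along \<P> \<sigma> x j)) v N (q j) (q (Suc j))"
    and v: "\<And>l. l < N \<Longrightarrow> v l \<in> roadmap_vertices \<P> r n"
  shows "solved \<P> r n"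
proof -
  have qV: "q j \<in> roadmap_vertices \<P> r n" if "j \<le> Suc K" for j
  proof (cases j)
    case 0
    then show ?thesis by (simp add: q0 roadmap_vertices_iff)
  next
    case (Suc i)
    then show ?thesis
      using q(1)[of i] qK(2) that by (cases "i = K") (auto simp: roadmap_vertices_iff)
  qed
  have *: "mode_sampled \<P> r n (mode_along \<P> \<sigma> x j) \<and>
    (elementary_step \<P> r n)\<^sup>*\<^sup>* (init_state \<P>) (q j, mode_along \<P> \<sigma> x j)" if "j \<le> K" for j
    using that
  proof (induction j)
    case 0
    then show ?case by (simp add: mode_sampled_init init_state_def q0)
  next
    case (Suc j)
    then have IH: "mode_sampled \<P> r n (mode_along \<P> \<sigma> x j)"
      "(elementary_step \<P> r n)\<^sup>*\<^sup>* (init_state \<P>) (q j, mode_along \<P> \<sigma> x j)" by simp_all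
    have "(elementary_step \<P> r n)\<^sup>*\<^sup>* (q j, mode_along \<P> \<sigma> x j) (q (Suc j), mode_along \<P> \<sigma> x j)"
      using Suc.prems by (intro elementary_steps_path_via[OF path] qV v) auto
    moreover have "elementary_step \<P> r n (q (Suc j), mode_along \<P> \<sigma> x j) (q (Suc j), mode_along \<P> \<sigma> x (Suc j))"
      using Suc.prems IH(1) adj[of j] x[of j] q[of j] by (simp add: elementary_step_switch)
    ultimately have "(elementary_step \<P> r n)\<^sup>*\<^sup>* (init_state \<P>) (q (Suc j), mode_along \<P> \<sigma> x (Suc j))"
      using IH(2) by (meson rtranclp.rtrancl_into_rtrancl rtranclp_trans)
    moreover have "mode_sampled \<P> r n (mode_along \<P> \<sigma> x (Suc j))"
      using IH(1) x[of j] Suc.prems by (simp add: mode_sampled_switch)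
    ultimately show ?case by blast
  qed
  have "(elementary_step \<P> r n)\<^sup>*\<^sup>* (q K, mode_along \<P> \<sigma> x K) (q (Suc K), mode_along \<P> \<sigma> x K)"
    by (intro elementary_steps_path_via[OF path] qV v) auto
  with *[of K] have "(elementary_step \<P> r n)\<^sup>*\<^sup>* (init_state \<P>) (q (Suc K), mode_along \<P> \<sigma> x K)"
    by (meson order_refl rtranclp_trans)
  moreover have "(q (Suc K), mode_along \<P> \<sigma> x K) \<in> goal_states \<P>"
    using legal goal qK(1) path_via_end[OF path[of K]] by (simp add: goal_states_def legal_state_def)
  ultimately show ?thesis unfolding solved_iff by blast
qed

section \<open>Sampling a plan\<close>

lemma distr_pair_fst_comp:
  assumes "prob_space A" "prob_space B" and f: "f \<in> measurable A C"
  shows "distr (A \<Otimes>\<^sub>M B) C (\<lambda>x. f (fst x)) = distr A C f"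
proof -
  have "distr (A \<Otimes>\<^sub>M B) C (f \<circ> fst) = distr (distr (A \<Otimes>\<^sub>M B) A fst) C f"
    using f by (simp add: distr_distr)
  also have "distr (A \<Otimes>\<^sub>M B) A fst = A"
    using assms(2) by (rule prob_space.distr_pair_fst)
  finally show ?thesis by (simp add: comp_def)
qed

lemma distr_pair_snd_comp:
  assumes "prob_space A" "prob_space B" and f: "f \<in> measurable B C"
  shows "distr (A \<Otimes>\<^sub>M B) C (\<lambda>x. f (snd x)) = distr B C f"
proof -
  have "distr (A \<Otimes>\<^sub>M B) C (f \<circ> snd) = distr (distr (A \<Otimes>\<^sub>M B) B snd) C f"
    using f by (simp add: distr_distr)
  also have "distr (A \<Otimes>\<^sub>M B) B snd = B"
    using assms(1,2) by (rule distr_pair_measure_snd)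
  finally show ?thesis by (simp add: comp_def)
qed

text \<open>The case distinction is that of \<open>switch_measure\<close>: the draw is the one whose
  law is the measure under which \<open>X\<close> is known to be positive.\<close>

definition switch_draw ::
    "('d::finite, 'w::finite, 'o::finite) ppm \<Rightarrow> 'o switch \<Rightarrow> 'w rigid set \<Rightarrow> ('d, 'w, 'o) draw \<Rightarrow> 'w rigid" where
  "switch_draw \<P> \<sigma> X d =
     (case \<sigma> of
        Pick_up h \<Rightarrow> if goal_object \<P> = Some h \<and> X \<subseteq> goal_grasps \<P> h then draw_goal_grasp d else draw_grasp d h
      | Put_down h \<Rightarrow> if X \<subseteq> goal_placements \<P> h then draw_goal_pose d h else draw_pose d h)"

text \<open>Iteration \<open>m\<close> fills the indices \<open>2 * m - 1\<close> and
  \<open>2 * m\<close>. If \<open>X\<close> is nonempty and consists of goal placements, there is a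
  goal placement to draw, so index \<open>2 * m\<close> does carry a pose.\<close>

lemma value_sampled_switch_draw:
  assumes "1 \<le> m" "m \<le> n" "X \<noteq> {}"
  shows "value_sampled \<P> r n \<sigma> (switch_draw \<P> \<sigma> X (r m))"
proof (cases \<sigma>)
  obtain k where m: "m = Suc k" using assms(1) by (cases m) auto
  case (Pick_up h)
  have "draw_grasp (r m) h \<in> grasps \<P> r n h"
    using assms unfolding grasps_def by (auto intro!: exI[of _ "Suc (2 * k)"] simp: grasp_at_def m)
  moreover have "draw_goal_grasp (r m) \<in> grasps \<P> r n h" if "goal_object \<P> = Some h"
    using assms that unfolding grasps_def by (auto intro!: exI[of _ "2 * m"] simp: grasp_at_def)
  ultimately show ?thesis by (simp add: Pick_up switch_draw_def)
next
  obtain k where m: "m = Suc k" using assms(1) by (cases m) auto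
  case (Put_down h)
  have "draw_pose (r m) h \<in> poses \<P> r n h"
    using assms unfolding poses_def by (auto intro!: exI[of _ "Suc (2 * k)"] simp: pose_at_def m)
  moreover have "draw_goal_pose (r m) h \<in> poses \<P> r n h" if "goal_placements \<P> h \<noteq> {}"
    using assms that unfolding poses_def by (auto intro!: exI[of _ "2 * m"] simp: pose_at_def)
  ultimately show ?thesis using assms(3) by (auto simp: Put_down switch_draw_def)
qed

text \<open>Draw \<open>y j\<close> supplies the configuration that ends mode \<open>j\<close>:
  through its seed if a switch follows, through its goal configuration for \<open>j = K\<close>. The
  first components of the same draws are left for the roadmap.\<close>

primrec conf_along ::
    "('d::finite, 'w::finite, 'o::finite) ppm \<Rightarrow> nat \<Rightarrow> (nat \<Rightarrow> 'o switch) \<Rightarrow> (nat \<Rightarrow> 'w rigid) \<Rightarrow>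
     (nat \<Rightarrow> (real^'d) \<times> (real^'d) \<times> real) \<Rightarrow> nat \<Rightarrow> real^'d" where
  "conf_along \<P> K \<sigma> x y 0 = init_conf \<P>"
| "conf_along \<P> K \<sigma> x y (Suc j) =
     (if j < K then ik_sampler \<P> (snd (snd (y j))) (switch_transform (mode_along \<P> \<sigma> x j) (mode_along \<P> \<sigma> x (Suc j)))
      else fst (snd (y j)))"

text \<open>A condition on the drawn values only, without the sets and clearances of robust
  feasibility; this is why it defines a measurable event jointly in \<open>x\<close> and
  \<open>y\<close>.\<close>

definition plan_along ::
    "('d::finite, 'w::finite, 'o::finite) ppm \<Rightarrow> nat \<Rightarrow> (nat \<Rightarrow> 'o switch) \<Rightarrow> nat \<Rightarrow> (nat \<Rightarrow> 'w rigid) \<Rightarrow>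
     (nat \<Rightarrow> (real^'d) \<times> (real^'d) \<times> real) \<Rightarrow> bool" where
  "plan_along \<P> K \<sigma> N x y \<longleftrightarrow>
     (\<forall>j<K. conf_along \<P> K \<sigma> x y (Suc j) \<in>
        ik_confs \<P> (switch_transform (mode_along \<P> \<sigma> x j) (mode_along \<P> \<sigma> x (Suc j)))) \<and>
     conf_along \<P> K \<sigma> x y (Suc K) \<in> goal_conf \<P> \<and>
     (\<forall>j\<le>K. path_via (mode_confs \<P> (mode_along \<P> \<sigma> x j)) (\<lambda>l. fst (y l)) N
        (conf_along \<P> K \<sigma> x y j) (conf_along \<P> K \<sigma> x y (Suc j)))"

lemma plan_along_mono: "N \<le> N' \<Longrightarrow> plan_along \<P> K \<sigma> N x y \<Longrightarrow> plan_along \<P> K \<sigma> N' x y"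
  unfolding plan_along_def using path_via_mono by blast

context valid_ppm
begin

lemma distr_draw_law:
  "distr (draw_law \<P>) (pose_law i) (\<lambda>d. draw_pose d i) = pose_law i"
  "distr (draw_law \<P>) (goal_pose_law \<P> i) (\<lambda>d. draw_goal_pose d i) = goal_pose_law \<P> i"
  "distr (draw_law \<P>) (grasp_law i) (\<lambda>d. draw_grasp d i) = grasp_law i"
  "distr (draw_law \<P>) (goal_grasp_law \<P>) draw_goal_grasp = goal_grasp_law \<P>"
proof -
  let ?A7 = "seeds_law"
  let ?A6 = "goal_conf_law \<Otimes>\<^sub>M ?A7"
  let ?A5 = "conf_law \<Otimes>\<^sub>M ?A6"
  let ?A4 = "goal_grasp_law \<P> \<Otimes>\<^sub>M ?A5"
  let ?A3 = "(\<Pi>\<^sub>M i\<in>UNIV. grasp_law i) \<Otimes>\<^sub>M ?A4"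
  let ?A2 = "(\<Pi>\<^sub>M i\<in>UNIV. goal_pose_law \<P> i) \<Otimes>\<^sub>M ?A3"
  have P: "prob_space (\<Pi>\<^sub>M i\<in>UNIV. pose_law i)" "prob_space (\<Pi>\<^sub>M i\<in>UNIV. goal_pose_law \<P> i)"
    "prob_space (\<Pi>\<^sub>M i\<in>UNIV. grasp_law i)"
    by (intro prob_space_PiM prob_space_laws)+
  have A: "prob_space ?A5" "prob_space ?A4" "prob_space ?A3" "prob_space ?A2"
    by (intro P prob_space_pair prob_space_PiM prob_space_laws prob_space_seed_law)+
  have C: "(\<lambda>x. x i) \<in> measurable (\<Pi>\<^sub>M i\<in>UNIV. pose_law i) (pose_law i)"
    "(\<lambda>x. x i) \<in> measurable (\<Pi>\<^sub>M i\<in>UNIV. goal_pose_law \<P> i) (goal_pose_law \<P> i)"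
    "(\<lambda>x. x i) \<in> measurable (\<Pi>\<^sub>M i\<in>UNIV. grasp_law i) (grasp_law i)" for i
    by (intro measurable_component_singleton UNIV_I)+
  have D: "distr (\<Pi>\<^sub>M i\<in>UNIV. pose_law i) (pose_law i) (\<lambda>x. x i) = pose_law i"
    "distr (\<Pi>\<^sub>M i\<in>UNIV. goal_pose_law \<P> i) (goal_pose_law \<P> i) (\<lambda>x. x i) = goal_pose_law \<P> i"
    "distr (\<Pi>\<^sub>M i\<in>UNIV. grasp_law i) (grasp_law i) (\<lambda>x. x i) = grasp_law i"
    using distr_PiM_component[of UNIV pose_law i] distr_PiM_component[of UNIV "goal_pose_law \<P>" i]
      distr_PiM_component[of UNIV grasp_law i] prob_space_laws by simp_all
  show "distr (draw_law \<P>) (pose_law i) (\<lambda>d. draw_pose d i) = pose_law i"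
    using distr_pair_fst_comp[OF P(1) A(4) C(1), of i] D(1)
    by (simp add: draw_law_def draw_pose_def case_prod_beta)
  show "distr (draw_law \<P>) (goal_pose_law \<P> i) (\<lambda>d. draw_goal_pose d i) = goal_pose_law \<P> i"
    using distr_pair_snd_comp[OF P(1) A(4), of "\<lambda>x. fst x i" "goal_pose_law \<P> i"]
      distr_pair_fst_comp[OF P(2) A(3) C(2), of i] D(2)
    by (simp add: draw_law_def draw_goal_pose_def case_prod_beta measurable_compose[OF measurable_fst C(2)])
  show "distr (draw_law \<P>) (grasp_law i) (\<lambda>d. draw_grasp d i) = grasp_law i"
    using distr_pair_snd_comp[OF P(1) A(4), of "\<lambda>x. fst (snd x) i" "grasp_law i"]
      distr_pair_snd_comp[OF P(2) A(3), of "\<lambda>x. fst x i" "grasp_law i"]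
      distr_pair_fst_comp[OF P(3) A(2) C(3), of i] D(3)
    by (simp add: draw_law_def draw_grasp_def case_prod_beta measurable_compose[OF measurable_fst C(3)]
        measurable_compose[OF measurable_snd measurable_compose[OF measurable_fst C(3)]])
  have e: "draw_goal_grasp = (\<lambda>d :: ('d, 'w, 'o) draw. fst (snd (snd (snd d))))"
    by (simp add: draw_goal_grasp_def case_prod_beta fun_eq_iff)
  show "distr (draw_law \<P>) (goal_grasp_law \<P>) draw_goal_grasp = goal_grasp_law \<P>"
    using distr_pair_snd_comp[OF P(1) A(4), of "\<lambda>x. fst (snd (snd x))" "goal_grasp_law \<P>"]
      distr_pair_snd_comp[OF P(2) A(3), of "\<lambda>x. fst (snd x)" "goal_grasp_law \<P>"]
      distr_pair_snd_comp[OF P(3) A(2), of "fst" "goal_grasp_law \<P>"]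
      prob_space.distr_pair_fst[OF A(1), of "goal_grasp_law \<P>"]
    by (simp add: draw_law_def e)
qed

lemma switch_draw_measurable [measurable]: "switch_draw \<P> \<sigma> X \<in> borel_measurable (draw_law \<P>)"
  unfolding switch_draw_def by (cases \<sigma>) simp_all

text \<open>The law of \<open>switch_draw\<close> is the uniform measure that
  \<open>switch_measure\<close> refers to, in each of its four cases, so positive relative measure
  is positive probability.\<close>

lemma switch_draw_pos:
  assumes X: "X \<subseteq> switch_space \<P> \<sigma>" "0 < switch_measure \<P> \<sigma> X"
  shows "X \<in> sets borel" "0 < emeasure (draw_law \<P>) {d. switch_draw \<P> \<sigma> X d \<in> X}"
proof -
  have ne: "X \<noteq> {}" using X(2) by (cases \<sigma>) (auto simp: rel_measure_def split: if_splits)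
  \<comment> \<open>Common end of the four cases, with \<open>L\<close> the law of the selected
    draw.\<close>
  have key: "X \<in> sets borel \<and> 0 < emeasure (draw_law \<P>) {d. switch_draw \<P> \<sigma> X d \<in> X}"
    if "X \<in> sets borel" "0 < emeasure L X" "distr (draw_law \<P>) L (switch_draw \<P> \<sigma> X) = L" "sets L = sets borel"
    for L
  proof -
    have "emeasure L X = emeasure (distr (draw_law \<P>) L (switch_draw \<P> \<sigma> X)) X"
      using that by simp
    also have "\<dots> = emeasure (draw_law \<P>) {d. switch_draw \<P> \<sigma> X d \<in> X}"
      using that by (subst emeasure_distr) (auto simp: vimage_def measurable_cong_sets[OF refl that(4)])
    finally show ?thesis using that by simp
  qed
  have "X \<in> sets borel \<and> 0 < emeasure (draw_law \<P>) {d. switch_draw \<P> \<sigma> X d \<in> X}"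
  proof (cases \<sigma>)
    case (Pick_up h)
    show ?thesis
    proof (cases "goal_object \<P> = Some h \<and> X \<subseteq> goal_grasps \<P> h")
      case True
      then have "measure_on (goal_grasp_mu \<P>) (goal_grasps \<P> h)" by (intro goal_grasps_measure) simp
      from emeasure_uniform_measure_on_pos[OF this, of X] True X show ?thesis
        by (intro key[of "goal_grasp_law \<P>"])
          (auto simp: goal_grasp_law_def[symmetric] switch_draw_def[abs_def] Pick_up distr_draw_law,
            simp add: goal_grasp_law_def)
    next
      case False
      then have f: "(goal_object \<P> = Some h \<and> X \<subseteq> goal_grasps \<P> h) = False" by blast
      have "0 < rel_measure (grasp_mu \<P> h) (grasp_space \<P> h) X"
        using X(2) unfolding Pick_up switch_measure.simps f if_False .
      note pos = emeasure_uniform_measure_on_pos[OF grasp_space_measure _ this]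
      have "switch_draw \<P> \<sigma> X = (\<lambda>d. draw_grasp d h)"
        unfolding switch_draw_def[abs_def] Pick_up switch.case f if_False ..
      with pos X(1) show ?thesis
        by (intro key[of "grasp_law h"]) (auto simp: Pick_up distr_draw_law)
    qed
  next
    case (Put_down h)
    show ?thesis
    proof (cases "X \<subseteq> goal_placements \<P> h")
      case True
      with ne have g: "goal_placements \<P> h \<noteq> {}" by auto
      have "goal_pose_law \<P> h = uniform_measure (goal_pose_mu \<P> h) (goal_placements \<P> h)"
        using g by (simp add: goal_pose_law_def)
      note pos = emeasure_uniform_measure_on_pos[OF goal_placements_measure[OF g], folded this, of X]
      show ?thesis
        using pos True X
        by (intro key[of "goal_pose_law \<P> h"]) (auto simp: switch_draw_def[abs_def] Put_down distr_draw_law)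
    next
      case False
      then have f: "(X \<subseteq> goal_placements \<P> h) = False" by blast
      have "0 < rel_measure (pose_mu \<P> h) (pose_space \<P> h) X"
        using X(2) unfolding Put_down switch_measure.simps f if_False .
      note pos = emeasure_uniform_measure_on_pos[OF pose_space_measure _ this]
      have "switch_draw \<P> \<sigma> X = (\<lambda>d. draw_pose d h)"
        unfolding switch_draw_def[abs_def] Put_down switch.case f if_False ..
      with pos X(1) show ?thesis
        by (intro key[of "pose_law h"]) (auto simp: Put_down distr_draw_law)
    qed
  qed
  then show "X \<in> sets borel" "0 < emeasure (draw_law \<P>) {d. switch_draw \<P> \<sigma> X d \<in> X}" by simp_all
qed

lemma space_essential_law [simp]: "space essential_law = UNIV"
  by (simp add: space_pair_measure)

lemma space_essential_run_law [simp]: "space essential_run_law = UNIV"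
  by (simp add: space_PiM)

text \<open>The configuration components are independent and uniform, and a ball inside the
  configuration space has positive Lebesgue measure. The quantifier over balls stands under the
  almost sure one, because the balls to be visited will depend on \<open>y\<close> through the
  switch configurations.\<close>

lemma AE_essential_dense:
  "AE y in essential_run_law. \<forall>c e. 0 < e \<and> ball c e \<subseteq> conf_space \<P> \<longrightarrow> (\<exists>l. fst (y l) \<in> ball c e)"
proof -
  have fm: "fst \<in> measurable essential_law conf_law" by (rule measurable_fst)
  have d: "distr essential_law conf_law fst = conf_law"
    by (intro prob_space.distr_pair_fst prob_space_pair prob_space_laws prob_space_seed_law)
  have *: "distr essential_run_law (\<Pi>\<^sub>M _\<in>UNIV. conf_law) (\<lambda>y l. fst (y l)) = (\<Pi>\<^sub>M _\<in>(UNIV::nat set). conf_law)"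
    using distr_PiM_map[of UNIV "\<lambda>_::nat. essential_law" "\<lambda>_. fst" "\<lambda>_. conf_law"]
      prob_space_essential_law fm d by (simp add: restrict_def)
  have m: "(\<lambda>y l. fst (y l)) \<in> measurable essential_run_law (\<Pi>\<^sub>M _\<in>(UNIV::nat set). conf_law)"
    by (intro measurable_PiM_single') (auto intro: measurable_compose[where g = fst and N = essential_law, OF _ fm])
  have "AE x in \<Pi>\<^sub>M _\<in>(UNIV::nat set). conf_law. \<forall>U. open U \<and> emeasure conf_law U > 0 \<longrightarrow> (\<exists>n. x n \<in> U)"
    by (intro AE_PiM_visits_open prob_space_laws) simp
  then have "AE x in distr essential_run_law (\<Pi>\<^sub>M _\<in>(UNIV::nat set). conf_law) (\<lambda>y l. fst (y l)).
      \<forall>U. open U \<and> emeasure conf_law U > 0 \<longrightarrow> (\<exists>n. x n \<in> U)"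
    by (simp only: *)
  from AE_distrD[OF m this]
  have "AE y in essential_run_law. \<forall>U. open U \<and> emeasure conf_law U > 0 \<longrightarrow> (\<exists>n. fst (y n) \<in> U)" .
  then show ?thesis
  proof (eventually_elim, intro allI impI)
    fix y c e assume y: "\<forall>U. open U \<and> emeasure conf_law U > 0 \<longrightarrow> (\<exists>n. fst (y n :: (real^'d) \<times> (real^'d) \<times> real) \<in> U)"
      and ce: "0 < e \<and> ball c e \<subseteq> conf_space \<P>"
    have "0 < measure lborel (ball c e)" using ce content_ball_pos[of e c] by simp
    then have "emeasure lborel (ball c e) \<noteq> 0" by (auto simp: measure_def)
    moreover have "conf_space \<P> \<inter> ball c e = ball c e" using ce by auto
    ultimately have "0 < emeasure conf_law (ball c e)"
      using conf_space_measure
      by (simp add: measure_on_def ennreal_zero_less_divide less_top zero_less_iff_neq_zero)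
    with y show "\<exists>l. fst (y l) \<in> ball c e" by blast
  qed
qed

lemma random_mode_along:
  assumes "\<And>j. (\<lambda>z. x z j) \<in> borel_measurable M"
  shows "random_mode M (\<lambda>z. mode_along \<P> \<sigma> (x z) j)"
proof (induction j)
  case 0
  show ?case
    using random_mode_const[of "init_mode \<P>" M] init_hand_unplaced by (simp add: init_mode_def)
next
  case (Suc j)
  then show ?case by (simp add: random_mode_switch assms)
qed

lemma conf_along_measurable:
  assumes x: "\<And>j. (\<lambda>z. x z j) \<in> borel_measurable M"
    and y: "\<And>j. (\<lambda>z. fst (snd (y z j))) \<in> borel_measurable M" "\<And>j. (\<lambda>z. snd (snd (y z j))) \<in> borel_measurable M"
  shows "(\<lambda>z. conf_along \<P> K \<sigma> (x z) (y z) j) \<in> borel_measurable M"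
proof (cases j)
  case (Suc i)
  have "(\<lambda>z. ik_sampler \<P> (snd (snd (y z i)))
      (switch_transform (mode_along \<P> \<sigma> (x z) i) (mode_along \<P> \<sigma> (x z) (Suc i)))) \<in> borel_measurable M"
    by (intro ik_sampler_measurable switch_transform_measurable random_mode_along x y)
  with y(1) show ?thesis by (cases "i < K") (simp_all add: Suc)
qed simp

lemma pred_plan_along:
  assumes x: "\<And>j. (\<lambda>z. x z j) \<in> borel_measurable M"
    and y: "\<And>j. (\<lambda>z. fst (y z j)) \<in> borel_measurable M"
      "\<And>j. (\<lambda>z. fst (snd (y z j))) \<in> borel_measurable M" "\<And>j. (\<lambda>z. snd (snd (y z j))) \<in> borel_measurable M"
  shows "Measurable.pred M (\<lambda>z. plan_along \<P> K \<sigma> N (x z) (y z))"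
proof -
  note c = conf_along_measurable[OF x y(2,3)]
  note m = random_mode_along[OF x]
  have t: "Measurable.pred M (\<lambda>z. conf_along \<P> K \<sigma> (x z) (y z) (Suc j) \<in>
      ik_confs \<P> (switch_transform (mode_along \<P> \<sigma> (x z) j) (mode_along \<P> \<sigma> (x z) (Suc j))))" for j
    by (intro pred_ik_confs switch_transform_measurable c m)
  have g: "Measurable.pred M (\<lambda>z. conf_along \<P> K \<sigma> (x z) (y z) (Suc K) \<in> goal_conf \<P>)"
    by (rule pred_sets2[OF sets_goal_conf c])
  have p: "Measurable.pred M (\<lambda>z. path_via (mode_confs \<P> (mode_along \<P> \<sigma> (x z) j)) (\<lambda>l. fst (y z l)) N
        (conf_along \<P> K \<sigma> (x z) (y z) j) (conf_along \<P> K \<sigma> (x z) (y z) (Suc j)))" for j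
  proof -
    have n: "(\<lambda>z. path_node (\<lambda>l. fst (y z l)) (conf_along \<P> K \<sigma> (x z) (y z) j)
        (conf_along \<P> K \<sigma> (x z) (y z) (Suc j)) k) \<in> borel_measurable M" for k
    proof -
      consider "k = 0" | "k = Suc 0" | l where "k = Suc (Suc l)" by (metis not0_implies_Suc)
      then show ?thesis using c[where j = j] c[where j = "Suc j"] y(1) by cases (simp_all del: conf_along.simps)
    qed
    show ?thesis
      unfolding path_via_def path_edge_def
      by (intro pred_rtranclp_countable pred_intros_logic pred_segment_mode_confs m n) simp_all
  qed
  show ?thesis
    unfolding plan_along_def by (intro pred_intros_logic pred_intros_countable t g p) simp_all
qed

text \<open>The run consists of the history \<open>h\<close>, then \<open>K\<close> iterations
  drawing the parameters, then \<open>r'\<close>. In iteration \<open>j\<close> of \<open>r'\<close>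
  the inverse kinematics sample for switch \<open>j\<close> is used. The numbers \<open>c j\<close>
  are computed from \<open>h\<close> and \<open>r0\<close> and remain correct for the actual run,
  since the pose and the grasp of every switch have occurred before \<open>r'\<close>
  begins.\<close>

lemma solved_comb_seq:
  fixes h r0 r' :: "('d, 'w, 'o) run"
  assumes adj: "\<And>j. j < K \<Longrightarrow> mode_adjacent \<P> (mode_along \<P> \<sigma> x j) (mode_along \<P> \<sigma> x (Suc j))"
    and legal: "legal_mode \<P> (mode_along \<P> \<sigma> x K)" and goal: "goal_mode \<P> (mode_along \<P> \<sigma> x K)"
    and x: "\<And>j. j < K \<Longrightarrow> x j = switch_draw \<P> (\<sigma> j) (X j) (r0 j)" and X: "\<And>j. j < K \<Longrightarrow> X j \<noteq> {}"
    and c: "\<And>j. j < K \<Longrightarrow> c j = (switch_object (\<sigma> j),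
      LEAST a. pose_at \<P> (comb_seq (Suc n0) h r0) (switch_object (\<sigma> j)) a =
        Some (switch_pose (\<sigma> j) (x j) (mode_along \<P> \<sigma> x j)),
      LEAST b. grasp_at \<P> (comb_seq (Suc n0) h r0) (switch_object (\<sigma> j)) b =
        Some (switch_grasp (\<sigma> j) (x j) (mode_along \<P> \<sigma> x j)))"
    and plan: "plan_along \<P> K \<sigma> N x (essential_run c r')" and N: "Suc K \<le> N"
  shows "solved \<P> (comb_seq (Suc n0) h (comb_seq K r0 r')) (n0 + K + N)"
proof -
  let ?S = "comb_seq (Suc n0) h (comb_seq K r0 r')" and ?T = "comb_seq (Suc n0) h r0"
  let ?n = "n0 + K + N" and ?q = "conf_along \<P> K \<sigma> x (essential_run c r')"
  have S0: "?S (Suc (n0 + j)) = r0 j" if "j < K" for j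
    using that by (simp add: comb_seq_def)
  have S': "?S (Suc (n0 + K + l)) = r' l" for l
    using comb_seq_add[of "Suc n0" h "comb_seq K r0 r'" "l + K"] comb_seq_add[of K r0 r' l]
    by (simp add: ac_simps)
  \<comment> \<open>\<open>?T\<close> is the run from which \<open>c\<close> was computed. It
    differs from \<open>?S\<close> only after iteration \<open>n0 + K\<close>, too late to affect
    first occurrences of the values in use.\<close>
  have agree: "?S m = ?T m" if "m \<le> n0 + K" for m
    using that by (auto simp: comb_seq_def)
  have sampled: "value_sampled \<P> ?S n (\<sigma> j) (x j)" if "j < K" "n0 + K \<le> n" for j n
    using value_sampled_switch_draw[of "Suc (n0 + j)" n "X j" \<P> ?S "\<sigma> j"] that X x S0 by simp
  have ms: "mode_sampled \<P> ?S n (mode_along \<P> \<sigma> x j)" if "j \<le> K" "n0 + K \<le> n" for j n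
    using that by (induction j) (simp_all add: mode_sampled_init mode_sampled_switch sampled)
  have "?q (Suc j) \<in> ik_samples \<P> ?S ?n (switch_object (\<sigma> j))" if j: "j < K" for j
  proof -
    let ?i = "switch_object (\<sigma> j)"
    let ?p = "switch_pose (\<sigma> j) (x j) (mode_along \<P> \<sigma> x j)"
    let ?g = "switch_grasp (\<sigma> j) (x j) (mode_along \<P> \<sigma> x j)"
    have adj': "mode_adjacent \<P> (mode_along \<P> \<sigma> x j) (switch_mode (\<sigma> j) (x j) (mode_along \<P> \<sigma> x j))"
      using adj[OF j] by simp
    have t: "switch_transform (mode_along \<P> \<sigma> x j) (mode_along \<P> \<sigma> x (Suc j)) = ee_transform ?p ?g"
      using mode_adjacent_switch(1)[OF adj'] by simp
    have pg: "?p \<in> poses \<P> ?S n ?i" "?g \<in> grasps \<P> ?S n ?i" if "n0 + K \<le> n" for n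
      using switch_values_sampled[OF adj' ms sampled] j that by simp_all
    have "ik_draw \<P> ?S (Suc (n0 + K + j)) ?i ?p ?g = ?q (Suc j)"
      using pose_index_cong[OF agree pg(1)[of "n0 + K"]] grasp_index_cong[OF agree pg(2)[of "n0 + K"]] j
      unfolding ik_draw_def S' by (simp add: t[simplified] c essential_run_def essential_def)
    moreover have "?q (Suc j) \<in> ik_confs \<P> (ee_transform ?p ?g)"
      using plan j t unfolding plan_along_def by metis
    moreover have "Suc (n0 + K + j) \<in> {1..?n}" using j N by simp
    ultimately show ?thesis
      using pg[of "Suc (n0 + K + j)"] unfolding ik_samples_iff by (metis le_SucI le_add1)
  qed
  moreover have "?q (Suc K) \<in> roadmap_vertices \<P> ?S ?n"
  proof -
    \<comment> \<open>The goal configuration comes from iteration \<open>K\<close> of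
      \<open>r'\<close>, counted from 0; this is the reason for
      \<open>Suc K \<le> N\<close>.\<close>
    have "?q (Suc K) = draw_goal_conf (?S (Suc (n0 + K + K)))"
      by (subst S') (simp add: essential_run_def essential_def)
    moreover have "Suc (n0 + K + K) \<in> {1..?n}" using N by simp
    ultimately show ?thesis unfolding roadmap_vertices_iff by blast
  qed
  moreover have "fst (essential_run c r' l) \<in> roadmap_vertices \<P> ?S ?n" if "l < N" for l
  proof -
    have "fst (essential_run c r' l) = draw_conf (?S (Suc (n0 + K + l)))"
      by (subst S') (simp add: essential_run_def essential_def)
    moreover have "Suc (n0 + K + l) \<in> {1..?n}" using that by simp
    ultimately show ?thesis unfolding roadmap_vertices_iff by blast
  qed
  ultimately show ?thesis
    using plan adj legal goal sampled unfolding plan_along_def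
    by (intro solved_along_modes[where q = ?q and v = "\<lambda>l. fst (essential_run c r' l)" and N = N and K = K
          and \<sigma> = \<sigma> and x = x]) auto
qed

end

section \<open>Success of a block of iterations\<close>

context valid_ppm
begin

lemma essential_component_measurable [measurable]:
  "(\<lambda>y. fst (y j)) \<in> borel_measurable essential_run_law"
  "(\<lambda>y. fst (snd (y j))) \<in> borel_measurable essential_run_law"
  "(\<lambda>y. snd (snd (y j))) \<in> borel_measurable essential_run_law"
proof -
  have [measurable]: "(\<lambda>y. y j) \<in> measurable essential_run_law essential_law"
    by (intro measurable_component_singleton UNIV_I)
  show "(\<lambda>y. fst (y j)) \<in> borel_measurable essential_run_law"
    "(\<lambda>y. fst (snd (y j))) \<in> borel_measurable essential_run_law"
    "(\<lambda>y. snd (snd (y j))) \<in> borel_measurable essential_run_law"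
    by measurable
qed

lemma prob_space_essential_run_law: "prob_space essential_run_law"
  by (intro prob_space_PiM prob_space_essential_law)

lemma emeasure_essential_law_Times:
  assumes "A \<in> sets borel" "B \<in> sets borel" "C \<in> sets borel"
  shows "A \<times> B \<times> C \<in> sets essential_law"
    "emeasure essential_law (A \<times> B \<times> C) = emeasure conf_law A * (emeasure goal_conf_law B * emeasure seed_law C)"
proof -
  interpret S: prob_space seed_law by (rule prob_space_seed_law)
  interpret GS: prob_space "goal_conf_law \<Otimes>\<^sub>M seed_law"
    by (intro prob_space_pair prob_space_laws prob_space_seed_law)
  show "A \<times> B \<times> C \<in> sets essential_law" using assms by auto
  show "emeasure essential_law (A \<times> B \<times> C) = emeasure conf_law A * (emeasure goal_conf_law B * emeasure seed_law C)"
    using assms by (subst GS.emeasure_pair_measure_Times) (auto simp: S.emeasure_pair_measure_Times)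
qed

text \<open>With the parameters \<open>x\<close> fixed, the first \<open>K + 1\<close> draws
  independently hit the robust sets \<open>Q 1, ..., Q (Suc K)\<close> with positive probability.
  Whenever they do, every motion to be made is robust, so a dense roadmap connects it with finitely
  many points.\<close>

lemma plan_along_pos:
  assumes Q0: "Q 0 = {init_conf \<P>}"
    and Q: "\<And>j. j < K \<Longrightarrow> Q (Suc j) \<subseteq> ik_confs \<P> (switch_transform (mode_along \<P> \<sigma> x j) (mode_along \<P> \<sigma> x (Suc j)))"
      "\<And>j. j < K \<Longrightarrow> 0 < rel_measure
        (ik_mu \<P> (switch_transform (mode_along \<P> \<sigma> x j) (mode_along \<P> \<sigma> x (Suc j))))
        (ik_confs \<P> (switch_transform (mode_along \<P> \<sigma> x j) (mode_along \<P> \<sigma> x (Suc j)))) (Q (Suc j))"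
    and QK: "Q (Suc K) \<subseteq> goal_conf \<P>" "0 < rel_measure (goal_conf_mu \<P>) (goal_conf \<P>) (Q (Suc K))"
    and motion: "\<And>j q0 q1. j \<le> K \<Longrightarrow> q0 \<in> Q j \<Longrightarrow> q1 \<in> Q (Suc j) \<Longrightarrow>
        robust_motion (mode_confs \<P> (mode_along \<P> \<sigma> x j)) q0 q1"
  shows "0 < emeasure essential_run_law {y. \<exists>N. plan_along \<P> K \<sigma> N x y}"
proof -
  interpret E: product_prob_space "\<lambda>_::nat. essential_law" UNIV
    unfolding product_prob_space_def product_prob_space_axioms_def product_sigma_finite_def
    by (auto intro: prob_space_essential_law prob_space_imp_sigma_finite)
  interpret C: prob_space conf_law by (rule prob_space_laws)
  interpret GC: prob_space goal_conf_law by (rule prob_space_laws)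
  interpret S: prob_space seed_law by (rule prob_space_seed_law)
  have one: "emeasure conf_law UNIV = 1" "emeasure goal_conf_law UNIV = 1" "emeasure seed_law UNIV = 1"
    using C.emeasure_space_1 GC.emeasure_space_1 S.emeasure_space_1 by simp_all
  let ?t = "\<lambda>j. switch_transform (mode_along \<P> \<sigma> x j) (mode_along \<P> \<sigma> x (Suc j))"
  \<comment> \<open>Each \<open>B j\<close> restricts a single component of the triple: the seed
    before a switch, the goal configuration at the end.\<close>
  define B :: "nat \<Rightarrow> ((real^'d) \<times> (real^'d) \<times> real) set" where "B j =
    (if j < K then UNIV \<times> UNIV \<times> {u. ik_sampler \<P> u (?t j) \<in> Q (Suc j)} else UNIV \<times> Q (Suc K) \<times> UNIV)" for j
  have B: "B j \<in> sets essential_law" "0 < emeasure essential_law (B j)" for j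
  proof -
    have "B j \<in> sets essential_law \<and> 0 < emeasure essential_law (B j)"
    proof (cases "j < K")
      case True
      with ik_sampler_pos[OF Q(1)[OF True] Q(2)[OF True]] show ?thesis
        by (simp add: B_def emeasure_essential_law_Times one del: mode_along.simps)
    next
      case False
      with emeasure_uniform_measure_on_pos[OF goal_conf_measure QK] show ?thesis
        by (simp add: B_def emeasure_essential_law_Times one del: mode_along.simps emeasure_uniform_measure)
    qed
    then show "B j \<in> sets essential_law" "0 < emeasure essential_law (B j)" by simp_all
  qed
  have "0 < (\<Prod>j\<in>{..K}. emeasure essential_law (B j))"
    using B(2) by (simp add: zero_less_iff_neq_zero prod_zero_iff)
  also have "\<dots> = emeasure essential_run_law {y \<in> space essential_run_law. \<forall>j\<in>{..K}. y j \<in> B j}"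
    using B(1) by (intro E.emeasure_PiM_Collect[symmetric]) auto
  also have "\<dots> \<le> emeasure essential_run_law {y. \<exists>N. plan_along \<P> K \<sigma> N x y}"
  \<comment> \<open>The inclusion holds only off the null set on which the configuration draws fail
    to be dense.\<close>
  proof (rule emeasure_mono_AE)
    have "Measurable.pred essential_run_law (\<lambda>y. plan_along \<P> K \<sigma> N x y)" for N
      by (intro pred_plan_along) measurable
    then have "Measurable.pred essential_run_law (\<lambda>y. \<exists>N. plan_along \<P> K \<sigma> N x y)"
      by (intro pred_intros_countable)
    then show "{y. \<exists>N. plan_along \<P> K \<sigma> N x y} \<in> sets essential_run_law"
      by (simp add: pred_def)
    show "AE y in essential_run_law. y \<in> {y \<in> space essential_run_law. \<forall>j\<in>{..K}. y j \<in> B j} \<longrightarrow>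
        y \<in> {y. \<exists>N. plan_along \<P> K \<sigma> N x y}"
      using AE_essential_dense
    proof (eventually_elim, intro impI)
      fix y assume dense: "\<forall>c e. 0 < e \<and> ball c e \<subseteq> conf_space \<P> \<longrightarrow> (\<exists>l. fst (y l) \<in> ball c e)"
        and "y \<in> {y \<in> space essential_run_law. \<forall>j\<in>{..K}. y j \<in> B j}"
      then have yB: "\<And>j. j \<le> K \<Longrightarrow> y j \<in> B j" by blast
      let ?q = "conf_along \<P> K \<sigma> x y"
      have q: "?q (Suc j) \<in> Q (Suc j)" if "j \<le> K" for j
        using yB[OF that] that by (cases "j < K") (auto simp: B_def simp del: mode_along.simps)
      have q': "?q j \<in> Q j" if "j \<le> K" for j
        using that q Q0 by (cases j) (simp_all del: conf_along.simps(2))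
      have "\<exists>N. path_via (mode_confs \<P> (mode_along \<P> \<sigma> x j)) (\<lambda>l. fst (y l)) N (?q j) (?q (Suc j))"
        if "j \<le> K" for j
      proof (rule robust_motion_path_via)
        show "robust_motion (mode_confs \<P> (mode_along \<P> \<sigma> x j)) (?q j) (?q (Suc j))"
          by (intro motion q q' that)
        show "\<exists>l. fst (y l) \<in> ball c e" if "0 < e" "ball c e \<subseteq> mode_confs \<P> (mode_along \<P> \<sigma> x j)" for c e
          using dense that mode_confs_subset by blast
      qed
      then obtain N where N: "\<And>j. j \<le> K \<Longrightarrow>
          path_via (mode_confs \<P> (mode_along \<P> \<sigma> x j)) (\<lambda>l. fst (y l)) (N j) (?q j) (?q (Suc j))"
        by metis
      have "path_via (mode_confs \<P> (mode_along \<P> \<sigma> x j)) (\<lambda>l. fst (y l)) (Max (N ` {..K})) (?q j) (?q (Suc j))"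
        if "j \<le> K" for j
        using that by (intro path_via_mono[OF _ N]) auto
      moreover have "?q (Suc j) \<in> ik_confs \<P> (?t j)" if "j < K" for j
        using q[of j] Q(1)[OF that] that by (auto simp del: conf_along.simps mode_along.simps)
      moreover have "?q (Suc K) \<in> goal_conf \<P>"
        using q[of K] QK(1) by blast
      ultimately show "y \<in> {y. \<exists>N. plan_along \<P> K \<sigma> N x y}"
        unfolding plan_along_def by blast
    qed
  qed
  finally show ?thesis .
qed

lemma comb_seq_run_measurable [measurable (raw)]:
  "f \<in> measurable N (run_law \<P>) \<Longrightarrow> g \<in> measurable N (run_law \<P>) \<Longrightarrow>
    (\<lambda>x. comb_seq i (f x) (g x)) \<in> measurable N (run_law \<P>)"
  unfolding run_law_def by (rule measurable_comb_seq')

lemma distr_comb_seq: "distr (run_law \<P> \<Otimes>\<^sub>M run_law \<P>) (run_law \<P>) (\<lambda>(\<omega>, \<omega>'). comb_seq i \<omega> \<omega>') = run_law \<P>"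
proof -
  interpret sequence_space "draw_law \<P>"
    unfolding sequence_space_def product_prob_space_def product_prob_space_axioms_def product_sigma_finite_def
    by (auto intro: prob_space_draw_law prob_space_imp_sigma_finite)
  show ?thesis unfolding run_law_def by (rule PiM_comb_seq)
qed

text \<open>Conditioning on the components below \<open>i\<close>: two independent runs spliced at
  \<open>i\<close> again have the law of a run, and Fubini's theorem integrates over the second one
  first.\<close>

lemma emeasure_comb_seq:
  assumes P: "Measurable.pred (run_law \<P>) P"
  shows "emeasure (run_law \<P>) {r. P r} =
    (\<integral>\<^sup>+h. emeasure (run_law \<P>) {r. P (comb_seq i h r)} \<partial>run_law \<P>)"
proof -
  interpret R: prob_space "run_law \<P>" by (rule prob_space_run_law)
  let ?A = "{z \<in> space (run_law \<P> \<Otimes>\<^sub>M run_law \<P>). P (comb_seq i (fst z) (snd z))}"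
  have m: "(\<lambda>(\<omega>, \<omega>'). comb_seq i \<omega> \<omega>') \<in> measurable (run_law \<P> \<Otimes>\<^sub>M run_law \<P>) (run_law \<P>)"
    unfolding case_prod_beta by measurable
  have PA: "{r. P r} \<in> sets (run_law \<P>)" using P by (simp add: pred_def)
  have "emeasure (run_law \<P>) {r. P r} =
      emeasure (distr (run_law \<P> \<Otimes>\<^sub>M run_law \<P>) (run_law \<P>) (\<lambda>(\<omega>, \<omega>'). comb_seq i \<omega> \<omega>')) {r. P r}"
    by (simp only: distr_comb_seq)
  also have "\<dots> = emeasure (run_law \<P> \<Otimes>\<^sub>M run_law \<P>) ?A"
    using PA by (subst emeasure_distr[OF m]) (auto simp: vimage_def case_prod_beta Int_def intro!: arg_cong2[where f = emeasure])
  also have "\<dots> = (\<integral>\<^sup>+h. emeasure (run_law \<P>) (Pair h -` ?A) \<partial>run_law \<P>)"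
  proof (rule R.emeasure_pair_measure_alt)
    have "Measurable.pred (run_law \<P> \<Otimes>\<^sub>M run_law \<P>) (\<lambda>z. P (comb_seq i (fst z) (snd z)))"
      by (rule measurable_compose[OF _ P]) measurable
    then show "?A \<in> sets (run_law \<P> \<Otimes>\<^sub>M run_law \<P>)" by (simp add: pred_def)
  qed
  also have "\<dots> = (\<integral>\<^sup>+h. emeasure (run_law \<P>) {r. P (comb_seq i h r)} \<partial>run_law \<P>)"
    by (intro nn_integral_cong arg_cong2[where f = emeasure]) (auto simp: space_pair_measure)
  finally show ?thesis .
qed

lemma pred_comb_seq:
  assumes "Measurable.pred (run_law \<P>) P"
  shows "Measurable.pred (run_law \<P>) (\<lambda>r. P (comb_seq i h r))"
  by (rule measurable_compose[OF _ assms]) measurable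

text \<open>Translation from lists to sequences. There are \<open>Suc K\<close> modes, so
  \<open>Q 1, ..., Q K\<close> belong to the switches and \<open>Q (Suc K)\<close> to the
  goal.\<close>

lemma robustly_feasible_values:
  assumes theta: "\<forall>xs. list_all2 (\<in>) xs (map snd \<theta>) \<longrightarrow>
           (let \<omega>s = modes_from (init_mode \<P>) (zip (map fst \<theta>) xs)
            in mode_sequence \<P> \<omega>s \<and> goal_mode \<P> (last \<omega>s) \<and> robust_multi_mode \<P> \<omega>s)"
    and x: "\<And>j. j < length \<theta> \<Longrightarrow> x j \<in> snd (\<theta> ! j)"
    and \<sigma>: "\<sigma> = (\<lambda>j. fst (\<theta> ! j))" and K: "K = length \<theta>"
  shows "\<And>j. j < K \<Longrightarrow> mode_adjacent \<P> (mode_along \<P> \<sigma> x j) (mode_along \<P> \<sigma> x (Suc j))"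
    and "legal_mode \<P> (mode_along \<P> \<sigma> x K)" "goal_mode \<P> (mode_along \<P> \<sigma> x K)"
    and "0 < emeasure essential_run_law {y. \<exists>N. plan_along \<P> K \<sigma> N x y}"
proof -
  define xs where "xs = map x [0..<K]"
  define \<omega>s where "\<omega>s = modes_from (init_mode \<P>) (zip (map fst \<theta>) xs)"
  have len: "length \<omega>s = Suc K" by (simp add: \<omega>s_def xs_def K)
  have nth: "\<omega>s ! j = mode_along \<P> \<sigma> x j" if "j \<le> K" for j
    unfolding \<omega>s_def using that by (intro modes_from_eq_mode_along) (auto simp: xs_def K \<sigma>)
  have "list_all2 (\<in>) xs (map snd \<theta>)"
    using x by (auto simp: list_all2_conv_all_nth xs_def K)
  from theta[rule_format, OF this] have seq: "mode_sequence \<P> \<omega>s" and goal: "goal_mode \<P> (last \<omega>s)"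
    and robust: "robust_multi_mode \<P> \<omega>s"
    unfolding \<omega>s_def Let_def by blast+
  have last: "last \<omega>s = mode_along \<P> \<sigma> x K"
    using len nth[of K] by (subst last_conv_nth) auto
  show "mode_adjacent \<P> (mode_along \<P> \<sigma> x j) (mode_along \<P> \<sigma> x (Suc j))" if "j < K" for j
    using seq that nth[of j] nth[of "Suc j"] len
    by (auto simp: mode_sequence_def simp del: mode_along.simps)
  show "legal_mode \<P> (mode_along \<P> \<sigma> x K)"
    using seq last unfolding mode_sequence_def by (metis last_in_set)
  show "goal_mode \<P> (mode_along \<P> \<sigma> x K)" using goal last by simp
  from robust obtain Q :: "nat \<Rightarrow> (real^'d) set" and \<epsilon> :: real where \<epsilon>: "0 < \<epsilon>" and Q0: "Q 0 = {init_conf \<P>}"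
    and Q: "\<forall>i \<in> {1..<length \<omega>s}.
           let t = switch_transform (\<omega>s ! (i - 1)) (\<omega>s ! i)
           in Q i \<subseteq> ik_confs \<P> t \<and> \<epsilon> \<le> rel_measure (ik_mu \<P> t) (ik_confs \<P> t) (Q i)"
    and QK: "Q (length \<omega>s) \<subseteq> goal_conf \<P>"
      "\<epsilon> \<le> rel_measure (goal_conf_mu \<P>) (goal_conf \<P>) (Q (length \<omega>s))"
    and motion: "\<forall>i \<in> {1..length \<omega>s}. \<forall>q0 \<in> Q (i - 1). \<forall>q1 \<in> Q i.
           robust_motion (mode_confs \<P> (\<omega>s ! (i - 1))) q0 q1"
    unfolding robust_multi_mode_def by (elim exE conjE) (rule that)
  show "0 < emeasure essential_run_law {y. \<exists>N. plan_along \<P> K \<sigma> N x y}"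
  proof (rule plan_along_pos[where Q = Q])
    fix j assume j: "j < K"
    have "Suc j \<in> {1..<length \<omega>s}" using j len by simp
    from bspec[OF Q this] nth[of j] nth[of "Suc j"] j
    show "Q (Suc j) \<subseteq> ik_confs \<P> (switch_transform (mode_along \<P> \<sigma> x j) (mode_along \<P> \<sigma> x (Suc j)))"
      "0 < rel_measure
        (ik_mu \<P> (switch_transform (mode_along \<P> \<sigma> x j) (mode_along \<P> \<sigma> x (Suc j))))
        (ik_confs \<P> (switch_transform (mode_along \<P> \<sigma> x j) (mode_along \<P> \<sigma> x (Suc j)))) (Q (Suc j))"
      using \<epsilon> by (auto simp: Let_def simp del: mode_along.simps)
  next
    fix j q0 q1 assume "j \<le> K" "q0 \<in> Q j" "q1 \<in> Q (Suc j)"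
    with bspec[OF motion, of "Suc j"] nth[of j] len
    show "robust_motion (mode_confs \<P> (mode_along \<P> \<sigma> x j)) q0 q1" by simp
  qed (use Q0 QK len \<epsilon> in simp_all)
qed

text \<open>\<open>D N\<close> pairs parameters in their prescribed sets with draws that yield a
  plan over \<open>N\<close> roadmap points. It mentions neither \<open>h\<close> nor
  \<open>m\<close>, so its measure can serve as a uniform lower bound.\<close>

lemma block_success:
  assumes "robustly_feasible \<P>"
  obtains p :: real and n :: nat where "0 < p" "p \<le> 1 / 2" "0 < n"
    "\<And>h m. ennreal p \<le> emeasure (run_law \<P>) {r. solved \<P> (comb_seq (Suc m) h r) (m + n)}"
proof -
  from assms obtain \<theta> :: "('o switch \<times> 'w rigid set) list" where
    sw: "\<forall>(\<sigma>, X) \<in> set \<theta>. X \<subseteq> switch_space \<P> \<sigma> \<and> 0 < switch_measure \<P> \<sigma> X"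
    and theta: "\<forall>xs. list_all2 (\<in>) xs (map snd \<theta>) \<longrightarrow>
           (let \<omega>s = modes_from (init_mode \<P>) (zip (map fst \<theta>) xs)
            in mode_sequence \<P> \<omega>s \<and> goal_mode \<P> (last \<omega>s) \<and> robust_multi_mode \<P> \<omega>s)"
    unfolding robustly_feasible_def by (elim conjE exE) (rule that)
  define K where "K = length \<theta>"
  define \<sigma> where "\<sigma> = (\<lambda>j. fst (\<theta> ! j))"
  define X where "X j = snd (\<theta> ! j)" for j
  define xs where "xs r j = switch_draw \<P> (\<sigma> j) (X j) (r j)" for r :: "('d, 'w, 'o) run" and j
  let ?M = "run_law \<P>" and ?Y = essential_run_law
  interpret R: prob_space ?M by (rule prob_space_run_law)
  interpret Y: prob_space ?Y by (rule prob_space_essential_run_law)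
  interpret RY: prob_space "?M \<Otimes>\<^sub>M ?Y"
    by (intro prob_space_pair prob_space_run_law prob_space_essential_run_law)
  have X: "X j \<in> sets borel" "0 < emeasure (draw_law \<P>) {d. switch_draw \<P> (\<sigma> j) (X j) d \<in> X j}" "X j \<noteq> {}"
    if "j < K" for j
  proof -
    have "\<theta> ! j \<in> set \<theta>" using that by (simp add: K_def)
    with sw have "X j \<subseteq> switch_space \<P> (\<sigma> j)" "0 < switch_measure \<P> (\<sigma> j) (X j)"
      by (auto simp: X_def \<sigma>_def case_prod_beta)
    from switch_draw_pos[OF this]
    show "X j \<in> sets borel" "0 < emeasure (draw_law \<P>) {d. switch_draw \<P> (\<sigma> j) (X j) d \<in> X j}" by simp_all
    then show "X j \<noteq> {}" by auto
  qed
  note feas = robustly_feasible_values[OF theta _ \<sigma>_def K_def]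
  define A where "A = {r. \<forall>j<K. xs r j \<in> X j}"
  define D where "D N = {z. fst z \<in> A \<and> plan_along \<P> K \<sigma> N (xs (fst z)) (snd z)}" for N
  have xs_meas [measurable]: "(\<lambda>r. xs r j) \<in> borel_measurable ?M" for j
    unfolding xs_def by measurable
  have A_pred: "Measurable.pred ?M (\<lambda>r. r \<in> A)"
    unfolding A_def mem_Collect_eq using X(1)
    by (intro pred_intros_countable pred_intros_imp' pred_sets2[OF X(1) xs_meas])
  have A_pos: "0 < emeasure ?M A"
  proof -
    interpret E: product_prob_space "\<lambda>_::nat. draw_law \<P>" UNIV
      unfolding product_prob_space_def product_prob_space_axioms_def product_sigma_finite_def
      by (auto intro: prob_space_draw_law prob_space_imp_sigma_finite)
    have "0 < (\<Prod>j\<in>{..<K}. emeasure (draw_law \<P>) {d. switch_draw \<P> (\<sigma> j) (X j) d \<in> X j})"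
      using X(2) by (simp add: zero_less_iff_neq_zero prod_zero_iff)
    also have "\<dots> = emeasure (\<Pi>\<^sub>M _\<in>UNIV. draw_law \<P>)
        {r \<in> space (\<Pi>\<^sub>M _\<in>UNIV. draw_law \<P>). \<forall>j\<in>{..<K}. r j \<in> {d. switch_draw \<P> (\<sigma> j) (X j) d \<in> X j}}"
    proof (rule E.emeasure_PiM_Collect[symmetric])
      fix j assume "j \<in> {..<K}"
      then show "{d. switch_draw \<P> (\<sigma> j) (X j) d \<in> X j} \<in> sets (draw_law \<P>)"
        using measurable_sets[OF switch_draw_measurable X(1)[of j]] by (simp add: vimage_def)
    qed auto
    also have "\<dots> = emeasure ?M A"
      unfolding A_def xs_def run_law_def by (intro arg_cong2[where f = emeasure]) (auto simp: space_PiM)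
    finally show ?thesis .
  qed
  have D_sets: "D N \<in> sets (?M \<Otimes>\<^sub>M ?Y)" for N
  proof -
    have "Measurable.pred (?M \<Otimes>\<^sub>M ?Y) (\<lambda>z. fst z \<in> A)"
      by (rule measurable_compose[OF measurable_fst A_pred])
    moreover have "Measurable.pred (?M \<Otimes>\<^sub>M ?Y) (\<lambda>z. plan_along \<P> K \<sigma> N (xs (fst z)) (snd z))"
      by (intro pred_plan_along) measurable
    ultimately have "Measurable.pred (?M \<Otimes>\<^sub>M ?Y) (\<lambda>z. z \<in> D N)"
      unfolding D_def mem_Collect_eq by (rule pred_intros_logic)
    then show ?thesis by (simp add: pred_def space_pair_measure)
  qed
  have D_section: "Pair r -` (\<Union>N. D N) = {y. \<exists>N. plan_along \<P> K \<sigma> N (xs r) y}" if "r \<in> A" for r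
    using that by (auto simp: D_def)
  \<comment> \<open>Were all \<open>D N\<close> null, almost every section of their union would be
    null; but the sections over \<open>A\<close> have positive measure, and so has
    \<open>A\<close>.\<close>
  have "\<not> (\<forall>N. emeasure (?M \<Otimes>\<^sub>M ?Y) (D N) = 0)"
  proof
    assume "\<forall>N. emeasure (?M \<Otimes>\<^sub>M ?Y) (D N) = 0"
    then have "(\<Union>N. D N) \<in> null_sets (?M \<Otimes>\<^sub>M ?Y)"
      using D_sets by (intro null_sets_UN) auto
    then have "(\<integral>\<^sup>+r. emeasure ?Y (Pair r -` (\<Union>N. D N)) \<partial>?M) = 0"
      using Y.emeasure_pair_measure_alt[OF null_setsD2] null_setsD1 by metis
    then have "AE r in ?M. emeasure ?Y (Pair r -` (\<Union>N. D N)) = 0"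
      using D_sets by (subst (asm) nn_integral_0_iff_AE) (auto intro!: Y.measurable_emeasure_Pair)
    then have "AE r in ?M. r \<notin> A"
    proof eventually_elim
      fix r assume 0: "emeasure ?Y (Pair r -` (\<Union>N. D N)) = 0"
      show "r \<notin> A"
      proof
        assume r: "r \<in> A"
        have "0 < emeasure ?Y {y. \<exists>N. plan_along \<P> K \<sigma> N (xs r) y}"
          using r by (intro feas(4)) (auto simp: A_def X_def K_def)
        with 0 D_section[OF r] show False by simp
      qed
    qed
    moreover have "A \<in> sets ?M" using A_pred by (simp add: pred_def)
    ultimately have "A \<in> null_sets ?M" by (simp add: AE_iff_null_sets)
    with A_pos show False by auto
  qed
  then obtain N0 where N0: "emeasure (?M \<Otimes>\<^sub>M ?Y) (D N0) \<noteq> 0" by blast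
  \<comment> \<open>Enlarging \<open>N0\<close> keeps the measure positive by monotonicity and makes
    the block long enough to contain the goal draw.\<close>
  define N where "N = max N0 (Suc K)"
  have "D N0 \<subseteq> D N"
    unfolding D_def N_def using plan_along_mono[of N0 "max N0 (Suc K)"] by auto
  then have "emeasure (?M \<Otimes>\<^sub>M ?Y) (D N0) \<le> emeasure (?M \<Otimes>\<^sub>M ?Y) (D N)"
    by (intro emeasure_mono D_sets)
  with N0 have pos: "0 < measure (?M \<Otimes>\<^sub>M ?Y) (D N)"
    using zero_less_measure_iff[of "?M \<Otimes>\<^sub>M ?Y" "D N0"] by (simp add: RY.emeasure_eq_measure)
  have bound: "emeasure (?M \<Otimes>\<^sub>M ?Y) (D N) \<le>
      emeasure ?M {r. solved \<P> (comb_seq (Suc m) h r) (m + (K + N))}" for h m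
  proof -
    have "emeasure (?M \<Otimes>\<^sub>M ?Y) (D N) = (\<integral>\<^sup>+r0. emeasure ?Y (Pair r0 -` D N) \<partial>?M)"
      by (intro Y.emeasure_pair_measure_alt D_sets)
    also have "\<dots> \<le> (\<integral>\<^sup>+r0. emeasure ?M {r'. solved \<P> (comb_seq (Suc m) h (comb_seq K r0 r')) (m + (K + N))} \<partial>?M)"
    proof (rule nn_integral_mono)
      fix r0
      show "emeasure ?Y (Pair r0 -` D N) \<le>
          emeasure ?M {r'. solved \<P> (comb_seq (Suc m) h (comb_seq K r0 r')) (m + (K + N))}"
      proof (cases "r0 \<in> A")
        case False
        then have "Pair r0 -` D N = {}" by (auto simp: D_def)
        then show ?thesis by simp
      next
        case True
        let ?x = "xs r0"
        \<comment> \<open>Given \<open>h\<close> and \<open>r0\<close> these numbers are constants,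
          which permits the use of \<open>essential_run c\<close> on the independent remainder
          \<open>r'\<close>.\<close>
        define c where "c j = (switch_object (\<sigma> j),
          LEAST a. pose_at \<P> (comb_seq (Suc m) h r0) (switch_object (\<sigma> j)) a =
            Some (switch_pose (\<sigma> j) (?x j) (mode_along \<P> \<sigma> ?x j)),
          LEAST b. grasp_at \<P> (comb_seq (Suc m) h r0) (switch_object (\<sigma> j)) b =
            Some (switch_grasp (\<sigma> j) (?x j) (mode_along \<P> \<sigma> ?x j)))" for j
        have x: "?x j \<in> snd (\<theta> ! j)" if "j < length \<theta>" for j
          using True that by (auto simp: A_def X_def K_def)
        have "emeasure ?Y (Pair r0 -` D N) = emeasure (distr ?M ?Y (essential_run c)) (Pair r0 -` D N)"
          by (simp only: distr_run_law_essential)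
        also have "\<dots> = emeasure ?M (essential_run c -` (Pair r0 -` D N) \<inter> space ?M)"
          by (rule emeasure_distr[OF essential_run_measurable sets_Pair1[OF D_sets]])
        also have "\<dots> \<le> emeasure ?M {r'. solved \<P> (comb_seq (Suc m) h (comb_seq K r0 r')) (m + (K + N))}"
        proof (rule emeasure_mono)
          show "essential_run c -` (Pair r0 -` D N) \<inter> space ?M \<subseteq>
              {r'. solved \<P> (comb_seq (Suc m) h (comb_seq K r0 r')) (m + (K + N))}"
          proof
            fix r' assume "r' \<in> essential_run c -` (Pair r0 -` D N) \<inter> space ?M"
            then have plan: "plan_along \<P> K \<sigma> N ?x (essential_run c r')" by (simp add: D_def)
            have "solved \<P> (comb_seq (Suc m) h (comb_seq K r0 r')) (m + K + N)"
              by (rule solved_comb_seq[where x = ?x and X = X and \<sigma> = \<sigma> and c = c])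
                (use feas(1-3)[where x = ?x, OF x] X(3) plan in \<open>auto simp: xs_def c_def N_def simp del: mode_along.simps\<close>)
            then show "r' \<in> {r'. solved \<P> (comb_seq (Suc m) h (comb_seq K r0 r')) (m + (K + N))}"
              by (simp add: add.assoc)
          qed
          have "Measurable.pred ?M (\<lambda>r. solved \<P> (comb_seq (Suc m) h (comb_seq K r0 r)) (m + (K + N)))"
            by (rule pred_comb_seq[OF pred_comb_seq[OF pred_solved]])
          then show "{r'. solved \<P> (comb_seq (Suc m) h (comb_seq K r0 r')) (m + (K + N))} \<in> sets ?M"
            by (simp add: pred_def)
        qed
        finally show ?thesis .
      qed
    qed
    also have "\<dots> = emeasure ?M {r. solved \<P> (comb_seq (Suc m) h r) (m + (K + N))}"
      by (intro emeasure_comb_seq[symmetric] pred_comb_seq pred_solved)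
    finally show ?thesis .
  qed
  show ?thesis
  \<comment> \<open>The cap 1/2 keeps \<open>1 - p\<close> positive, so that its logarithm can later
    serve as a rate.\<close>
  proof (rule that[of "min (measure (?M \<Otimes>\<^sub>M ?Y) (D N)) (1 / 2)" "K + N"])
    fix h m
    have "ennreal (min (measure (?M \<Otimes>\<^sub>M ?Y) (D N)) (1 / 2)) \<le> emeasure (?M \<Otimes>\<^sub>M ?Y) (D N)"
      by (simp add: RY.emeasure_eq_measure ennreal_leI)
    also note bound
    finally show "ennreal (min (measure (?M \<Otimes>\<^sub>M ?Y) (D N)) (1 / 2)) \<le>
        emeasure ?M {r. solved \<P> (comb_seq (Suc m) h r) (m + (K + N))}" .
  qed (use pos in \<open>auto simp: N_def\<close>)
qed

text \<open>Conditioning on the first \<open>j * n\<close> iterations: a solved history stays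
  solved, and after an unsolved one the next block fails with probability at most
  \<open>1 - p\<close>, whatever the history is.\<close>

lemma not_solved_decay:
  assumes p: "0 < p" "p \<le> 1 / 2"
    and block: "\<And>h m. ennreal p \<le> emeasure (run_law \<P>) {r. solved \<P> (comb_seq (Suc m) h r) (m + n)}"
  shows "emeasure (run_law \<P>) {r. \<not> solved \<P> r (j * n)} \<le> ennreal ((1 - p) ^ j)"
proof (induction j)
  interpret R: prob_space "run_law \<P>" by (rule prob_space_run_law)
  case 0
  show ?case by (simp add: R.emeasure_le_1)
next
  interpret R: prob_space "run_law \<P>" by (rule prob_space_run_law)
  case (Suc j)
  let ?M = "run_law \<P>" and ?m = "j * n"
  have ns: "Measurable.pred ?M (\<lambda>r. \<not> solved \<P> r k)" for k by measurable
  have "emeasure ?M {r. \<not> solved \<P> r (?m + n)} =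
      (\<integral>\<^sup>+h. emeasure ?M {r. \<not> solved \<P> (comb_seq (Suc ?m) h r) (?m + n)} \<partial>?M)"
    by (rule emeasure_comb_seq[OF ns])
  also have "\<dots> \<le> (\<integral>\<^sup>+h. ennreal (1 - p) * indicator {r. \<not> solved \<P> r ?m} h \<partial>?M)"
  proof (rule nn_integral_mono)
    fix h
    show "emeasure ?M {r. \<not> solved \<P> (comb_seq (Suc ?m) h r) (?m + n)} \<le>
        ennreal (1 - p) * indicator {r. \<not> solved \<P> r ?m} h"
    proof (cases "solved \<P> h ?m")
      case True
      \<comment> \<open>The search of iteration \<open>?m\<close> sees only the components up to
        \<open>?m\<close>, which are those of \<open>h\<close>.\<close>
      have "solved \<P> (comb_seq (Suc ?m) h r) (?m + n)" for r
      proof (rule solved_mono)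
        show "solved \<P> (comb_seq (Suc ?m) h r) ?m"
          using True solved_cong[of ?m "comb_seq (Suc ?m) h r" h \<P>] by (simp add: comb_seq_less)
      qed simp
      then show ?thesis by simp
    next
      case False
      let ?S = "{r. solved \<P> (comb_seq (Suc ?m) h r) (?m + n)}"
      have S: "?S \<in> sets ?M"
        using pred_comb_seq[OF pred_solved] by (simp add: pred_def)
      have "{r. \<not> solved \<P> (comb_seq (Suc ?m) h r) (?m + n)} = space ?M - ?S" by auto
      then have "measure ?M {r. \<not> solved \<P> (comb_seq (Suc ?m) h r) (?m + n)} = 1 - measure ?M ?S"
        using R.prob_compl[OF S] by simp
      also have "\<dots> \<le> 1 - p"
        using block[of ?m h] p by (simp add: R.emeasure_eq_measure)
      finally show ?thesis
        using False by (simp add: R.emeasure_eq_measure ennreal_leI)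
    qed
  qed
  also have "\<dots> = ennreal (1 - p) * emeasure ?M {r. \<not> solved \<P> r ?m}"
    using ns by (intro nn_integral_cmult_indicator) (simp add: pred_def)
  also have "\<dots> \<le> ennreal (1 - p) * ennreal ((1 - p) ^ j)"
    by (intro mult_left_mono Suc.IH) simp
  also have "\<dots> = ennreal ((1 - p) ^ Suc j)"
    using p by (simp add: ennreal_mult[symmetric])
  finally show ?case by (simp add: add.commute)
qed

end

section \<open>Time steps\<close>

lemma card_image_eq_card_first:
  fixes A :: "nat set"
  assumes "finite A"
  shows "card (f ` A) = card {a\<in>A. \<forall>a'\<in>A. a' < a \<longrightarrow> f a' \<noteq> f a}"
proof -
  let ?B = "{a\<in>A. \<forall>a'\<in>A. a' < a \<longrightarrow> f a' \<noteq> f a}"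
  have "f a \<in> f ` ?B" if "a \<in> A" for a
  proof -
    define l where "l = (LEAST b. b \<in> A \<and> f b = f a)"
    have l: "l \<in> A" "f l = f a"
      using LeastI[of "\<lambda>b. b \<in> A \<and> f b = f a" a] that by (simp_all add: l_def)
    have "f b \<noteq> f l" if "b \<in> A" "b < l" for b
      using not_less_Least[of b "\<lambda>b. b \<in> A \<and> f b = f a"] that l(2) unfolding l_def by metis
    with l(1) have "l \<in> ?B" by blast
    with l(2) show ?thesis by (metis (no_types, lifting) imageI)
  qed
  moreover have "?B \<subseteq> A" by blast
  ultimately have "f ` A = f ` ?B" by (intro equalityI image_subsetI image_mono)
  moreover have "inj_on f ?B"
  proof (rule inj_onI)
    fix a b assume "a \<in> ?B" "b \<in> ?B" "f a = f b"
    then show "a = b" by (cases a b rule: linorder_cases) auto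
  qed
  ultimately show ?thesis by (simp add: card_image)
qed

lemma measurable_nat_binary:
  fixes F :: "nat \<Rightarrow> nat \<Rightarrow> 'b"
  assumes f: "f \<in> measurable M (count_space UNIV)" and g: "g \<in> measurable M (count_space UNIV)"
  shows "(\<lambda>x. F (f x) (g x)) \<in> measurable M (count_space UNIV)"
  by (rule measurable_compose_countable[where f = "\<lambda>k x. F k (g x)", OF _ f])
     (rule measurable_compose[OF g measurable_count_space])

lemma measurable_nat_sum:
  fixes f :: "'i \<Rightarrow> 'a \<Rightarrow> nat"
  assumes "\<And>i. i \<in> I \<Longrightarrow> f i \<in> measurable M (count_space UNIV)"
  shows "(\<lambda>x. \<Sum>i\<in>I. f i x) \<in> measurable M (count_space UNIV)"
  using assms
proof (induction I rule: infinite_finite_induct)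
  case (insert i I)
  then have "f i \<in> measurable M (count_space UNIV)" "(\<lambda>x. \<Sum>i\<in>I. f i x) \<in> measurable M (count_space UNIV)"
    by simp_all
  from measurable_nat_binary[where F = "(+)", OF this] insert(1,2) show ?case by simp
qed simp_all

lemma card_poses_le: "card (poses \<P> r n i) \<le> 2 * n + 1"
  using card_image_le[of "{a. a \<le> 2 * n \<and> pose_defined \<P> i a}" "pose_value \<P> r i"]
    card_mono[of "{..2 * n}" "{a. a \<le> 2 * n \<and> pose_defined \<P> i a}"]
  by (auto simp: poses_eq intro: order_trans)

lemma card_grasps_le: "card (grasps \<P> r n i) \<le> 2 * n + 1"
  using card_image_le[of "{a. a \<le> 2 * n \<and> grasp_defined \<P> i a}" "grasp_value \<P> r i"]
    card_mono[of "{..2 * n}" "{a. a \<le> 2 * n \<and> grasp_defined \<P> i a}"]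
  by (auto simp: grasps_eq intro: order_trans)

text \<open>Vertices are values of indices, so counting indices suffices. An inverse kinematics
  index consists of an iteration, an object, a pose number and a grasp number; the three numbers
  account for the exponent 3.\<close>

lemma card_roadmap_vertices_le:
  fixes \<P> :: "('d::finite, 'w::finite, 'o::finite) ppm"
  shows "card (roadmap_vertices \<P> r n) \<le> (CARD('o) + 2) * (2 * n + 2) ^ 3"
    and "finite (roadmap_vertices \<P> r n)"
proof -
  let ?z = "2 * n + 2"
  let ?I = "{..n} \<times> (UNIV :: 'o set) \<times> {..2 * n} \<times> {..2 * n}"
  let ?V1 = "Inl ` ?I :: 'o vertex_index set"
  let ?V2 = "Inr ` Inl ` {..n} :: 'o vertex_index set"
  let ?V3 = "Inr ` Inr ` {..n} :: 'o vertex_index set"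
  let ?V = "?V1 \<union> ?V2 \<union> ?V3"
  have sub: "roadmap_vertices \<P> r n \<subseteq> vertex_value \<P> r ` ?V"
  proof
    fix q assume "q \<in> roadmap_vertices \<P> r n"
    then obtain v where v: "vertex_ok \<P> r n v" "vertex_value \<P> r v = q"
      unfolding roadmap_vertices_iff_vertex by blast
    have "v \<in> ?V" using v(1) by (cases "(\<P>, r, n, v)" rule: vertex_ok.cases) auto
    with v(2) show "q \<in> vertex_value \<P> r ` ?V" by blast
  qed
  then show "finite (roadmap_vertices \<P> r n)" by (rule finite_subset) auto
  have "card (roadmap_vertices \<P> r n) \<le> card ?V"
    using sub by (intro surj_card_le) auto
  also have "\<dots> \<le> card ?V1 + card ?V2 + card ?V3"
    using card_Un_le[of "?V1 \<union> ?V2" ?V3] card_Un_le[of ?V1 ?V2] by linarith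
  also have "\<dots> \<le> card ?I + card {..n} + card {..n}"
    by (intro add_mono card_image_le order_trans[OF card_image_le card_image_le]) auto
  also have "\<dots> = (n + 1) * (CARD('o) * ((2 * n + 1) * (2 * n + 1))) + 2 * (n + 1)"
    by (simp add: card_cartesian_product)
  also have "\<dots> \<le> ?z * (CARD('o) * (?z * ?z)) + 2 * (?z * (?z * ?z))"
    by (intro add_mono mult_mono) auto
  also have "\<dots> = (CARD('o) + 2) * ?z ^ 3"
    by (simp add: power3_eq_cube algebra_simps)
  finally show "card (roadmap_vertices \<P> r n) \<le> (CARD('o) + 2) * ?z ^ 3" .
qed

text \<open>The exponent adds up from 3 for the configuration, 1 for the index of the held grasp and
  one for the pose index of every object.\<close>

lemma card_search_states_le:
  fixes \<P> :: "('d::finite, 'w::finite, 'o::finite) ppm"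
  shows "card (search_states \<P> r n) \<le> (CARD('o) + 2) * (CARD('o) + 1) * (2 * n + 2) ^ (CARD('o) + 4)"
proof -
  let ?z = "2 * n + 2" and ?m = "CARD('o)"
  let ?H = "insert None (Some ` ((UNIV :: 'o set) \<times> {..2 * n}))"
  let ?A = "PiE (UNIV :: 'o set) (\<lambda>_. insert None (Some ` {..2 * n}))"
  let ?S = "roadmap_vertices \<P> r n \<times> ?H \<times> ?A"
  let ?f = "\<lambda>(q, \<mu>). (q, mode_value \<P> r \<mu>)"
  have "search_states \<P> r n \<subseteq> ?f ` ?S"
  proof
    fix s assume s: "s \<in> search_states \<P> r n"
    obtain q g ps where s_eq: "s = (q, g, ps)" by (cases s) auto
    from s have q: "q \<in> roadmap_vertices \<P> r n"
      and g: "g = None \<or> (\<exists>i. \<exists>\<gamma> \<in> grasps \<P> r n i. g = Some (i, \<gamma>))"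
      and ps: "\<And>i. ps i = None \<or> (\<exists>p \<in> poses \<P> r n i. ps i = Some p)"
      by (auto simp: search_states_def s_eq)
    have "\<exists>H\<in>?H. map_option (\<lambda>(i, b). (i, grasp_value \<P> r i b)) H = g"
      using g
    proof
      assume "\<exists>i. \<exists>\<gamma> \<in> grasps \<P> r n i. g = Some (i, \<gamma>)"
      then obtain i b where "b \<le> 2 * n" "g = Some (i, grasp_value \<P> r i b)"
        unfolding grasps_eq by blast
      then show ?thesis by (intro bexI[of _ "Some (i, b)"]) auto
    qed simp
    then obtain H where H: "H \<in> ?H" "map_option (\<lambda>(i, b). (i, grasp_value \<P> r i b)) H = g" by blast
    have "\<exists>a\<in>insert None (Some ` {..2 * n}). map_option (pose_value \<P> r i) a = ps i" for i
      using ps[of i]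
    proof
      assume "\<exists>p \<in> poses \<P> r n i. ps i = Some p"
      then obtain a where "a \<le> 2 * n" "ps i = Some (pose_value \<P> r i a)"
        unfolding poses_eq by blast
      then show ?thesis by (intro bexI[of _ "Some a"]) auto
    qed simp
    then obtain A where A: "\<And>i. A i \<in> insert None (Some ` {..2 * n})"
      "\<And>i. map_option (pose_value \<P> r i) (A i) = ps i" by metis
    have "s = ?f (q, H, A)"
      using H(2) A(2) by (simp add: s_eq mode_value_def fun_eq_iff)
    moreover have "(q, H, A) \<in> ?S" using q H(1) A(1) by blast
    ultimately show "s \<in> ?f ` ?S" by blast
  qed
  then have "card (search_states \<P> r n) \<le> card ?S"
    using card_roadmap_vertices_le(2)[of \<P> r n]
    by (intro surj_card_le finite_cartesian_product finite_PiE) auto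
  also have "\<dots> = card (roadmap_vertices \<P> r n) * (card ?H * card ?A)"
    by (simp only: card_cartesian_product)
  also have "card ?A = card (insert None (Some ` {..2 * n})) ^ ?m"
    by (simp add: card_PiE)
  also have "card (insert None (Some ` {..2 * n})) = ?z"
    by (subst card_insert_disjoint) (auto simp: card_image)
  also have "card ?H = Suc (?m * (2 * n + 1))"
    by (subst card_insert_disjoint) (auto simp: card_image card_cartesian_product)
  also have "card (roadmap_vertices \<P> r n) * (Suc (?m * (2 * n + 1)) * ?z ^ ?m) \<le>
      ((?m + 2) * ?z ^ 3) * (((?m + 1) * ?z) * ?z ^ ?m)"
    by (intro mult_mono card_roadmap_vertices_le) (auto simp: algebra_simps)
  also have "\<dots> = (?m + 2) * (?m + 1) * ?z ^ (?m + 4)"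
    by (simp only: power_add power3_eq_cube power4_eq_xxxx mult.assoc mult.commute mult.left_commute)
  finally show ?thesis .
qed

lemma sampling_steps_le:
  fixes \<P> :: "('d::finite, 'w::finite, 'o::finite) ppm"
  shows "sampling_steps \<P> r n \<le> (2 * CARD('o) + 1) * (2 * n + 2) ^ 2"
proof -
  let ?z = "2 * n + 2"
  have 4: "4 \<le> ?z ^ 2"
    by (simp add: power2_eq_square)
  have pg: "card (poses \<P> r n i) * card (grasps \<P> r n i) \<le> ?z ^ 2" for i
    using card_poses_le[of \<P> r n i] card_grasps_le[of \<P> r n i]
    unfolding power2_eq_square by (intro mult_mono) auto
  have "2 + (if goal_placements \<P> i = {} then 0 else 1) + (if goal_object \<P> = Some i then 1 else 0) +
        card (poses \<P> r n i) * card (grasps \<P> r n i) \<le> 2 * ?z ^ 2" for i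
  proof -
    have "(if goal_placements \<P> i = {} then 0 else 1) \<le> (1::nat)"
      "(if goal_object \<P> = Some i then 1 else 0) \<le> (1::nat)" by simp_all
    with pg[of i] 4 show ?thesis by linarith
  qed
  then have "sampling_steps \<P> r n \<le> (\<Sum>i\<in>(UNIV::'o set). 2 * ?z ^ 2) + ?z ^ 2"
    unfolding sampling_steps_def by (intro add_mono sum_mono order_trans[OF _ 4]) simp_all
  also have "\<dots> = (2 * CARD('o) + 1) * ?z ^ 2"
    by (simp add: algebra_simps)
  finally show ?thesis .
qed

lemma iteration_time_le:
  fixes \<P> :: "('d::finite, 'w::finite, 'o::finite) ppm"
  assumes "polynomial_search ops" "ppm_problem \<P>"
  obtains A B where "0 < A" "0 < B"
    "\<And>r N. (\<Sum>n = 1..N. sampling_steps \<P> r n + ops \<P> r n) \<le> A * (N + 1) ^ B"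
proof -
  let ?m = "CARD('o)"
  from assms obtain C k where ops: "\<And>r n. ops \<P> r n \<le> C * card (search_states \<P> r n) ^ k"
    unfolding polynomial_search_def by blast
  define c where "c = (?m + 2) * (?m + 1)"
  \<comment> \<open>The first summand bounds the degree of the search cost, the second that of the
    sampling cost; using the sum of both covers either. The factor \<open>2 ^ b\<close> in
    \<open>A\<close> arises from \<open>2 * n + 2 = 2 * (n + 1)\<close>.\<close>
  define b where "b = (?m + 4) * k + 2"
  define A where "A = (2 * ?m + 1 + C * c ^ k) * 2 ^ b"
  have step: "sampling_steps \<P> r n + ops \<P> r n \<le> A * (n + 1) ^ b" for r n
  proof -
    let ?z = "2 * n + 2"
    have "ops \<P> r n \<le> C * card (search_states \<P> r n) ^ k" by (rule ops)
    also have "\<dots> \<le> C * (c * ?z ^ (?m + 4)) ^ k"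
      unfolding c_def by (intro mult_le_mono2 power_mono card_search_states_le) simp
    also have "\<dots> = C * c ^ k * ?z ^ ((?m + 4) * k)"
      by (simp only: power_mult_distrib power_mult mult.assoc)
    also have "\<dots> \<le> C * c ^ k * ?z ^ b"
      by (intro mult_le_mono2 power_increasing) (auto simp: b_def)
    finally have o: "ops \<P> r n \<le> C * c ^ k * ?z ^ b" .
    have "sampling_steps \<P> r n \<le> (2 * ?m + 1) * ?z ^ 2" by (rule sampling_steps_le)
    also have "\<dots> \<le> (2 * ?m + 1) * ?z ^ b"
      by (intro mult_le_mono2 power_increasing) (auto simp: b_def)
    finally have "sampling_steps \<P> r n + ops \<P> r n \<le> (2 * ?m + 1) * ?z ^ b + C * c ^ k * ?z ^ b"
      using o by (rule add_mono)
    also have "\<dots> = (2 * ?m + 1 + C * c ^ k) * ?z ^ b"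
      by (simp only: distrib_right)
    also have "?z ^ b = 2 ^ b * (n + 1) ^ b"
      by (simp add: power_mult_distrib[symmetric])
    finally show ?thesis by (simp only: A_def mult.assoc)
  qed
  show ?thesis
  \<comment> \<open>Adding up \<open>N\<close> iterations raises the degree by one.\<close>
  proof (rule that[of A "b + 1"])
    fix r N
    have "(\<Sum>n = 1..N. sampling_steps \<P> r n + ops \<P> r n) \<le> (\<Sum>n = 1..N. A * (N + 1) ^ b)"
      by (intro sum_mono order_trans[OF step] mult_le_mono2 power_mono) auto
    also have "\<dots> \<le> A * (N + 1) ^ (b + 1)"
      by (simp add: algebra_simps)
    finally show "(\<Sum>n = 1..N. sampling_steps \<P> r n + ops \<P> r n) \<le> A * (N + 1) ^ (b + 1)" .
  qed (simp_all add: A_def b_def)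
qed

text \<open>If \<open>m\<close> iterations fit into \<open>t\<close> time steps, then not having
  halted by time \<open>t\<close> means not having halted within \<open>m\<close> iterations. The
  largest such \<open>m\<close> grows like \<open>t\<close> to the power
  \<open>1 / B\<close>.\<close>

lemma exponential_tail_transfer:
  fixes A B :: nat
  assumes N: "exponential_tail 1 M N" and T: "T \<in> measurable M (count_space UNIV)"
    and A: "0 < A" and B: "0 < B"
    and le: "\<And>r m t. N r \<le> enat m \<Longrightarrow> A * (m + 1) ^ B \<le> t \<Longrightarrow> T r \<le> enat t"
  shows "exponential_tail (1 / B) M T"
proof -
  from N interpret prob_space M by (simp add: exponential_tail_def)
  from N obtain C a where C: "0 < C" and a: "0 < a"
    and N_meas: "N \<in> measurable M (count_space UNIV)"
    and tail: "\<And>t::nat. measure M {r \<in> space M. enat t < N r} \<le> C * exp (- a * real t powr 1)"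
    unfolding exponential_tail_def by blast
  define b where "b = 1 / real B"
  have b: "0 < b" using B by (simp add: b_def)
  \<comment> \<open>The factor \<open>exp (2 * a)\<close> pays for replacing \<open>m\<close> by
    \<open>s - 2\<close>; with \<open>max 1 C\<close> in front the bound is at least 1, hence
    trivial, for \<open>s < 2\<close>.\<close>
  define c where "c = max 1 C * exp (2 * a)"
  define a' where "a' = a / real A powr b"
  have "measure M {r \<in> space M. enat t < T r} \<le> c * exp (- a' * real t powr b)" for t :: nat
  proof -
    define s where "s = (real t / real A) powr b"
    have as: "a' * real t powr b = a * s"
      using A by (simp add: a'_def s_def powr_divide)
    have s0: "0 \<le> s" by (simp add: s_def)
    have cexp: "c * exp (- a' * real t powr b) = max 1 C * exp (- a * (s - 2))"
      by (simp add: c_def as algebra_simps flip: exp_add)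
    show ?thesis
    proof (cases "s < 2")
      case True
      then have "1 \<le> exp (- a * (s - 2))" using a by (simp add: mult_nonneg_nonpos)
      then have "1 * 1 \<le> max 1 C * exp (- a * (s - 2))" by (intro mult_mono) auto
      with cexp prob_le_1 show ?thesis by (metis mult_1 order_trans)
    next
      case False
      \<comment> \<open>\<open>m + 1\<close> is the integer part of \<open>s\<close>: one unit is
        lost to rounding and one to the shift in \<open>(m + 1) ^ B\<close>.\<close>
      define m where "m = nat \<lfloor>s\<rfloor> - 1"
      have m: "real m + 1 \<le> s" "s - 2 \<le> real m"
        using False by (auto simp: m_def) linarith+
      have "t \<noteq> 0"
      proof
        assume "t = 0"
        with False show False by (simp add: s_def)
      qed
      have "(real m + 1) ^ B \<le> s ^ B" using m(1) by (intro power_mono) auto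
      also have "s ^ B = real t / real A"
        using powr_realpow[of s B] False B A \<open>t \<noteq> 0\<close> by (simp add: s_def b_def powr_powr)
      finally have "real A * (real m + 1) ^ B \<le> real t"
        using A by (simp add: field_simps)
      then have mt: "A * (m + 1) ^ B \<le> t"
        by (metis (mono_tags, lifting) of_nat_1 of_nat_add of_nat_le_iff of_nat_mult of_nat_power)
      have "{r \<in> space M. enat t < T r} \<subseteq> {r \<in> space M. enat m < N r}"
        using le[OF _ mt] by (auto simp: not_less[symmetric])
      then have "measure M {r \<in> space M. enat t < T r} \<le> measure M {r \<in> space M. enat m < N r}"
        using measurable_sets[OF N_meas, of "{x. enat m < x}"]
        by (intro finite_measure_mono) (auto simp: vimage_def Int_def conj_commute)
      also have "\<dots> \<le> C * exp (- a * real m)" using tail[of m] by simp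
      also have "\<dots> \<le> max 1 C * exp (- a * (s - 2))"
        using m(2) a C by (intro mult_mono) auto
      finally show ?thesis by (simp only: cexp)
    qed
  qed
  moreover have "0 < c" "0 < a'" using a A by (simp_all add: c_def a'_def)
  ultimately show ?thesis
    unfolding exponential_tail_def b_def using prob_space_axioms T by blast
qed

lemma exponential_tail_LIMSEQ:
  assumes "exponential_tail b M T" "0 < b"
  shows "(\<lambda>t. measure M {r \<in> space M. T r \<le> enat t}) \<longlonglongrightarrow> 1"
proof -
  from assms interpret prob_space M by (simp add: exponential_tail_def)
  from assms obtain C a where C: "0 < C" and a: "0 < a"
    and meas: "T \<in> measurable M (count_space UNIV)"
    and tail: "\<And>t::nat. measure M {r \<in> space M. enat t < T r} \<le> C * exp (- a * real t powr b)"
    unfolding exponential_tail_def by blast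
  have eq: "measure M {r \<in> space M. T r \<le> enat t} = 1 - measure M {r \<in> space M. enat t < T r}" for t
  proof -
    have "{r \<in> space M. enat t < T r} \<in> sets M"
      using measurable_sets[OF meas, of "{x. enat t < x}"] by (simp add: vimage_def Int_def conj_commute)
    moreover have "{r \<in> space M. T r \<le> enat t} = space M - {r \<in> space M. enat t < T r}" by auto
    ultimately show ?thesis by (simp add: prob_compl)
  qed
  have "filterlim (\<lambda>x. exp (b * ln x)) at_top (at_top :: real filter)"
    by (intro filterlim_compose[OF exp_at_top] filterlim_tendsto_pos_mult_at_top[OF tendsto_const assms(2)] ln_at_top)
  moreover have "\<forall>\<^sub>F x in at_top. exp (b * ln x) = x powr b"
    using eventually_gt_at_top[of "0::real"] by eventually_elim (simp add: powr_def)
  ultimately have "filterlim (\<lambda>x::real. x powr b) at_top at_top"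
    by (simp cong: filterlim_cong)
  then have "filterlim (\<lambda>t::nat. real t powr b) at_top sequentially"
    by (rule filterlim_compose[OF _ filterlim_real_sequentially])
  then have "filterlim (\<lambda>t::nat. a * real t powr b) at_top sequentially"
    by (rule filterlim_tendsto_pos_mult_at_top[OF tendsto_const a])
  then have "filterlim (\<lambda>t::nat. - a * real t powr b) at_bot sequentially"
    by (simp add: filterlim_uminus_at_bot)
  then have lim: "(\<lambda>t::nat. C * exp (- a * real t powr b)) \<longlonglongrightarrow> 0"
    by (intro tendsto_mult_right_zero filterlim_compose[OF exp_at_bot])
  have "(\<lambda>t. measure M {r \<in> space M. enat t < T r}) \<longlonglongrightarrow> 0"
  proof (rule tendsto_sandwich[OF _ _ tendsto_const lim])
    show "\<forall>\<^sub>F t in sequentially. measure M {r \<in> space M. enat t < T r} \<le> C * exp (- a * real t powr b)"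
      by (intro always_eventually allI tail)
  qed simp
  then have "(\<lambda>t. 1 - measure M {r \<in> space M. enat t < T r}) \<longlonglongrightarrow> 1 - 0"
    by (intro tendsto_intros)
  then show ?thesis by (simp add: eq)
qed

section \<open>Tails of the number of iterations and of the time\<close>

context valid_ppm
begin

lemma card_poses_measurable: "(\<lambda>r. card (poses \<P> r n i)) \<in> measurable (run_law \<P>) (count_space UNIV)"
proof -
  let ?A = "{a. a \<le> 2 * n \<and> pose_defined \<P> i a}"
  have "finite ?A" by (rule finite_subset[of _ "{..2 * n}"]) auto
  note eq = card_image_eq_card_first[OF this]
  have "Measurable.pred (run_law \<P>) (\<lambda>r. a \<in> ?A \<and>
      (\<forall>a'\<in>?A. a' < a \<longrightarrow> pose_value \<P> r i a' \<noteq> pose_value \<P> r i a))" for a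
    using \<open>finite ?A\<close>
    by (intro pred_intros_logic pred_intros_finite pred_eq_borel pose_value_measurable) simp_all
  then show ?thesis
    unfolding poses_eq eq by (intro measurable_card) (simp add: pred_def)
qed

lemma card_grasps_measurable: "(\<lambda>r. card (grasps \<P> r n i)) \<in> measurable (run_law \<P>) (count_space UNIV)"
proof -
  let ?A = "{a. a \<le> 2 * n \<and> grasp_defined \<P> i a}"
  have "finite ?A" by (rule finite_subset[of _ "{..2 * n}"]) auto
  note eq = card_image_eq_card_first[OF this]
  have "Measurable.pred (run_law \<P>) (\<lambda>r. a \<in> ?A \<and>
      (\<forall>a'\<in>?A. a' < a \<longrightarrow> grasp_value \<P> r i a' \<noteq> grasp_value \<P> r i a))" for a
    using \<open>finite ?A\<close>
    by (intro pred_intros_logic pred_intros_finite pred_eq_borel grasp_value_measurable) simp_all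
  then show ?thesis
    unfolding grasps_eq eq by (intro measurable_card) (simp add: pred_def)
qed

lemma sampling_steps_measurable: "(\<lambda>r. sampling_steps \<P> r n) \<in> measurable (run_law \<P>) (count_space UNIV)"
proof -
  have "(\<lambda>r. card (poses \<P> r n i) * card (grasps \<P> r n i)) \<in> measurable (run_law \<P>) (count_space UNIV)" for i
    by (rule measurable_nat_binary[where F = "(*)", OF card_poses_measurable card_grasps_measurable])
  then show ?thesis
    unfolding sampling_steps_def
    by (intro measurable_nat_binary[where F = "(+)"] measurable_nat_sum) simp_all
qed

lemma ffrob_time_measurable:
  assumes "polynomial_search ops"
  shows "ffrob_time ops \<P> \<in> measurable (run_law \<P>) (count_space UNIV)"
proof -
  have ops: "(\<lambda>r. ops \<P> r n) \<in> measurable (run_law \<P>) (count_space UNIV)" for n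
    using assms problem by (auto simp: polynomial_search_def)
  have sum: "(\<lambda>r. \<Sum>n = 1..N. sampling_steps \<P> r n + ops \<P> r n) \<in> measurable (run_law \<P>) (count_space UNIV)" for N
    by (intro measurable_nat_sum measurable_nat_binary[where F = "(+)"] sampling_steps_measurable ops)
  have "(\<lambda>r. case k of enat N \<Rightarrow> enat (\<Sum>n = 1..N. sampling_steps \<P> r n + ops \<P> r n) | \<infinity> \<Rightarrow> \<infinity>) \<in>
      measurable (run_law \<P>) (count_space UNIV)" for k :: enat
  proof (cases k)
    case (enat N)
    have "(\<lambda>r. enat (\<Sum>n = 1..N. sampling_steps \<P> r n + ops \<P> r n)) \<in>
        measurable (run_law \<P>) (count_space UNIV)"
      by (rule measurable_compose[OF sum measurable_count_space])
    then show ?thesis by (simp add: enat del: One_nat_def)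
  qed simp
  from measurable_compose_countable[OF this ffrob_iterations_measurable]
  show ?thesis by (simp add: ffrob_time_def[abs_def])
qed

text \<open>Failure decays geometrically in the number of completed blocks of length
  \<open>n\<close>, which gives the rate \<open>a / n\<close>.\<close>

lemma iterations_tail:
  assumes "robustly_feasible \<P>"
  shows "exponential_tail 1 (run_law \<P>) (ffrob_iterations \<P>)"
proof -
  interpret R: prob_space "run_law \<P>" by (rule prob_space_run_law)
  obtain p n where p: "0 < p" "p \<le> 1 / 2" and n: "0 < n"
    and block: "\<And>h m. ennreal p \<le> emeasure (run_law \<P>) {r. solved \<P> (comb_seq (Suc m) h r) (m + n)}"
    by (rule block_success[OF assms]) (rule that)
  define a where "a = - ln (1 - p)"
  have a: "0 < a" using p by (simp add: a_def)
  have "measure (run_law \<P>) {r \<in> space (run_law \<P>). enat t < ffrob_iterations \<P> r} \<le>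
      exp a * exp (- (a / n) * real t powr 1)" for t :: nat
  proof (cases "t = 0")
    \<comment> \<open>The count of iterations starts at 1, so a plan at 0 would not make it 0; the
      bound is at least 1 here anyway.\<close>
    case True
    then show ?thesis using a by (intro order_trans[OF R.prob_le_1]) simp
  next
    case False
    define j where "j = t div n"
    have "j * n \<le> t" by (simp add: j_def)
    have "{r \<in> space (run_law \<P>). enat t < ffrob_iterations \<P> r} \<subseteq> {r. \<not> solved \<P> r (j * n)}"
    proof
      fix r assume r: "r \<in> {r \<in> space (run_law \<P>). enat t < ffrob_iterations \<P> r}"
      have "\<not> solved \<P> r t"
      proof
        assume s: "solved \<P> r t"
        then have "(LEAST n. 1 \<le> n \<and> solved \<P> r n) \<le> t" using False by (intro Least_le) simp
        moreover have "\<exists>n\<ge>1. solved \<P> r n" using s False by (intro exI[of _ t]) simp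
        ultimately show False using r by (simp add: ffrob_iterations_def)
      qed
      then show "r \<in> {r. \<not> solved \<P> r (j * n)}"
        using solved_mono[OF \<open>j * n \<le> t\<close>] by auto
    qed
    moreover have "Measurable.pred (run_law \<P>) (\<lambda>r. \<not> solved \<P> r (j * n))" by measurable
    ultimately have "measure (run_law \<P>) {r \<in> space (run_law \<P>). enat t < ffrob_iterations \<P> r} \<le>
        measure (run_law \<P>) {r. \<not> solved \<P> r (j * n)}"
      by (intro R.finite_measure_mono) (simp_all add: pred_def)
    also have "\<dots> \<le> (1 - p) ^ j"
      using not_solved_decay[OF p block, of j] p by (simp add: R.emeasure_eq_measure)
    also have "\<dots> = exp (- a * j)"
      using p by (simp add: a_def flip: powr_realpow) (simp add: powr_def mult.commute)
    \<comment> \<open>The unfinished block costs at most one unit of \<open>j\<close>, that is the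
      factor \<open>exp a\<close>.\<close>
    also have "\<dots> \<le> exp (a - (a / n) * t)"
    proof -
      have "t \<le> (j + 1) * n"
        unfolding j_def add_mult_distrib
        using mod_less_divisor[OF n, of t] div_mult_mod_eq[of t n] by linarith
      then have "real t \<le> real ((j + 1) * n)" by (simp only: of_nat_le_iff)
      then have "real t / n \<le> j + 1" using n by (simp add: divide_le_eq algebra_simps)
      then have "a * (real t / n) \<le> a * (j + 1)" using a by (intro mult_left_mono) auto
      then show ?thesis by (simp add: algebra_simps)
    qed
    also have "\<dots> = exp a * exp (- (a / n) * real t powr 1)"
      by (simp flip: exp_add)
    finally show ?thesis .
  qed
  moreover have "0 < exp a" "0 < a / n" using a n by simp_all
  ultimately show ?thesis
    unfolding exponential_tail_def using prob_space_run_law ffrob_iterations_measurable by blast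
qed

lemma time_tail:
  assumes "robustly_feasible \<P>" "polynomial_search ops"
  shows "\<exists>b>0. exponential_tail b (run_law \<P>) (ffrob_time ops \<P>)"
proof -
  obtain A B where A: "0 < A" and B: "0 < B"
    and le: "\<And>r N. (\<Sum>n = 1..N. sampling_steps \<P> r n + ops \<P> r n) \<le> A * (N + 1) ^ B"
    by (rule iteration_time_le[OF assms(2) problem]) (rule that)
  have "exponential_tail (1 / B) (run_law \<P>) (ffrob_time ops \<P>)"
  proof (rule exponential_tail_transfer[OF iterations_tail[OF assms(1)] ffrob_time_measurable[OF assms(2)] A B])
    fix r m t assume "ffrob_iterations \<P> r \<le> enat m" and mt: "A * (m + 1) ^ B \<le> t"
    then obtain N where N: "ffrob_iterations \<P> r = enat N" "N \<le> m"
      by (cases "ffrob_iterations \<P> r") auto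
    have "(\<Sum>n = 1..N. sampling_steps \<P> r n + ops \<P> r n) \<le> A * (N + 1) ^ B" by (rule le)
    also have "\<dots> \<le> A * (m + 1) ^ B" using N(2) by (intro mult_le_mono2 power_mono) auto
    also note mt
    finally show "ffrob_time ops \<P> r \<le> enat t" by (simp add: ffrob_time_def N(1))
  qed
  with B show ?thesis by (intro exI[of _ "1 / B"]) simp
qed

end

theorem theorem4:
  fixes ops :: "('d::finite, 'w::finite, 'o::finite) ppm \<Rightarrow> ('d, 'w, 'o) run \<Rightarrow> nat \<Rightarrow> nat"
  assumes "polynomial_search ops"
  shows "probabilistically_complete run_law (ffrob_time ops) {\<P>. robustly_feasible \<P>} \<and>
    exponentially_convergent run_law (ffrob_time ops) {\<P>. robustly_feasible \<P>} \<and>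
    exponentially_convergent_iterations run_law ffrob_iterations
      {\<P> :: ('d, 'w, 'o) ppm. robustly_feasible \<P>}"
proof -
  have V: "valid_ppm \<P>" if "robustly_feasible \<P>" for \<P> :: "('d, 'w, 'o) ppm"
    using that by (simp add: valid_ppm_def robustly_feasible_def)
  have time: "\<exists>b>0. exponential_tail b (run_law \<P>) (ffrob_time ops \<P>)"
    if "robustly_feasible \<P>" for \<P> :: "('d, 'w, 'o) ppm"
    using valid_ppm.time_tail[OF V[OF that] that assms] .
  have "prob_space (run_law \<P>) \<and> ffrob_time ops \<P> \<in> measurable (run_law \<P>) (count_space UNIV) \<and>
     (\<lambda>t. measure (run_law \<P>) {r \<in> space (run_law \<P>). ffrob_time ops \<P> r \<le> enat t}) \<longlonglongrightarrow> 1"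
    if "robustly_feasible \<P>" for \<P> :: "('d, 'w, 'o) ppm"
    using time[OF that] exponential_tail_LIMSEQ valid_ppm.prob_space_run_law[OF V[OF that]]
      valid_ppm.ffrob_time_measurable[OF V[OF that] assms] by blast
  moreover have "exponential_tail 1 (run_law \<P>) (ffrob_iterations \<P>)"
    if "robustly_feasible \<P>" for \<P> :: "('d, 'w, 'o) ppm"
    using valid_ppm.iterations_tail[OF V[OF that] that] .
  ultimately show ?thesis
    using time unfolding probabilistically_complete_def exponentially_convergent_def
      exponentially_convergent_iterations_def by blast
qed

end
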